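(* Let $M$ be an isometrically immersed invariant submanifold, of codimension $r$, of a locally metallic Riemannian manifold $(\bar M,J,g)$ with $J^2=pJ+qI$. Then for any $X,Y\in\Gamma(TM)$: $$\nabla J=0,$$ $$\sum_{\alpha=1}^rh_\alpha(X,JY)N_\alpha=\sum_{\alpha=1}^rh_\alpha(X,Y)JN_\alpha=\sum_{\alpha=1}^rh_\alpha(JX,Y)N_\alpha,$$ $$h_\alpha(JX,JY)=p\,h_\alpha(X,JY)+q\,h_\alpha(X,Y)\quad\text{for any }1\le\alpha\le r.$$
   Context: A metallic Riemannian manifold $(\bar M,J,g)$ is a smooth manifold with a $(1,1)$-tensor field $J$ satisfying $J^2=pJ+qI$ for some positive integers $p,q$ and a Riemannian metric $g$ with $g(JX,Y)=g(X,JY)$ for all vector fields $X,Y$. It is locally metallic if $\bar\nabla J=0$, where $\bar\nabla$ is the Levi-Civita connection of $(\bar M,g)$. A submanifold $M$ is invariant if $J(T_xM)\subset T_xM$ for all $x\in M$. $\nabla$ is the Levi-Civita connection of the induced metric on $M$, $\{N_1,\dots,N_r\}$ a (local) orthonormal frame of the normal bundle, and $h_\alpha$ are the symmetric second fundamental tensors defined by $\bar\nabla_XY=\nabla_XY+\sum_\alpha h_\alpha(X,Y)N_\alpha$ for $X,Y\in\Gamma(TM)$. $\nabla J=0$ refers to the restriction of $J$ to $TM$: $(\nabla_XJ)Y:=\nabla_X(JY)-J(\nabla_XY)$ for $X,Y\in\Gamma(TM)$. *)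

theory Defs
  imports "HOL-Analysis.Analysis" "HOL-Library.Function_Algebras"
begin

section \<open>Functions into a real vector space\<close>

instantiation "fun" :: (type, real_vector) real_vector
begin

definition scaleR_fun :: "real \<Rightarrow> ('a \<Rightarrow> 'b) \<Rightarrow> 'a \<Rightarrow> 'b" where
  "scaleR_fun r f = (\<lambda>x. r *\<^sub>R f x)"

instance
  by standard (simp_all add: scaleR_fun_def plus_fun_def scaleR_add_left scaleR_add_right)

end

lemma scaleR_fun_apply [simp]: "(r *\<^sub>R f) x = r *\<^sub>R f x"
  by (simp add: scaleR_fun_def)


section \<open>Smooth manifolds\<close>

text \<open>
  Class \<open>C\<^sup>k\<close> for a map defined on (at least) an open subset \<open>S\<close> of a Euclidean space:
  iterated directional derivatives exist and are continuous.
\<close>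

primrec Ck_on ::
    "nat \<Rightarrow> 'a::euclidean_space set \<Rightarrow> ('a \<Rightarrow> 'b::real_normed_vector) \<Rightarrow> bool" where
  "Ck_on 0 S F \<longleftrightarrow> continuous_on S F"
| "Ck_on (Suc k) S F \<longleftrightarrow>
     (\<forall>x\<in>S. F differentiable (at x)) \<and>
     (\<forall>v. Ck_on k S (\<lambda>x. frechet_derivative F (at x) v))"

definition smooth_on ::
    "'a::euclidean_space set \<Rightarrow> ('a \<Rightarrow> 'b::real_normed_vector) \<Rightarrow> bool" where
  "smooth_on S F \<longleftrightarrow> (\<forall>k. Ck_on k S F)"

text \<open>
  A chart is a pair of its domain and its coordinate map; the values of the coordinate map
  outside the domain are irrelevant. A manifold is a Hausdorff, second countable type
  together with a (not necessarily maximal) smooth atlas that covers the whole type.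
\<close>

type_synonym ('m, 'e) chart = "'m set \<times> ('m \<Rightarrow> 'e)"

abbreviation chart_inv :: "('m, 'e) chart \<Rightarrow> 'e \<Rightarrow> 'm" where
  "chart_inv c \<equiv> inv_into (fst c) (snd c)"

definition smooth_atlas ::
    "('m::{t2_space,second_countable_topology}, 'e::euclidean_space) chart set \<Rightarrow> bool" where
  "smooth_atlas A \<longleftrightarrow>
     (\<forall>c\<in>A. open (fst c) \<and> open (snd c ` fst c) \<and>
            homeomorphism (fst c) (snd c ` fst c) (snd c) (chart_inv c)) \<and>
     (\<Union>c\<in>A. fst c) = UNIV \<and>
     (\<forall>c\<in>A. \<forall>d\<in>A. smooth_on (snd c ` (fst c \<inter> fst d)) (snd d \<circ> chart_inv c))"

definition smooth_function ::
    "('m, 'e::euclidean_space) chart set \<Rightarrow> 'm set \<Rightarrow> ('m \<Rightarrow> 'b::real_normed_vector) \<Rightarrow> bool" where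
  "smooth_function A U F \<longleftrightarrow> (\<forall>c\<in>A. smooth_on (snd c ` (U \<inter> fst c)) (F \<circ> chart_inv c))"

definition smooth_map ::
    "('m::topological_space, 'e::euclidean_space) chart set \<Rightarrow>
     ('n::topological_space, 'f::euclidean_space) chart set \<Rightarrow> ('m \<Rightarrow> 'n) \<Rightarrow> bool" where
  "smooth_map A B f \<longleftrightarrow> continuous_on UNIV f \<and>
     (\<forall>d\<in>B. smooth_function A (f -` fst d) (snd d \<circ> f))"


section \<open>Tangent vectors and vector fields\<close>

text \<open>
  A tangent vector at \<open>x\<close> is the family of its components in all charts of the atlas around
  \<open>x\<close>, related by the contravariant transformation law. Components in charts that do
  not contain \<open>x\<close> are set to \<open>0\<close>, so that the family is determined by any one of the
  relevant components.
\<close>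

type_synonym ('m, 'e) tvec = "('m, 'e) chart \<Rightarrow> 'e"

definition tangent_space ::
    "('m, 'e::euclidean_space) chart set \<Rightarrow> 'm \<Rightarrow> ('m, 'e) tvec set" where
  "tangent_space A x = {v.
     (\<forall>c\<in>A. \<forall>d\<in>A. x \<in> fst c \<longrightarrow> x \<in> fst d \<longrightarrow>
        v d = frechet_derivative (snd d \<circ> chart_inv c) (at (snd c x)) (v c)) \<and>
     (\<forall>c. \<not> (c \<in> A \<and> x \<in> fst c) \<longrightarrow> v c = 0)}"

text \<open>
  Vector fields and other local objects are total functions of which only the restriction to
  the open set \<open>U\<close> matters.
\<close>

definition vector_field ::
    "('m, 'e::euclidean_space) chart set \<Rightarrow> 'm set \<Rightarrow> ('m \<Rightarrow> ('m, 'e) tvec) \<Rightarrow> bool" where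
  "vector_field A U X \<longleftrightarrow>
     (\<forall>x\<in>U. X x \<in> tangent_space A x) \<and>
     (\<forall>c\<in>A. smooth_function A (U \<inter> fst c) (\<lambda>x. X x c))"

text \<open>
  The derivative of a function \<open>F\<close>, smooth near \<open>x\<close>, in the direction of a tangent vector
  \<open>v\<close> at \<open>x\<close>. By the transformation law the choice of the chart around \<open>x\<close> is immaterial.
\<close>

definition tangent_deriv ::
    "('m, 'e::euclidean_space) chart set \<Rightarrow> 'm \<Rightarrow> ('m, 'e) tvec \<Rightarrow>
     ('m \<Rightarrow> 'b::real_normed_vector) \<Rightarrow> 'b" where
  "tangent_deriv A x v F =
     (let c = (SOME c. c \<in> A \<and> x \<in> fst c)
      in frechet_derivative (F \<circ> chart_inv c) (at (snd c x)) (v c))"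

definition differential ::
    "('m, 'e::euclidean_space) chart set \<Rightarrow> ('n, 'f::euclidean_space) chart set \<Rightarrow>
     ('m \<Rightarrow> 'n) \<Rightarrow> 'm \<Rightarrow> ('m, 'e) tvec \<Rightarrow> ('n, 'f) tvec" where
  "differential A B f x v =
     (\<lambda>d. if d \<in> B \<and> f x \<in> fst d then tangent_deriv A x v (snd d \<circ> f) else 0)"

definition lie_bracket ::
    "('m, 'e::euclidean_space) chart set \<Rightarrow> ('m \<Rightarrow> ('m, 'e) tvec) \<Rightarrow> ('m \<Rightarrow> ('m, 'e) tvec) \<Rightarrow>
     'm \<Rightarrow> ('m, 'e) tvec" where
  "lie_bracket A X Y x =
     (\<lambda>c. if c \<in> A \<and> x \<in> fst c
          then tangent_deriv A x (X x) (\<lambda>y. Y y c) - tangent_deriv A x (Y x) (\<lambda>y. X y c)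
          else 0)"

definition tensor_field_11 ::
    "('m::topological_space, 'e::euclidean_space) chart set \<Rightarrow>
     ('m \<Rightarrow> ('m, 'e) tvec \<Rightarrow> ('m, 'e) tvec) \<Rightarrow> bool" where
  "tensor_field_11 A J \<longleftrightarrow>
     (\<forall>x. \<forall>u\<in>tangent_space A x. J x u \<in> tangent_space A x \<and>
        (\<forall>v\<in>tangent_space A x. J x (u + v) = J x u + J x v) \<and>
        (\<forall>r. J x (r *\<^sub>R u) = r *\<^sub>R J x u)) \<and>
     (\<forall>U X. open U \<and> vector_field A U X \<longrightarrow> vector_field A U (\<lambda>x. J x (X x)))"


section \<open>Riemannian metrics and the Levi-Civita connection\<close>

definition riemannian_metric ::
    "('m::topological_space, 'e::euclidean_space) chart set \<Rightarrow>
     ('m \<Rightarrow> ('m, 'e) tvec \<Rightarrow> ('m, 'e) tvec \<Rightarrow> real) \<Rightarrow> bool" where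
  "riemannian_metric A g \<longleftrightarrow>
     (\<forall>x. \<forall>u\<in>tangent_space A x.
        (\<forall>v\<in>tangent_space A x. g x u v = g x v u \<and>
           (\<forall>w\<in>tangent_space A x. g x (u + v) w = g x u w + g x v w) \<and>
           (\<forall>r. g x (r *\<^sub>R u) v = r * g x u v)) \<and>
        (u \<noteq> 0 \<longrightarrow> g x u u > 0)) \<and>
     (\<forall>U X Y. open U \<and> vector_field A U X \<and> vector_field A U Y \<longrightarrow>
        smooth_function A U (\<lambda>x. g x (X x) (Y x)))"

text \<open>
  \<open>nabla X Y\<close> stands for \<open>\<nabla>\<^sub>X Y\<close>. The operator acts on vector fields over arbitrary open
  sets, and the last clause makes it compatible with restriction.
\<close>

definition affine_connection ::
    "('m::topological_space, 'e::euclidean_space) chart set \<Rightarrow>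
     (('m \<Rightarrow> ('m, 'e) tvec) \<Rightarrow> ('m \<Rightarrow> ('m, 'e) tvec) \<Rightarrow> 'm \<Rightarrow> ('m, 'e) tvec) \<Rightarrow> bool" where
  "affine_connection A nabla \<longleftrightarrow>
     (\<forall>U X Y. open U \<and> vector_field A U X \<and> vector_field A U Y \<longrightarrow>
        vector_field A U (nabla X Y) \<and>
        (\<forall>Z. vector_field A U Z \<longrightarrow>
           (\<forall>x\<in>U. nabla (X + Z) Y x = nabla X Y x + nabla Z Y x \<and>
                  nabla X (Y + Z) x = nabla X Y x + nabla X Z x)) \<and>
        (\<forall>a. smooth_function A U a \<longrightarrow>
           (\<forall>x\<in>U. nabla (\<lambda>y. a y *\<^sub>R X y) Y x = a x *\<^sub>R nabla X Y x \<and>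
                  nabla X (\<lambda>y. a y *\<^sub>R Y y) x =
                    a x *\<^sub>R nabla X Y x + tangent_deriv A x (X x) a *\<^sub>R Y x)) \<and>
        (\<forall>X' Y'. (\<forall>x\<in>U. X' x = X x \<and> Y' x = Y x) \<longrightarrow>
           (\<forall>x\<in>U. nabla X' Y' x = nabla X Y x)))"

definition levi_civita ::
    "('m::topological_space, 'e::euclidean_space) chart set \<Rightarrow>
     ('m \<Rightarrow> ('m, 'e) tvec \<Rightarrow> ('m, 'e) tvec \<Rightarrow> real) \<Rightarrow>
     (('m \<Rightarrow> ('m, 'e) tvec) \<Rightarrow> ('m \<Rightarrow> ('m, 'e) tvec) \<Rightarrow> 'm \<Rightarrow> ('m, 'e) tvec) \<Rightarrow> bool" where
  "levi_civita A g nabla \<longleftrightarrow>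
     affine_connection A nabla \<and>
     (\<forall>U X Y. open U \<and> vector_field A U X \<and> vector_field A U Y \<longrightarrow>
        (\<forall>x\<in>U. nabla X Y x - nabla Y X x = lie_bracket A X Y x)) \<and>
     (\<forall>U X Y Z. open U \<and> vector_field A U X \<and> vector_field A U Y \<and> vector_field A U Z \<longrightarrow>
        (\<forall>x\<in>U. tangent_deriv A x (X x) (\<lambda>y. g y (Y y) (Z y)) =
                 g x (nabla X Y x) (Z x) + g x (Y x) (nabla X Z x)))"

text \<open>\<open>(\<nabla>\<^sub>X J) Y\<close> for a field \<open>J\<close> of endomorphisms of the tangent spaces.\<close>

definition cov_deriv_endo ::
    "(('m \<Rightarrow> ('m, 'e) tvec) \<Rightarrow> ('m \<Rightarrow> ('m, 'e) tvec) \<Rightarrow> 'm \<Rightarrow> ('m, 'e::euclidean_space) tvec) \<Rightarrow>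
     ('m \<Rightarrow> ('m, 'e) tvec \<Rightarrow> ('m, 'e) tvec) \<Rightarrow>
     ('m \<Rightarrow> ('m, 'e) tvec) \<Rightarrow> ('m \<Rightarrow> ('m, 'e) tvec) \<Rightarrow> 'm \<Rightarrow> ('m, 'e) tvec" where
  "cov_deriv_endo nabla J X Y x = nabla X (\<lambda>y. J y (Y y)) x - J x (nabla X Y x)"

definition parallel_endo ::
    "('m::topological_space, 'e::euclidean_space) chart set \<Rightarrow>
     (('m \<Rightarrow> ('m, 'e) tvec) \<Rightarrow> ('m \<Rightarrow> ('m, 'e) tvec) \<Rightarrow> 'm \<Rightarrow> ('m, 'e) tvec) \<Rightarrow>
     ('m \<Rightarrow> ('m, 'e) tvec \<Rightarrow> ('m, 'e) tvec) \<Rightarrow> bool" where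
  "parallel_endo A nabla J \<longleftrightarrow>
     (\<forall>U X Y. open U \<and> vector_field A U X \<and> vector_field A U Y \<longrightarrow>
        (\<forall>x\<in>U. cov_deriv_endo nabla J X Y x = 0))"


section \<open>Metallic Riemannian manifolds\<close>

definition metallic_riemannian ::
    "('m::{t2_space,second_countable_topology}, 'e::euclidean_space) chart set \<Rightarrow>
     ('m \<Rightarrow> ('m, 'e) tvec \<Rightarrow> ('m, 'e) tvec \<Rightarrow> real) \<Rightarrow>
     ('m \<Rightarrow> ('m, 'e) tvec \<Rightarrow> ('m, 'e) tvec) \<Rightarrow> nat \<Rightarrow> nat \<Rightarrow> bool" where
  "metallic_riemannian A g J p q \<longleftrightarrow>
     smooth_atlas A \<and> riemannian_metric A g \<and> tensor_field_11 A J \<and> p > 0 \<and> q > 0 \<and>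
     (\<forall>x. \<forall>u\<in>tangent_space A x. J x (J x u) = real p *\<^sub>R J x u + real q *\<^sub>R u) \<and>
     (\<forall>x. \<forall>u\<in>tangent_space A x. \<forall>v\<in>tangent_space A x. g x (J x u) v = g x u (J x v))"

definition locally_metallic ::
    "('m::{t2_space,second_countable_topology}, 'e::euclidean_space) chart set \<Rightarrow>
     ('m \<Rightarrow> ('m, 'e) tvec \<Rightarrow> ('m, 'e) tvec \<Rightarrow> real) \<Rightarrow>
     (('m \<Rightarrow> ('m, 'e) tvec) \<Rightarrow> ('m \<Rightarrow> ('m, 'e) tvec) \<Rightarrow> 'm \<Rightarrow> ('m, 'e) tvec) \<Rightarrow>
     ('m \<Rightarrow> ('m, 'e) tvec \<Rightarrow> ('m, 'e) tvec) \<Rightarrow> nat \<Rightarrow> nat \<Rightarrow> bool" where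
  "locally_metallic A g nabla J p q \<longleftrightarrow>
     metallic_riemannian A g J p q \<and> levi_civita A g nabla \<and> parallel_endo A nabla J"


section \<open>Isometrically immersed submanifolds\<close>

text \<open>
  Below, \<open>A\<close>, \<open>g\<close>, \<open>nabla\<close> belong to the submanifold, \<open>B\<close>, \<open>G\<close>, \<open>nablaB\<close> to the
  ambient manifold, and \<open>f\<close> is the immersion of the former into the latter.
\<close>

definition isometric_immersion ::
    "('m::{t2_space,second_countable_topology}, 'e::euclidean_space) chart set \<Rightarrow>
     ('m \<Rightarrow> ('m, 'e) tvec \<Rightarrow> ('m, 'e) tvec \<Rightarrow> real) \<Rightarrow>
     ('n::{t2_space,second_countable_topology}, 'f::euclidean_space) chart set \<Rightarrow>
     ('n \<Rightarrow> ('n, 'f) tvec \<Rightarrow> ('n, 'f) tvec \<Rightarrow> real) \<Rightarrow> ('m \<Rightarrow> 'n) \<Rightarrow> bool" where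
  "isometric_immersion A g B G f \<longleftrightarrow>
     smooth_map A B f \<and>
     (\<forall>x. inj_on (differential A B f x) (tangent_space A x)) \<and>
     (\<forall>x. \<forall>u\<in>tangent_space A x. \<forall>v\<in>tangent_space A x.
        g x u v = G (f x) (differential A B f x u) (differential A B f x v))"

definition invariant_submanifold ::
    "('m, 'e::euclidean_space) chart set \<Rightarrow> ('n, 'f::euclidean_space) chart set \<Rightarrow>
     ('n \<Rightarrow> ('n, 'f) tvec \<Rightarrow> ('n, 'f) tvec) \<Rightarrow> ('m \<Rightarrow> 'n) \<Rightarrow> bool" where
  "invariant_submanifold A B J f \<longleftrightarrow>
     (\<forall>x. J (f x) ` (differential A B f x ` tangent_space A x)
            \<subseteq> differential A B f x ` tangent_space A x)"

text \<open>
  The restriction of \<open>J\<close> to the tangent bundle of the submanifold, transported along the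
  injective differential of \<open>f\<close>.
\<close>

definition restrict_endo ::
    "('m, 'e::euclidean_space) chart set \<Rightarrow> ('n, 'f::euclidean_space) chart set \<Rightarrow>
     ('m \<Rightarrow> 'n) \<Rightarrow> ('n \<Rightarrow> ('n, 'f) tvec \<Rightarrow> ('n, 'f) tvec) \<Rightarrow>
     'm \<Rightarrow> ('m, 'e) tvec \<Rightarrow> ('m, 'e) tvec" where
  "restrict_endo A B f J x v =
     inv_into (tangent_space A x) (differential A B f x) (J (f x) (differential A B f x v))"

text \<open>
  The coordinate vector field in direction \<open>e\<close> of a chart \<open>c\<close>, the Christoffel symbols of a
  connection in \<open>c\<close> (as a bilinear map on the model space), and the covariant derivative
  along \<open>f\<close> in direction \<open>X\<close>, in coordinates
  \<open>X(V\<^sup>k) + \<Gamma>\<^sup>k\<^sub>i\<^sub>j(f) (df X)\<^sup>i V\<^sup>j\<close>, of a section \<open>V\<close> of the pull-back of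
  the ambient tangent bundle. For \<open>V = df Y\<close> it is the derivative of \<open>Y\<close> in direction \<open>X\<close> with respect
  to the ambient connection, both regarded as tangent to the ambient manifold.
\<close>

definition coord_field ::
    "('m, 'e::euclidean_space) chart set \<Rightarrow> ('m, 'e) chart \<Rightarrow> 'e \<Rightarrow> 'm \<Rightarrow> ('m, 'e) tvec" where
  "coord_field A c e x =
     (\<lambda>d. if d \<in> A \<and> x \<in> fst c \<and> x \<in> fst d
          then frechet_derivative (snd d \<circ> chart_inv c) (at (snd c x)) e else 0)"

definition christoffel ::
    "('m, 'e::euclidean_space) chart set \<Rightarrow>
     (('m \<Rightarrow> ('m, 'e) tvec) \<Rightarrow> ('m \<Rightarrow> ('m, 'e) tvec) \<Rightarrow> 'm \<Rightarrow> ('m, 'e) tvec) \<Rightarrow>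
     ('m, 'e) chart \<Rightarrow> 'm \<Rightarrow> 'e \<Rightarrow> 'e \<Rightarrow> 'e" where
  "christoffel A nabla c x u w = nabla (coord_field A c u) (coord_field A c w) x c"

definition cov_deriv_along ::
    "('m, 'e::euclidean_space) chart set \<Rightarrow> ('n, 'f::euclidean_space) chart set \<Rightarrow>
     (('n \<Rightarrow> ('n, 'f) tvec) \<Rightarrow> ('n \<Rightarrow> ('n, 'f) tvec) \<Rightarrow> 'n \<Rightarrow> ('n, 'f) tvec) \<Rightarrow>
     ('m \<Rightarrow> 'n) \<Rightarrow> ('m \<Rightarrow> ('m, 'e) tvec) \<Rightarrow> ('m \<Rightarrow> ('n, 'f) tvec) \<Rightarrow> 'm \<Rightarrow> ('n, 'f) tvec" where
  "cov_deriv_along A B nablaB f X V x =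
     (\<lambda>d. if d \<in> B \<and> f x \<in> fst d
          then tangent_deriv A x (X x) (\<lambda>y. V y d) +
               christoffel B nablaB d (f x) (differential A B f x (X x) d) (V x d)
          else 0)"

definition normal_space ::
    "('m, 'e::euclidean_space) chart set \<Rightarrow> ('n, 'f::euclidean_space) chart set \<Rightarrow>
     ('n \<Rightarrow> ('n, 'f) tvec \<Rightarrow> ('n, 'f) tvec \<Rightarrow> real) \<Rightarrow> ('m \<Rightarrow> 'n) \<Rightarrow> 'm \<Rightarrow> ('n, 'f) tvec set" where
  "normal_space A B G f x =
     {w \<in> tangent_space B (f x). \<forall>v\<in>tangent_space A x. G (f x) (differential A B f x v) w = 0}"

definition orthonormal_normal_frame ::
    "('m, 'e::euclidean_space) chart set \<Rightarrow> ('n, 'f::euclidean_space) chart set \<Rightarrow>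
     ('n \<Rightarrow> ('n, 'f) tvec \<Rightarrow> ('n, 'f) tvec \<Rightarrow> real) \<Rightarrow> ('m \<Rightarrow> 'n) \<Rightarrow>
     'm set \<Rightarrow> nat \<Rightarrow> (nat \<Rightarrow> 'm \<Rightarrow> ('n, 'f) tvec) \<Rightarrow> bool" where
  "orthonormal_normal_frame A B G f U r N \<longleftrightarrow>
     (\<forall>\<alpha>\<in>{1..r}. \<forall>d\<in>B. smooth_function A (U \<inter> f -` fst d) (\<lambda>x. N \<alpha> x d)) \<and>
     (\<forall>x\<in>U. span ((\<lambda>\<alpha>. N \<alpha> x) ` {1..r}) = normal_space A B G f x \<and>
        (\<forall>\<alpha>\<in>{1..r}. \<forall>\<beta>\<in>{1..r}. G (f x) (N \<alpha> x) (N \<beta> x) = (if \<alpha> = \<beta> then 1 else 0)))"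

text \<open>
  The functions \<open>h \<alpha> x\<close> are the second fundamental tensors with respect to the normal
  frame \<open>N\<close> over \<open>U\<close>: they are the coefficients in the Gauss formula. Since every pair of
  tangent vectors extends to local vector fields, the formula determines \<open>h \<alpha> x\<close> on the
  tangent space at \<open>x\<close>; its bilinearity and symmetry are consequences.
\<close>

definition second_fundamental_tensors ::
    "('m::topological_space, 'e::euclidean_space) chart set \<Rightarrow>
     ('n, 'f::euclidean_space) chart set \<Rightarrow>
     (('n \<Rightarrow> ('n, 'f) tvec) \<Rightarrow> ('n \<Rightarrow> ('n, 'f) tvec) \<Rightarrow> 'n \<Rightarrow> ('n, 'f) tvec) \<Rightarrow>
     (('m \<Rightarrow> ('m, 'e) tvec) \<Rightarrow> ('m \<Rightarrow> ('m, 'e) tvec) \<Rightarrow> 'm \<Rightarrow> ('m, 'e) tvec) \<Rightarrow>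
     ('m \<Rightarrow> 'n) \<Rightarrow> 'm set \<Rightarrow> nat \<Rightarrow> (nat \<Rightarrow> 'm \<Rightarrow> ('n, 'f) tvec) \<Rightarrow>
     (nat \<Rightarrow> 'm \<Rightarrow> ('m, 'e) tvec \<Rightarrow> ('m, 'e) tvec \<Rightarrow> real) \<Rightarrow> bool" where
  "second_fundamental_tensors A B nablaB nabla f U r N h \<longleftrightarrow>
     (\<forall>V X Y. open V \<and> V \<subseteq> U \<and> vector_field A V X \<and> vector_field A V Y \<longrightarrow>
        (\<forall>x\<in>V. cov_deriv_along A B nablaB f X (\<lambda>y. differential A B f y (Y y)) x =
                 differential A B f x (nabla X Y x) +
                 (\<Sum>\<alpha>=1..r. h \<alpha> x (X x) (Y x) *\<^sub>R N \<alpha> x)))"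

end

theory Submission
  imports Defs
begin

text \<open>
  Let \<open>D\<close> be the connection \<open>cov_deriv_along\<close> on sections along \<open>f\<close> that the ambient
  Levi-Civita connection induces, and write \<open>df\<close> for the differential of \<open>f\<close>. Everything
  rests on three properties that \<open>D\<close> inherits from the ambient connection: it is compatible with
  the metric (\<open>pullback_connection_metric\<close>), it is torsion free in the sense
  \<open>D X (df Y) - D Y (df X) = df [X, Y]\<close> (\<open>pullback_torsion_free\<close>), and it commutes with
  the parallel field \<open>J\<close> (\<open>pullback_connection_endomorphism\<close>). The first and the last
  follow from a Leibniz rule for sections of the form \<open>\<Sum>i. a i * (W i \<circ> f)\<close> with ambient
  vector fields \<open>W i\<close> (\<open>pullback_connection_combination\<close>), which reduces a statement
  about \<open>D\<close> to the statement about the ambient connection and which also shows that the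
  chart formula for \<open>D\<close> defines a tangent vector. The torsion is computed in charts, from the
  symmetry of second derivatives and of the Christoffel symbols.

  Gauss formula (\<open>gauss_formula\<close>): the difference
  \<open>T X Y Z = G (D X (df Y)) (df Z) - g (\<nabla>\<^sub>X Y) Z\<close> is symmetric in \<open>X, Y\<close> because both
  connections are torsion free, and skew in \<open>Y, Z\<close> because both are metric. Such an expression
  vanishes, so \<open>B X Y = D X (df Y) - df (\<nabla>\<^sub>X Y)\<close>, the second fundamental form, is normal.

  Now let \<open>JM\<close> be the restriction of \<open>J\<close>, so that \<open>df (JM Y) = J (df Y)\<close>. Applying
  \<open>D X\<close> to both sides gives
  \<open>df (\<nabla>\<^sub>X (JM Y)) + B X (JM Y) = J (df (\<nabla>\<^sub>X Y)) + J (B X Y)\<close>.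
  Invariance makes \<open>J\<close> preserve tangent vectors, and then self-adjointness makes it preserve
  normal vectors. The tangential part of the equation is \<open>\<nabla> JM = 0\<close>, and the normal part is
  \<open>B X (JM Y) = J (B X Y)\<close>. Since \<open>B\<close> is symmetric, also \<open>B (JM X) Y = J (B X Y)\<close>, hence
  \<open>B (JM X) (JM Y) = J (J (B X Y)) = p * J (B X Y) + q * B X Y\<close>, and an orthonormal
  normal frame allows comparing coefficients.

  One analytic point remains: \<open>\<nabla>\<^sub>X (JM Y)\<close> is governed by the axioms of a connection only if
  \<open>JM Y\<close> is smooth, whereas \<open>JM\<close> is defined pointwise, by inverting \<open>df\<close>. In a chart, the
  components of \<open>JM Y\<close> solve a linear system whose matrix is the Gram matrix of the coordinate
  fields and whose right-hand side consists of the smooth functions \<open>G (J (df Y)) (df E)\<close> for the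
  coordinate fields \<open>E\<close>; solutions of such systems are smooth (\<open>smooth_on_linear_system\<close>).
\<close>

section \<open>Differential calculus in Euclidean spaces\<close>

subsection \<open>Maps of class \<open>C\<^sup>k\<close>\<close>

lemma has_derivative_imp_frechet:
  "(F has_derivative F') (at x) \<Longrightarrow> frechet_derivative F (at x) v = F' v"
  by (drule frechet_derivative_at) simp

text \<open>
  The derivative at a point of an open set depends only on the values in the set, so the values
  outside \<open>S\<close> do not matter. This is what allows rewriting derivatives pointwise below.
\<close>

lemma Ck_on_cong:
  assumes "open S" "\<And>x. x \<in> S \<Longrightarrow> F x = F' x" "Ck_on k S F"
  shows "Ck_on k S F'"
  using assms(2,3)
proof (induction k arbitrary: F F')
  case 0
  then show ?case by (metis Ck_on.simps(1) continuous_on_cong)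
next
  case (Suc k)
  have d: "F differentiable (at x)" if "x \<in> S" for x
    using Suc.prems that by simp
  have d': "F' differentiable (at x)" if "x \<in> S" for x
    using d[OF that] assms(1) that Suc.prems(1)
    by (metis differentiable_def has_derivative_transform_within_open)
  have e: "frechet_derivative F (at x) v = frechet_derivative F' (at x) v" if "x \<in> S" for x v
    using frechet_derivative_transform_within_open[OF d[OF that] assms(1) that] Suc.prems(1) by metis
  show ?case
    using Suc.IH[OF e] Suc.prems d' by simp
qed

lemma Ck_on_subset: "Ck_on k S F \<Longrightarrow> T \<subseteq> S \<Longrightarrow> Ck_on k T F"
  by (induction k arbitrary: F) (auto intro: continuous_on_subset)

lemma Ck_on_local:
  assumes "\<And>x. x \<in> S \<Longrightarrow> \<exists>T. open T \<and> x \<in> T \<and> Ck_on k T F"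
  shows "Ck_on k S F"
  using assms
proof (induction k arbitrary: F)
  case 0
  then show ?case
    by (simp add: continuous_on_eq_continuous_at)
       (metis continuous_at_imp_continuous_on continuous_on_eq_continuous_at)
next
  case (Suc k)
  have "F differentiable (at x)" if "x \<in> S" for x
    using Suc.prems[OF that] by auto
  moreover have "Ck_on k S (\<lambda>x. frechet_derivative F (at x) v)" for v
    by (rule Suc.IH) (use Suc.prems in fastforce)
  ultimately show ?case by simp
qed

lemma Ck_on_Suc_imp: "Ck_on (Suc k) S F \<Longrightarrow> Ck_on k S F"
proof (induction k arbitrary: F)
  case 0
  then show ?case
    by (simp add: continuous_at_imp_continuous_on differentiable_imp_continuous_within)
next
  case (Suc k)
  then show ?case by (metis Ck_on.simps(2))
qed

lemma Ck_on_const: "Ck_on k S (\<lambda>x. c)"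
  by (induction k arbitrary: c) auto

lemma Ck_on_add:
  assumes "open S" "Ck_on k S F" "Ck_on k S H"
  shows "Ck_on k S (\<lambda>x. F x + H x)"
  using assms(2,3)
proof (induction k arbitrary: F H)
  case 0
  then show ?case by (auto intro: continuous_intros)
next
  case (Suc k)
  have "Ck_on k S (\<lambda>x. frechet_derivative (\<lambda>x. F x + H x) (at x) v)" for v
  proof (rule Ck_on_cong[OF assms(1)])
    show "Ck_on k S (\<lambda>x. frechet_derivative F (at x) v + frechet_derivative H (at x) v)"
      using Suc by simp
    fix x assume x: "x \<in> S"
    have "((\<lambda>x. F x + H x) has_derivative
        (\<lambda>v. frechet_derivative F (at x) v + frechet_derivative H (at x) v)) (at x)"
      using Suc.prems x by (intro has_derivative_add) (auto simp: frechet_derivative_works[symmetric])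
    from has_derivative_imp_frechet[OF this]
    show "frechet_derivative F (at x) v + frechet_derivative H (at x) v =
        frechet_derivative (\<lambda>x. F x + H x) (at x) v" by (rule sym)
  qed
  then show ?case using Suc.prems by auto
qed

lemma Ck_on_bilinear:
  assumes "bounded_bilinear P" "open S" "Ck_on k S F" "Ck_on k S H"
  shows "Ck_on k S (\<lambda>x. P (F x) (H x))"
  using assms(3,4)
proof (induction k arbitrary: F H)
  case 0
  then show ?case by (auto intro: bounded_bilinear.continuous_on[OF assms(1)])
next
  case (Suc k)
  have der: "((\<lambda>x. P (F x) (H x)) has_derivative
      (\<lambda>v. P (F x) (frechet_derivative H (at x) v) + P (frechet_derivative F (at x) v) (H x))) (at x)"
    if "x \<in> S" for x
    using Suc.prems that
    by (intro bounded_bilinear.FDERIV[OF assms(1)]) (auto simp: frechet_derivative_works[symmetric])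
  have "Ck_on k S (\<lambda>x. frechet_derivative (\<lambda>x. P (F x) (H x)) (at x) v)" for v
  proof (rule Ck_on_cong[OF assms(2)])
    show "Ck_on k S (\<lambda>x. P (F x) (frechet_derivative H (at x) v) +
        P (frechet_derivative F (at x) v) (H x))"
      using Suc.prems Ck_on_Suc_imp[OF Suc.prems(1)] Ck_on_Suc_imp[OF Suc.prems(2)]
      by (intro Ck_on_add[OF assms(2)] Suc.IH) auto
    fix x assume "x \<in> S"
    from has_derivative_imp_frechet[OF der[OF this]]
    show "P (F x) (frechet_derivative H (at x) v) + P (frechet_derivative F (at x) v) (H x) =
        frechet_derivative (\<lambda>x. P (F x) (H x)) (at x) v" by (rule sym)
  qed
  then show ?case using der by (auto simp: differentiable_def)
qed

lemma Ck_on_linear: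
  assumes L: "bounded_linear L" and S: "open S" and F: "Ck_on k S F"
  shows "Ck_on k S (\<lambda>x. L (F x))"
  using F
proof (induction k arbitrary: F)
  case 0
  then show ?case by (auto intro: bounded_linear.continuous_on[OF L])
next
  case (Suc k)
  have der: "((\<lambda>x. L (F x)) has_derivative (\<lambda>v. L (frechet_derivative F (at x) v))) (at x)"
    if "x \<in> S" for x
    using Suc.prems that
    by (intro bounded_linear.has_derivative[OF L]) (auto simp: frechet_derivative_works[symmetric])
  have "Ck_on k S (\<lambda>x. frechet_derivative (\<lambda>x. L (F x)) (at x) v)" for v
  proof (rule Ck_on_cong[OF S])
    show "Ck_on k S (\<lambda>x. L (frechet_derivative F (at x) v))"
      using Suc by simp
    fix x assume "x \<in> S"
    from has_derivative_imp_frechet[OF der[OF this]]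
    show "L (frechet_derivative F (at x) v) = frechet_derivative (\<lambda>x. L (F x)) (at x) v" by (rule sym)
  qed
  then show ?case using der by (auto simp: differentiable_def)
qed

lemma Ck_on_sum:
  assumes "open S" "\<And>i. i \<in> I \<Longrightarrow> Ck_on k S (F i)"
  shows "Ck_on k S (\<lambda>x. \<Sum>i\<in>I. F i x)"
  using assms(2) by (induction I rule: infinite_finite_induct)
    (auto intro: Ck_on_const Ck_on_add[OF assms(1)])

text \<open>
  A derivative in a varying direction is a combination of derivatives in the fixed basis
  directions, the only ones that \<open>Ck_on\<close> controls.
\<close>

lemma derivative_euclidean_expansion:
  fixes L :: "'a::euclidean_space \<Rightarrow> 'b::real_normed_vector"
  assumes "linear L"
  shows "L v = (\<Sum>b\<in>Basis. (v \<bullet> b) *\<^sub>R L b)"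
proof -
  have "L v = L (\<Sum>b\<in>Basis. (v \<bullet> b) *\<^sub>R b)" by (simp add: euclidean_representation)
  also have "\<dots> = (\<Sum>b\<in>Basis. (v \<bullet> b) *\<^sub>R L b)"
    by (simp add: linear_sum[OF assms] linear_cmul[OF assms])
  finally show ?thesis .
qed

lemma linear_frechet_derivative:
  "F differentiable (at x) \<Longrightarrow> linear (frechet_derivative F (at x))"
  using frechet_derivative_works has_derivative_linear by blast

lemma Ck_on_compose:
  fixes H :: "'a::euclidean_space \<Rightarrow> 'b::euclidean_space"
    and F :: "'b \<Rightarrow> 'c::real_normed_vector"
  assumes S: "open S" and HS: "H ` S \<subseteq> T"
    and H: "Ck_on k S H" and F: "Ck_on k T F"
  shows "Ck_on k S (\<lambda>x. F (H x))"
  using H F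
proof (induction k arbitrary: F)
  case 0
  then show ?case using HS
    by (auto intro: continuous_on_compose2)
next
  case (Suc k)
  let ?D = "\<lambda>x v. \<Sum>b\<in>Basis. (frechet_derivative H (at x) v \<bullet> b) *\<^sub>R frechet_derivative F (at (H x)) b"
  have der: "((\<lambda>x. F (H x)) has_derivative ?D x) (at x)" if x: "x \<in> S" for x
  proof -
    have dF: "F differentiable (at (H x))" and dH: "H differentiable (at x)"
      using Suc.prems x HS by auto
    have "((\<lambda>x. F (H x)) has_derivative
        (\<lambda>v. frechet_derivative F (at (H x)) (frechet_derivative H (at x) v))) (at x)"
      using has_derivative_compose[OF dH[unfolded frechet_derivative_works]
          dF[unfolded frechet_derivative_works]] .
    then show ?thesis
      by (subst (asm) derivative_euclidean_expansion[OF linear_frechet_derivative[OF dF]])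
  qed
  have "Ck_on k S (\<lambda>x. frechet_derivative (\<lambda>x. F (H x)) (at x) v)" for v
  proof (rule Ck_on_cong[OF S])
    show "Ck_on k S (\<lambda>x. ?D x v)"
    proof (intro Ck_on_sum[OF S] Ck_on_bilinear[OF bounded_bilinear_scaleR S])
      fix b :: 'b
      show "Ck_on k S (\<lambda>x. frechet_derivative H (at x) v \<bullet> b)"
        using Suc.prems by (intro Ck_on_linear[OF bounded_linear_inner_left S]) auto
      show "Ck_on k S (\<lambda>x. frechet_derivative F (at (H x)) b)"
        using Suc.prems Ck_on_Suc_imp[OF Suc.prems(1)] by (intro Suc.IH) auto
    qed
    fix x assume "x \<in> S"
    from has_derivative_imp_frechet[OF der[OF this]]
    show "?D x v = frechet_derivative (\<lambda>x. F (H x)) (at x) v" by (rule sym)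
  qed
  then show ?case using der by (auto simp: differentiable_def)
qed

subsection \<open>Smooth maps on open sets\<close>

lemma smooth_on_cong:
  "open S \<Longrightarrow> (\<And>x. x \<in> S \<Longrightarrow> F x = F' x) \<Longrightarrow> smooth_on S F \<Longrightarrow> smooth_on S F'"
  unfolding smooth_on_def by (blast intro: Ck_on_cong)

lemma smooth_on_subset: "smooth_on S F \<Longrightarrow> T \<subseteq> S \<Longrightarrow> smooth_on T F"
  unfolding smooth_on_def by (blast intro: Ck_on_subset)

lemma smooth_on_local:
  "(\<And>x. x \<in> S \<Longrightarrow> \<exists>T. open T \<and> x \<in> T \<and> smooth_on T F) \<Longrightarrow> smooth_on S F"
  unfolding smooth_on_def by (intro allI Ck_on_local) meson

lemma smooth_on_const: "smooth_on S (\<lambda>x. c)"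
  by (simp add: smooth_on_def Ck_on_const)

lemma smooth_on_add:
  "open S \<Longrightarrow> smooth_on S F \<Longrightarrow> smooth_on S H \<Longrightarrow> smooth_on S (\<lambda>x. F x + H x)"
  by (simp add: smooth_on_def Ck_on_add)

lemma smooth_on_bilinear:
  "bounded_bilinear P \<Longrightarrow> open S \<Longrightarrow> smooth_on S F \<Longrightarrow> smooth_on S H \<Longrightarrow> smooth_on S (\<lambda>x. P (F x) (H x))"
  by (simp add: smooth_on_def Ck_on_bilinear)

lemma smooth_on_linear:
  "bounded_linear L \<Longrightarrow> open S \<Longrightarrow> smooth_on S F \<Longrightarrow> smooth_on S (\<lambda>x. L (F x))"
  by (simp add: smooth_on_def Ck_on_linear)

lemma smooth_on_sum:
  "open S \<Longrightarrow> (\<And>i. i \<in> I \<Longrightarrow> smooth_on S (F i)) \<Longrightarrow> smooth_on S (\<lambda>x. \<Sum>i\<in>I. F i x)"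
  by (simp add: smooth_on_def Ck_on_sum)

lemma smooth_on_compose:
  fixes H :: "'a::euclidean_space \<Rightarrow> 'b::euclidean_space"
  shows "open S \<Longrightarrow> H ` S \<subseteq> T \<Longrightarrow> smooth_on S H \<Longrightarrow> smooth_on T F \<Longrightarrow> smooth_on S (\<lambda>x. F (H x))"
  by (simp add: smooth_on_def Ck_on_compose)

lemma smooth_on_differentiable: "smooth_on S F \<Longrightarrow> x \<in> S \<Longrightarrow> F differentiable (at x)"
  unfolding smooth_on_def by (metis Ck_on.simps(2))

lemma smooth_on_frechet: "smooth_on S F \<Longrightarrow> smooth_on S (\<lambda>x. frechet_derivative F (at x) v)"
  unfolding smooth_on_def by (metis Ck_on.simps(2))

lemma smooth_on_frechet_field:
  fixes F :: "'a::euclidean_space \<Rightarrow> 'b::real_normed_vector"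
  assumes S: "open S" and F: "smooth_on S F" and v: "smooth_on S v"
  shows "smooth_on S (\<lambda>x. frechet_derivative F (at x) (v x))"
proof (rule smooth_on_cong[OF S])
  show "smooth_on S (\<lambda>x. \<Sum>b\<in>Basis. (v x \<bullet> b) *\<^sub>R frechet_derivative F (at x) b)"
    by (intro smooth_on_sum[OF S] smooth_on_bilinear[OF bounded_bilinear_scaleR S]
        smooth_on_linear[OF bounded_linear_inner_left S v] smooth_on_frechet[OF F])
  show "\<And>x. x \<in> S \<Longrightarrow> (\<Sum>b\<in>Basis. (v x \<bullet> b) *\<^sub>R frechet_derivative F (at x) b) =
      frechet_derivative F (at x) (v x)"
    by (rule derivative_euclidean_expansion[OF linear_frechet_derivative[OF smooth_on_differentiable[OF F]], symmetric])
qed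

text \<open>
  Differentiating \<open>DF(y)(u y)\<close> produces the second derivative of \<open>F\<close> and a term with the
  derivative of \<open>u\<close>. Applied to a map in charts and a vector field, this is the step of the torsion
  computation where the second derivatives appear.
\<close>

lemma has_derivative_frechet_field:
  fixes F :: "'a::euclidean_space \<Rightarrow> 'b::real_normed_vector"
  assumes S: "open S" "x \<in> S" and F: "smooth_on S F" and u: "(u has_derivative u') (at x)"
  shows "((\<lambda>y. frechet_derivative F (at y) (u y)) has_derivative
     (\<lambda>v. frechet_derivative (\<lambda>y. frechet_derivative F (at y) (u x)) (at x) v +
          frechet_derivative F (at x) (u' v))) (at x)"
proof -
  have lin: "\<And>y. y \<in> S \<Longrightarrow> linear (frechet_derivative F (at y))"
    by (rule linear_frechet_derivative[OF smooth_on_differentiable[OF F]])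
  have d2: "(\<lambda>y. frechet_derivative F (at y) w) differentiable (at x)" for w
    by (rule smooth_on_differentiable[OF smooth_on_frechet[OF F] S(2)])
  have d2': "((\<lambda>y. frechet_derivative F (at y) w) has_derivative
     frechet_derivative (\<lambda>y. frechet_derivative F (at y) w) (at x)) (at x)" for w
    using d2 frechet_derivative_works by blast
  let ?E = "\<lambda>v w. frechet_derivative (\<lambda>y. frechet_derivative F (at y) w) (at x) v"
  have E: "(\<Sum>b\<in>Basis. (w \<bullet> b) *\<^sub>R ?E v b) = ?E v w" for v w
  proof -
    have "((\<lambda>y. \<Sum>b\<in>Basis. (w \<bullet> b) *\<^sub>R frechet_derivative F (at y) b) has_derivative
        (\<lambda>v. \<Sum>b\<in>Basis. (w \<bullet> b) *\<^sub>R ?E v b)) (at x)"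
      by (intro has_derivative_sum has_derivative_scaleR_right d2')
    then have "((\<lambda>y. frechet_derivative F (at y) w) has_derivative
        (\<lambda>v. \<Sum>b\<in>Basis. (w \<bullet> b) *\<^sub>R ?E v b)) (at x)"
      by (rule has_derivative_transform_within_open[OF _ S])
         (rule derivative_euclidean_expansion[OF lin, symmetric])
    from has_derivative_imp_frechet[OF this] show ?thesis by (rule sym)
  qed
  have "((\<lambda>y. \<Sum>b\<in>Basis. (u y \<bullet> b) *\<^sub>R frechet_derivative F (at y) b) has_derivative
        (\<lambda>v. \<Sum>b\<in>Basis. (u x \<bullet> b) *\<^sub>R ?E v b + (u' v \<bullet> b) *\<^sub>R frechet_derivative F (at x) b)) (at x)"
    by (intro has_derivative_sum has_derivative_scaleR has_derivative_inner_left u d2')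
  then have "((\<lambda>y. frechet_derivative F (at y) (u y)) has_derivative
        (\<lambda>v. \<Sum>b\<in>Basis. (u x \<bullet> b) *\<^sub>R ?E v b + (u' v \<bullet> b) *\<^sub>R frechet_derivative F (at x) b)) (at x)"
    by (rule has_derivative_transform_within_open[OF _ S])
       (rule derivative_euclidean_expansion[OF lin, symmetric])
  moreover have "(\<lambda>v. \<Sum>b\<in>Basis. (u x \<bullet> b) *\<^sub>R ?E v b + (u' v \<bullet> b) *\<^sub>R frechet_derivative F (at x) b) =
     (\<lambda>v. ?E v (u x) + frechet_derivative F (at x) (u' v))"
    unfolding sum.distrib E derivative_euclidean_expansion[OF lin[OF S(2)], symmetric] ..
  ultimately show ?thesis by simp
qed


subsection \<open>Symmetry of second derivatives\<close>

lemma line_derivative: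
  fixes F :: "'a::euclidean_space \<Rightarrow> real"
  assumes "F differentiable (at (a + s *\<^sub>R u))"
  shows "((\<lambda>s. F (a + s *\<^sub>R u)) has_field_derivative frechet_derivative F (at (a + s *\<^sub>R u)) u) (at s)"
proof -
  let ?D = "frechet_derivative F (at (a + s *\<^sub>R u))"
  have "((\<lambda>s. a + s *\<^sub>R u) has_derivative (\<lambda>t. t *\<^sub>R u)) (at s)"
    by (auto intro!: derivative_eq_intros)
  from has_derivative_compose[OF this assms[unfolded frechet_derivative_works]]
  have "((\<lambda>s. F (a + s *\<^sub>R u)) has_derivative (\<lambda>t. ?D (t *\<^sub>R u))) (at s)" .
  moreover have "(\<lambda>t. ?D (t *\<^sub>R u)) = (*) (?D u)"
    using linear_cmul[OF linear_frechet_derivative[OF assms]] by (auto simp: mult.commute)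
  ultimately show ?thesis by (simp add: has_field_derivative_def)
qed

text \<open>
  The mean value theorem in direction \<open>u\<close> and then in direction \<open>v\<close> turns the second difference into
  \<open>t\<^sup>2\<close> times a second derivative at a point near \<open>x\<close>. The second difference is symmetric in
  \<open>u\<close> and \<open>v\<close>, which is why its limit yields the symmetry of second derivatives.
\<close>

lemma second_difference_tendsto:
  fixes F :: "'a::euclidean_space \<Rightarrow> real"
  assumes S: "open S" "x \<in> S" and F: "smooth_on S F"
  shows "((\<lambda>t. (F (x + t *\<^sub>R u + t *\<^sub>R v) - F (x + t *\<^sub>R u) - F (x + t *\<^sub>R v) + F x) / t\<^sup>2) \<longlongrightarrow>
     frechet_derivative (\<lambda>y. frechet_derivative F (at y) u) (at x) v) (at_right 0)"
proof (rule tendstoI)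
  fix e :: real assume "e > 0"
  define K where "K y = frechet_derivative (\<lambda>y. frechet_derivative F (at y) u) (at y) v" for y
  have "smooth_on S K" unfolding K_def by (intro smooth_on_frechet F)
  then have "isCont K x"
    using S smooth_on_differentiable differentiable_imp_continuous_within by blast
  then obtain d1 where d1: "d1 > 0" "\<And>y. dist y x < d1 \<Longrightarrow> dist (K y) (K x) < e"
    using \<open>e > 0\<close> unfolding continuous_at_eps_delta by blast
  obtain d2 where d2: "d2 > 0" "ball x d2 \<subseteq> S"
    using S openE by blast
  define d where "d = min d1 d2"
  have d: "d > 0" "\<And>y. dist y x < d \<Longrightarrow> dist (K y) (K x) < e" "\<And>y. dist y x < d \<Longrightarrow> y \<in> S"
    using d1 d2 by (auto simp: d_def dist_commute)
  define t0 where "t0 = d / (norm u + norm v + 1)"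
  have t0: "t0 > 0" using d by (simp add: t0_def add_nonneg_pos)
  have "dist ((F (x + t *\<^sub>R u + t *\<^sub>R v) - F (x + t *\<^sub>R u) - F (x + t *\<^sub>R v) + F x) / t\<^sup>2) (K x) < e"
    if t: "0 < t" "t < t0" for t
  proof -
    have near: "dist (x + a *\<^sub>R u + b *\<^sub>R v) x < d" if "0 \<le> a" "a \<le> t" "0 \<le> b" "b \<le> t" for a b
    proof -
      have "dist (x + a *\<^sub>R u + b *\<^sub>R v) x = norm (a *\<^sub>R u + b *\<^sub>R v)"
        by (simp add: dist_norm algebra_simps)
      also have "\<dots> \<le> a * norm u + b * norm v"
        using norm_triangle_ineq[of "a *\<^sub>R u" "b *\<^sub>R v"] that by simp
      also have "\<dots> \<le> t * norm u + t * norm v"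
        using that by (intro add_mono mult_right_mono) auto
      also have "\<dots> < t * (norm u + norm v + 1)" using t by (simp add: algebra_simps)
      also have "\<dots> \<le> t0 * (norm u + norm v + 1)" using t by (intro mult_right_mono) auto
      also have "\<dots> = d"
        using add_nonneg_pos[of "norm u + norm v" 1] by (simp add: t0_def)
      finally show ?thesis .
    qed
    have diffF: "F differentiable (at (x + a *\<^sub>R u + b *\<^sub>R v))"
      and diffD: "(\<lambda>y. frechet_derivative F (at y) u) differentiable (at (x + a *\<^sub>R u + b *\<^sub>R v))"
      if "0 \<le> a" "a \<le> t" "0 \<le> b" "b \<le> t" for a b
      using smooth_on_differentiable[OF F] smooth_on_differentiable[OF smooth_on_frechet[OF F]]
        d(3)[OF near[OF that]] by blast+
    \<comment> \<open>First application, in direction \<open>u\<close>, to a difference in direction \<open>v\<close>.\<close>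
    have "((\<lambda>s. F (x + t *\<^sub>R v + s *\<^sub>R u) - F (x + s *\<^sub>R u)) has_field_derivative
        frechet_derivative F (at (x + t *\<^sub>R v + s *\<^sub>R u)) u - frechet_derivative F (at (x + s *\<^sub>R u)) u) (at s)"
      if "0 \<le> s" "s \<le> t" for s
      using diffF[OF that, of t] diffF[OF that, of 0] t
      by (intro DERIV_diff line_derivative) (simp_all add: algebra_simps)
    from MVT2[OF t(1) this] obtain a where a: "0 < a" "a < t" and
      eq1: "F (x + t *\<^sub>R v + t *\<^sub>R u) - F (x + t *\<^sub>R u) - (F (x + t *\<^sub>R v) - F x) =
        t * (frechet_derivative F (at (x + t *\<^sub>R v + a *\<^sub>R u)) u - frechet_derivative F (at (x + a *\<^sub>R u)) u)"
      by auto
    \<comment> \<open>Second application, in direction \<open>v\<close>, to the derivative in direction \<open>u\<close>.\<close>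
    have "((\<lambda>s. frechet_derivative F (at (x + a *\<^sub>R u + s *\<^sub>R v)) u) has_field_derivative
        K (x + a *\<^sub>R u + s *\<^sub>R v)) (at s)"
      if "0 \<le> s" "s \<le> t" for s
      unfolding K_def
      by (rule line_derivative[of "\<lambda>y. frechet_derivative F (at y) u", OF diffD]) (use a that in auto)
    from MVT2[OF t(1) this] obtain b where b: "0 < b" "b < t" and
      eq2: "frechet_derivative F (at (x + a *\<^sub>R u + t *\<^sub>R v)) u - frechet_derivative F (at (x + a *\<^sub>R u)) u =
        t * K (x + a *\<^sub>R u + b *\<^sub>R v)"
      by auto
    have "F (x + t *\<^sub>R u + t *\<^sub>R v) - F (x + t *\<^sub>R u) - F (x + t *\<^sub>R v) + F x =
        t\<^sup>2 * K (x + a *\<^sub>R u + b *\<^sub>R v)"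
      using eq1 eq2 by (simp add: algebra_simps power2_eq_square)
    then show ?thesis using t d(2)[OF near[of a b]] a b by simp
  qed
  then show "\<forall>\<^sub>F t in at_right 0. dist ((F (x + t *\<^sub>R u + t *\<^sub>R v) - F (x + t *\<^sub>R u) - F (x + t *\<^sub>R v) + F x) / t\<^sup>2)
      (frechet_derivative (\<lambda>y. frechet_derivative F (at y) u) (at x) v) < e"
    using t0 unfolding eventually_at_right_field K_def by (intro exI[of _ t0]) auto
qed

lemma symmetric_second_derivative_real:
  fixes F :: "'a::euclidean_space \<Rightarrow> real"
  assumes S: "open S" "x \<in> S" and F: "smooth_on S F"
  shows "frechet_derivative (\<lambda>y. frechet_derivative F (at y) u) (at x) v =
     frechet_derivative (\<lambda>y. frechet_derivative F (at y) v) (at x) u"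
proof (rule tendsto_unique[OF trivial_limit_at_right_real second_difference_tendsto[OF assms, of u v]])
  show "((\<lambda>t. (F (x + t *\<^sub>R u + t *\<^sub>R v) - F (x + t *\<^sub>R u) - F (x + t *\<^sub>R v) + F x) / t\<^sup>2) \<longlongrightarrow>
     frechet_derivative (\<lambda>y. frechet_derivative F (at y) v) (at x) u) (at_right 0)"
    using second_difference_tendsto[OF assms, of v u] by (simp add: algebra_simps)
qed

lemma symmetric_second_derivative:
  fixes F :: "'a::euclidean_space \<Rightarrow> 'b::real_inner"
  assumes S: "open S" "x \<in> S" and F: "smooth_on S F"
  shows "frechet_derivative (\<lambda>y. frechet_derivative F (at y) u) (at x) v =
     frechet_derivative (\<lambda>y. frechet_derivative F (at y) v) (at x) u"
proof -
  let ?E = "\<lambda>u v. frechet_derivative (\<lambda>y. frechet_derivative F (at y) u) (at x) v"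
  have E: "frechet_derivative (\<lambda>y. frechet_derivative (\<lambda>y. F y \<bullet> b) (at y) u) (at x) v = ?E u v \<bullet> b"
    for u v b
  proof (rule has_derivative_imp_frechet)
    have "((\<lambda>y. frechet_derivative F (at y) u \<bullet> b) has_derivative (\<lambda>v. ?E u v \<bullet> b)) (at x)"
      using smooth_on_differentiable[OF smooth_on_frechet[OF F] S(2)]
      by (intro has_derivative_inner_left) (simp add: frechet_derivative_works[symmetric])
    then show "((\<lambda>y. frechet_derivative (\<lambda>y. F y \<bullet> b) (at y) u) has_derivative (\<lambda>v. ?E u v \<bullet> b)) (at x)"
    proof (rule has_derivative_transform_within_open[OF _ S])
      fix y assume "y \<in> S"
      then have "((\<lambda>y. F y \<bullet> b) has_derivative (\<lambda>v. frechet_derivative F (at y) v \<bullet> b)) (at y)"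
        using smooth_on_differentiable[OF F]
        by (intro has_derivative_inner_left) (simp add: frechet_derivative_works[symmetric])
      from has_derivative_imp_frechet[OF this]
      show "frechet_derivative F (at y) u \<bullet> b = frechet_derivative (\<lambda>y. F y \<bullet> b) (at y) u" by simp
    qed
  qed
  have "?E u v \<bullet> b = ?E v u \<bullet> b" for b
    using symmetric_second_derivative_real[OF S smooth_on_linear[OF bounded_linear_inner_left S(1) F], of b u v]
    unfolding E .
  then have "(?E u v - ?E v u) \<bullet> (?E u v - ?E v u) = 0"
    by (simp add: inner_diff_left)
  then show ?thesis by simp
qed

subsection \<open>Linear systems with smooth coefficients\<close>

text \<open>
  The product of a factor that tends to \<open>0\<close> and one of size \<open>O(norm (y - x))\<close> is
  \<open>o(norm (y - x))\<close>. The first factor is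
  merely continuous: in \<open>linear_system_differentiable\<close> it is the solution whose differentiability
  is to be shown.
\<close>

lemma has_derivative_scaleR_vanishing:
  fixes a :: "'a::real_normed_vector \<Rightarrow> real" and b :: "'a \<Rightarrow> 'b::real_normed_vector"
  assumes a: "isCont a x" "a x = 0" and b: "b differentiable (at x)" "b x = 0"
  shows "((\<lambda>y. a y *\<^sub>R b y) has_derivative (\<lambda>_. 0)) (at x)"
proof -
  obtain b' where b': "(b has_derivative b') (at x)"
    using b(1) differentiable_def by blast
  then obtain K where K: "K > 0" "\<And>h. norm (b' h) \<le> norm h * K"
    using has_derivative_bounded_linear bounded_linear.pos_bounded by blast
  obtain d1 where d1: "d1 > 0" "\<And>y. norm (y - x) < d1 \<Longrightarrow> norm (b y - b x - b' (y - x)) \<le> 1 * norm (y - x)"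
    using b' unfolding has_derivative_at_alt by (meson zero_less_one)
  have bound: "norm (b y) \<le> (K + 1) * norm (y - x)" if "norm (y - x) < d1" for y
    using d1(2)[OF that] K(2)[of "y - x"] norm_triangle_ineq2[of "b y" "b' (y - x)"]
    by (simp add: b(2) algebra_simps)
  have "\<exists>d>0. \<forall>y. norm (y - x) < d \<longrightarrow> norm (a y *\<^sub>R b y) \<le> e * norm (y - x)" if "e > 0" for e
  proof -
    have "e / (K + 1) > 0" using that K by simp
    then obtain d2 where d2: "d2 > 0" "\<And>y. dist y x < d2 \<Longrightarrow> dist (a y) (a x) < e / (K + 1)"
      using a(1) unfolding continuous_at_eps_delta by blast
    have "norm (a y *\<^sub>R b y) \<le> e * norm (y - x)" if y: "norm (y - x) < min d1 d2" for y
    proof -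
      have "norm (a y *\<^sub>R b y) \<le> e / (K + 1) * ((K + 1) * norm (y - x))"
        using d2(2)[of y] bound[of y] y a(2) \<open>e / (K + 1) > 0\<close>
        unfolding norm_scaleR by (intro mult_mono) (auto simp: dist_norm)
      then show ?thesis using K by simp
    qed
    then show ?thesis using d1(1) d2(1) by (intro exI[of _ "min d1 d2"]) auto
  qed
  then show ?thesis
    unfolding has_derivative_at_alt by (simp add: a(2))
qed

text \<open>
  With \<open>u = z y - z x\<close>, one has
  \<open>M x u = (w y - M y (z x)) - (M y - M x) u\<close>. Injectivity bounds \<open>norm (M x u)\<close> from below by
  \<open>C * norm u\<close>, and the last term is at most \<open>C / 2 * norm u\<close> near \<open>x\<close>, so it can be absorbed.
\<close>

lemma linear_system_continuous:
  fixes M :: "'a::euclidean_space \<Rightarrow> 'b::euclidean_space \<Rightarrow> 'c::euclidean_space"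
  assumes S: "open S" "x \<in> S" and lin: "\<And>y. y \<in> S \<Longrightarrow> linear (M y)"
    and inj: "\<And>e. M x e = 0 \<Longrightarrow> e = 0"
    and M: "\<And>e. isCont (\<lambda>y. M y e) x"
    and w: "isCont w x" and z: "\<And>y. y \<in> S \<Longrightarrow> M y (z y) = w y"
  shows "isCont z x"
proof -
  have "inj (M x)"
    using linear_injective_0[OF lin[OF S(2)]] inj by blast
  then obtain C where C: "C > 0" "\<And>e. C * norm e \<le> norm (M x e)"
    using linear_inj_bounded_below_pos[OF lin[OF S(2)]] by blast
  define \<eta> where "\<eta> y = (\<Sum>b\<in>Basis. norm (M y b - M x b))" for y
  define \<phi> where "\<phi> y = w y - M y (z x)" for y
  have "isCont \<eta> x" unfolding \<eta>_def by (intro continuous_intros M)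
  moreover have "\<eta> x = 0" by (simp add: \<eta>_def)
  ultimately have "(\<eta> \<longlongrightarrow> 0) (at x)" by (metis isCont_def)
  then have ev1: "\<forall>\<^sub>F y in at x. \<eta> y < C / 2"
    using C by (intro order_tendstoD) auto
  have ev2: "\<forall>\<^sub>F y in at x. y \<in> S"
    using S by (rule eventually_at_in_open')
  have "isCont \<phi> x" unfolding \<phi>_def by (intro continuous_intros M w)
  moreover have "\<phi> x = 0" by (simp add: \<phi>_def z S)
  ultimately have "(\<phi> \<longlongrightarrow> 0) (at x)" by (metis isCont_def)
  from tendsto_mult_right[OF tendsto_norm[OF this], of "2 / C"]
  have lim: "((\<lambda>y. 2 / C * norm (\<phi> y)) \<longlongrightarrow> 0) (at x)"
    by (simp add: mult.commute)
  have "\<forall>\<^sub>F y in at x. norm (z y - z x) \<le> 2 / C * norm (\<phi> y)"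
    using ev1 ev2
  proof eventually_elim
    case (elim y)
    define u where "u = z y - z x"
    note lin_y = lin[OF elim(2)] and lin_x = lin[OF S(2)]
    have "M y u - M x u = (\<Sum>b\<in>Basis. (u \<bullet> b) *\<^sub>R (M y b - M x b))"
      unfolding scaleR_diff_right sum_subtractf
      by (metis derivative_euclidean_expansion[OF lin_y] derivative_euclidean_expansion[OF lin_x])
    also have "norm \<dots> \<le> (\<Sum>b\<in>Basis. norm u * norm (M y b - M x b))"
      by (intro sum_norm_le) (auto intro!: mult_right_mono Basis_le_norm)
    finally have *: "norm (M y u - M x u) \<le> \<eta> y * norm u"
      by (simp add: \<eta>_def sum_distrib_left mult.commute)
    have "M x u = \<phi> y - (M y u - M x u)"
      using z[OF elim(2)] by (simp add: \<phi>_def u_def linear_diff[OF lin_y])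
    then have "C * norm u \<le> norm (\<phi> y) + norm (M y u - M x u)"
      using C(2)[of u] norm_triangle_ineq4[of "\<phi> y" "M y u - M x u"] by simp
    also have "\<dots> \<le> norm (\<phi> y) + C / 2 * norm u"
      using * mult_right_mono[of "\<eta> y" "C / 2" "norm u"] elim(1) by simp
    finally show "norm (z y - z x) \<le> 2 / C * norm (\<phi> y)"
      using C(1) by (simp add: u_def field_simps)
  qed
  from Lim_null_comparison[OF this lim] show ?thesis
    by (simp add: isCont_def LIM_zero_iff)
qed

text \<open>
  Applying a left inverse \<open>L\<close> of \<open>M x\<close> to the same identity gives
  \<open>z y = z x + L ((w y - M y (z x)) - \<rho> y)\<close> with \<open>\<rho> y = (M y - M x) (z y - z x)\<close>. The first
  term in the argument of \<open>L\<close> is visibly differentiable in \<open>y\<close>, and \<open>\<rho>\<close> is a sum of products of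
  two factors that vanish at \<open>x\<close>.
\<close>

lemma linear_system_differentiable:
  fixes M :: "'a::euclidean_space \<Rightarrow> 'b::euclidean_space \<Rightarrow> 'c::euclidean_space"
  assumes S: "open S" "x \<in> S" and lin: "\<And>y. y \<in> S \<Longrightarrow> linear (M y)"
    and inj: "\<And>e. M x e = 0 \<Longrightarrow> e = 0"
    and M: "\<And>e. (\<lambda>y. M y e) differentiable (at x)"
    and w: "w differentiable (at x)" and z: "\<And>y. y \<in> S \<Longrightarrow> M y (z y) = w y"
  shows "z differentiable (at x)"
proof -
  have cont: "isCont z x"
    by (rule linear_system_continuous[OF S lin inj _ _ z, of "\<lambda>y. y"])
       (simp_all add: M w differentiable_imp_continuous_within)
  have "inj (M x)"
    using linear_injective_0[OF lin[OF S(2)]] inj by blast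
  then obtain L where L: "linear L" "L \<circ> M x = id"
    using linear_injective_left_inverse[OF lin[OF S(2)]] by blast
  define \<rho> where "\<rho> y = (\<Sum>b\<in>Basis. ((z y - z x) \<bullet> b) *\<^sub>R (M y b - M x b))" for y
  have rho: "(\<rho> has_derivative (\<lambda>_. \<Sum>b\<in>(Basis::'b set). 0)) (at x)"
    unfolding \<rho>_def using M cont
    by (intro has_derivative_sum has_derivative_scaleR_vanishing)
       (auto intro!: continuous_intros derivative_intros)
  have "\<rho> differentiable (at x)" using rho differentiable_def by blast
  moreover have "(\<lambda>y. w y - M y (z x)) differentiable (at x)"
    by (intro derivative_intros M w)
  ultimately have "(\<lambda>y. (w y - M y (z x)) - \<rho> y) differentiable (at x)"
    by (rule differentiable_diff[rotated])
  then obtain D where "((\<lambda>y. (w y - M y (z x)) - \<rho> y) has_derivative D) (at x)"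
    using differentiable_def by blast
  from has_derivative_add[OF has_derivative_const
      bounded_linear.has_derivative[OF linear_conv_bounded_linear[THEN iffD1, OF L(1)] this]]
  have "((\<lambda>y. z x + L ((w y - M y (z x)) - \<rho> y)) has_derivative (\<lambda>v. 0 + L (D v))) (at x)" .
  then have "(z has_derivative (\<lambda>v. 0 + L (D v))) (at x)"
  proof (rule has_derivative_transform_within_open[OF _ S])
    fix y assume y: "y \<in> S"
    note lin_y = lin[OF y] and lin_x = lin[OF S(2)]
    have "\<rho> y = M y (z y - z x) - M x (z y - z x)"
      unfolding \<rho>_def scaleR_diff_right sum_subtractf
      by (metis derivative_euclidean_expansion[OF lin_y] derivative_euclidean_expansion[OF lin_x])
    then have "(w y - M y (z x)) - \<rho> y = M x (z y - z x)"
      using z[OF y] by (simp add: linear_diff[OF lin_y])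
    then have "L ((w y - M y (z x)) - \<rho> y) = z y - z x"
      using L(2) by (metis comp_apply id_apply)
    then show "z x + L ((w y - M y (z x)) - \<rho> y) = z y" by simp
  qed
  then show ?thesis using differentiable_def by blast
qed

text \<open>
  The derivative of the solution solves the differentiated system
  \<open>M y (z' y) = w' y - M' y (z y)\<close>, which has the same matrix. If \<open>z\<close> is of class \<open>C\<^sup>k\<close>, so is the
  new right-hand side, and hence \<open>z'\<close> by the induction hypothesis.
\<close>

lemma Ck_on_linear_system:
  fixes M :: "'a::euclidean_space \<Rightarrow> 'b::euclidean_space \<Rightarrow> 'c::euclidean_space"
  assumes S: "open S" and lin: "\<And>y. y \<in> S \<Longrightarrow> linear (M y)"
    and inj: "\<And>y e. y \<in> S \<Longrightarrow> M y e = 0 \<Longrightarrow> e = 0"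
    and M: "\<And>e. smooth_on S (\<lambda>y. M y e)"
    and w: "Ck_on k S w" and z: "\<And>y. y \<in> S \<Longrightarrow> M y (z y) = w y"
  shows "Ck_on k S z"
  using w z
proof (induction k arbitrary: w z)
  case 0
  have "isCont z y" if "y \<in> S" for y
    using that 0 S smooth_on_differentiable[OF M that]
    by (intro linear_system_continuous[OF S that lin inj _ _ 0(2)])
       (auto simp: continuous_on_eq_continuous_at differentiable_imp_continuous_within)
  then show ?case by (simp add: continuous_at_imp_continuous_on)
next
  case (Suc k)
  have zk: "Ck_on k S z" using Suc.IH[OF Ck_on_Suc_imp] Suc.prems by blast
  have zd: "z differentiable (at y)" if "y \<in> S" for y
    using that Suc.prems smooth_on_differentiable[OF M that]
    by (intro linear_system_differentiable[OF S that lin inj _ _ Suc.prems(2)]) auto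
  have "Ck_on k S (\<lambda>y. frechet_derivative z (at y) v)" for v
  proof (rule Suc.IH)
    show "Ck_on k S (\<lambda>y. frechet_derivative w (at y) v +
        (\<Sum>b\<in>Basis. (- (z y \<bullet> b)) *\<^sub>R frechet_derivative (\<lambda>y. M y b) (at y) v))"
    proof (intro Ck_on_add Ck_on_sum Ck_on_bilinear[OF bounded_bilinear_scaleR] S)
      show "Ck_on k S (\<lambda>y. frechet_derivative w (at y) v)" using Suc.prems by simp
      fix b
      show "Ck_on k S (\<lambda>y. - (z y \<bullet> b))"
        using Ck_on_linear[OF bounded_linear_inner_left S zk, of "- b"] by simp
      show "Ck_on k S (\<lambda>y. frechet_derivative (\<lambda>y. M y b) (at y) v)"
        using smooth_on_frechet[OF M] by (simp add: smooth_on_def)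
    qed
    fix y assume y: "y \<in> S"
    have "((\<lambda>y. \<Sum>b\<in>Basis. (z y \<bullet> b) *\<^sub>R M y b) has_derivative
        (\<lambda>v. \<Sum>b\<in>Basis. (z y \<bullet> b) *\<^sub>R frechet_derivative (\<lambda>y. M y b) (at y) v +
           (frechet_derivative z (at y) v \<bullet> b) *\<^sub>R M y b)) (at y)"
      using zd[OF y] smooth_on_differentiable[OF M y]
      by (intro has_derivative_sum has_derivative_scaleR has_derivative_inner_left)
         (auto simp: frechet_derivative_works[symmetric])
    then have "(w has_derivative
        (\<lambda>v. \<Sum>b\<in>Basis. (z y \<bullet> b) *\<^sub>R frechet_derivative (\<lambda>y. M y b) (at y) v +
           (frechet_derivative z (at y) v \<bullet> b) *\<^sub>R M y b)) (at y)"
    proof (rule has_derivative_transform_within_open[OF _ S y])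
      fix y' assume "y' \<in> S"
      then show "(\<Sum>b\<in>Basis. (z y' \<bullet> b) *\<^sub>R M y' b) = w y'"
        using derivative_euclidean_expansion[OF lin, of y' "z y'"] Suc.prems(2) by simp
    qed
    from has_derivative_imp_frechet[OF this, of v]
    show "M y (frechet_derivative z (at y) v) = frechet_derivative w (at y) v +
        (\<Sum>b\<in>Basis. (- (z y \<bullet> b)) *\<^sub>R frechet_derivative (\<lambda>y. M y b) (at y) v)"
      by (subst derivative_euclidean_expansion[OF lin[OF y]]) (simp add: sum.distrib sum_negf)
  qed
  then show ?case using zd by simp
qed

lemma smooth_on_linear_system:
  fixes M :: "'a::euclidean_space \<Rightarrow> 'b::euclidean_space \<Rightarrow> 'c::euclidean_space"
  assumes "open S" "\<And>y. y \<in> S \<Longrightarrow> linear (M y)"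
    and "\<And>y e. y \<in> S \<Longrightarrow> M y e = 0 \<Longrightarrow> e = 0"
    and "\<And>e. smooth_on S (\<lambda>y. M y e)"
    and "smooth_on S w" and "\<And>y. y \<in> S \<Longrightarrow> M y (z y) = w y"
  shows "smooth_on S z"
  unfolding smooth_on_def
proof
  fix k
  show "Ck_on k S z"
    by (rule Ck_on_linear_system[OF assms(1-4) _ assms(6)]) (use assms(5) in \<open>auto simp: smooth_on_def\<close>)
qed

section \<open>Calculus on a manifold\<close>

lemma sum_fun_apply: "(\<Sum>i\<in>I. F i) x = (\<Sum>i\<in>I. F i x)"
  by (induction I rule: infinite_finite_induct) auto

locale smooth_manifold =
  fixes A :: "('m::{t2_space,second_countable_topology}, 'e::euclidean_space) chart set"
  assumes atlas: "smooth_atlas A"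
begin

lemma chart_open: "c \<in> A \<Longrightarrow> open (fst c)"
  and chart_homeo: "c \<in> A \<Longrightarrow> homeomorphism (fst c) (snd c ` fst c) (snd c) (chart_inv c)"
  and chart_range_open: "c \<in> A \<Longrightarrow> open (snd c ` fst c)"
  and transition_smooth: "c \<in> A \<Longrightarrow> d \<in> A \<Longrightarrow> smooth_on (snd c ` (fst c \<inter> fst d)) (snd d \<circ> chart_inv c)"
  using atlas by (auto simp: smooth_atlas_def)

lemma open_chart_domain: "c \<in> A \<Longrightarrow> open U \<Longrightarrow> open (U \<inter> fst c)"
  using chart_open by blast

lemma ex_chart: "\<exists>c\<in>A. x \<in> fst c"
  using atlas unfolding smooth_atlas_def by blast

lemma chart_inv_chart [simp]: "c \<in> A \<Longrightarrow> x \<in> fst c \<Longrightarrow> chart_inv c (snd c x) = x"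
  by (meson chart_homeo homeomorphism_apply1)

lemma chart_image_open:
  assumes "c \<in> A" "open U" shows "open (snd c ` (U \<inter> fst c))"
proof -
  have "snd c ` (U \<inter> fst c) = snd c ` fst c \<inter> chart_inv c -` U"
    using assms by auto
  moreover have "continuous_on (snd c ` fst c) (chart_inv c)"
    using chart_homeo[OF assms(1)] homeomorphism_cont2 by blast
  ultimately show ?thesis
    using continuous_open_preimage[OF _ chart_range_open[OF assms(1)] assms(2)] by metis
qed

lemma chart_image_open_subset:
  "c \<in> A \<Longrightarrow> open W \<Longrightarrow> W \<subseteq> fst c \<Longrightarrow> open (snd c ` W)"
  using chart_image_open[of c W] by (simp add: Int_absorb2)

subsection \<open>Smooth functions\<close>

lemma smooth_function_chart:
  "smooth_function A U F \<Longrightarrow> c \<in> A \<Longrightarrow> W \<subseteq> U \<Longrightarrow> W \<subseteq> fst c \<Longrightarrow> smooth_on (snd c ` W) (F \<circ> chart_inv c)"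
  unfolding smooth_function_def by (rule smooth_on_subset) auto

text \<open>
  Chart changes are smooth, so smoothness in one chart around a point carries over to all others.
\<close>

lemma smooth_function_local_chart:
  assumes "\<And>x. x \<in> U \<Longrightarrow> \<exists>c\<in>A. \<exists>W. open W \<and> x \<in> W \<and> W \<subseteq> fst c \<and> smooth_on (snd c ` W) (F \<circ> chart_inv c)"
  shows "smooth_function A U F"
  unfolding smooth_function_def
proof (intro ballI smooth_on_local)
  fix d y assume d: "d \<in> A" and "y \<in> snd d ` (U \<inter> fst d)"
  then obtain x where x: "x \<in> U" "x \<in> fst d" "y = snd d x" by auto
  obtain c W where c: "c \<in> A" and W: "open W" "x \<in> W" "W \<subseteq> fst c"
    and sm: "smooth_on (snd c ` W) (F \<circ> chart_inv c)"
    using assms[OF x(1)] by blast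
  let ?V = "W \<inter> fst d"
  have op: "open (snd d ` ?V)" by (rule chart_image_open[OF d W(1)])
  have tr: "smooth_on (snd d ` ?V) (snd c \<circ> chart_inv d)"
    using transition_smooth[OF d c] by (rule smooth_on_subset) (use W in auto)
  have "smooth_on (snd d ` ?V) (\<lambda>y. (F \<circ> chart_inv c) ((snd c \<circ> chart_inv d) y))"
    by (rule smooth_on_compose[OF op _ tr sm]) (use d in auto)
  then have "smooth_on (snd d ` ?V) (F \<circ> chart_inv d)"
    by (rule smooth_on_cong[OF op, rotated]) (use c d subsetD[OF W(3)] in auto)
  with op show "\<exists>T. open T \<and> y \<in> T \<and> smooth_on T (F \<circ> chart_inv d)"
    using x W by blast
qed

lemma smooth_function_cong:
  assumes "open U" "\<And>x. x \<in> U \<Longrightarrow> F x = F' x" "smooth_function A U F"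
  shows "smooth_function A U F'"
  unfolding smooth_function_def
proof
  fix c assume c: "c \<in> A"
  show "smooth_on (snd c ` (U \<inter> fst c)) (F' \<circ> chart_inv c)"
    by (rule smooth_on_cong[OF chart_image_open[OF c assms(1)], of "F \<circ> chart_inv c"])
       (use assms c in \<open>auto simp: smooth_function_def\<close>)
qed

lemma smooth_function_subset: "smooth_function A U F \<Longrightarrow> V \<subseteq> U \<Longrightarrow> smooth_function A V F"
  unfolding smooth_function_def by (meson Int_mono image_mono order_refl smooth_on_subset)

lemma smooth_function_local:
  assumes "\<And>x. x \<in> U \<Longrightarrow> \<exists>W. open W \<and> x \<in> W \<and> smooth_function A W F"
  shows "smooth_function A U F"
proof (rule smooth_function_local_chart)
  fix x assume "x \<in> U"
  then obtain W where W: "open W" "x \<in> W" "smooth_function A W F" using assms by blast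
  obtain c where c: "c \<in> A" "x \<in> fst c" using ex_chart by blast
  show "\<exists>c\<in>A. \<exists>W. open W \<and> x \<in> W \<and> W \<subseteq> fst c \<and> smooth_on (snd c ` W) (F \<circ> chart_inv c)"
    using W c chart_open[OF c(1)]
    by (intro bexI[of _ c] exI[of _ "W \<inter> fst c"]) (auto simp: smooth_function_def)
qed

lemma smooth_function_const: "smooth_function A U (\<lambda>x. a)"
  by (simp add: smooth_function_def comp_def smooth_on_const)

lemma smooth_function_add:
  "open U \<Longrightarrow> smooth_function A U F \<Longrightarrow> smooth_function A U H \<Longrightarrow> smooth_function A U (\<lambda>x. F x + H x)"
  unfolding smooth_function_def comp_def by (simp add: smooth_on_add chart_image_open)

lemma smooth_function_sum:
  "open U \<Longrightarrow> (\<And>i. i \<in> I \<Longrightarrow> smooth_function A U (F i)) \<Longrightarrow> smooth_function A U (\<lambda>x. \<Sum>i\<in>I. F i x)"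
  unfolding smooth_function_def comp_def by (simp add: smooth_on_sum chart_image_open)

lemma smooth_function_bilinear:
  "bounded_bilinear P \<Longrightarrow> open U \<Longrightarrow> smooth_function A U F \<Longrightarrow> smooth_function A U H \<Longrightarrow>
    smooth_function A U (\<lambda>x. P (F x) (H x))"
  unfolding smooth_function_def comp_def
  by (intro ballI smooth_on_bilinear[of P] chart_image_open) simp_all

lemmas smooth_function_scaleR = smooth_function_bilinear[OF bounded_bilinear_scaleR]
lemmas smooth_function_mult = smooth_function_bilinear[OF bounded_bilinear_mult]

lemma smooth_function_linear:
  "bounded_linear L \<Longrightarrow> open U \<Longrightarrow> smooth_function A U F \<Longrightarrow> smooth_function A U (\<lambda>x. L (F x))"
  unfolding smooth_function_def comp_def
  by (intro ballI smooth_on_linear[of L] chart_image_open) simp_all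

lemma smooth_function_inner:
  "open U \<Longrightarrow> smooth_function A U F \<Longrightarrow> smooth_function A U (\<lambda>x. F x \<bullet> b)"
  using smooth_function_linear[OF bounded_linear_inner_left] .

lemma smooth_function_compose:
  fixes F :: "'m \<Rightarrow> 'c::euclidean_space"
  assumes "open U" "F ` U \<subseteq> T" "smooth_function A U F" "smooth_on T Q"
  shows "smooth_function A U (\<lambda>x. Q (F x))"
  unfolding smooth_function_def
proof
  fix c assume c: "c \<in> A"
  have "smooth_on (snd c ` (U \<inter> fst c)) (F \<circ> chart_inv c)"
    using assms(3) c by (simp add: smooth_function_def)
  moreover have "(F \<circ> chart_inv c) ` snd c ` (U \<inter> fst c) \<subseteq> T"
    using assms(2) c by auto
  ultimately have "smooth_on (snd c ` (U \<inter> fst c)) (\<lambda>y. Q ((F \<circ> chart_inv c) y))"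
    using smooth_on_compose[OF chart_image_open[OF c assms(1)] _ _ assms(4)] by blast
  then show "smooth_on (snd c ` (U \<inter> fst c)) ((\<lambda>x. Q (F x)) \<circ> chart_inv c)"
    by (simp add: comp_def)
qed

lemma smooth_function_coordinates: "c \<in> A \<Longrightarrow> smooth_function A (fst c) (snd c)"
  unfolding smooth_function_def using transition_smooth by (auto simp: Int_commute)

lemma smooth_function_differentiable:
  assumes "smooth_function A U F" "x \<in> U" "c \<in> A" "x \<in> fst c"
  shows "(F \<circ> chart_inv c) differentiable (at (snd c x))"
  using assms unfolding smooth_function_def by (blast intro: smooth_on_differentiable)

subsection \<open>Tangent vectors\<close>

text \<open>
  The chain rule for a change of charts. It makes coordinate fields obey the transformation law of
  tangent vectors and \<open>tangent_deriv\<close> independent of the chart.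
\<close>

lemma chart_change_derivative:
  assumes cd: "c \<in> A" "d \<in> A" "x \<in> fst c" "x \<in> fst d"
    and F: "(F \<circ> chart_inv d) differentiable (at (snd d x))"
  shows "((F \<circ> chart_inv c) has_derivative
     (\<lambda>v. frechet_derivative (F \<circ> chart_inv d) (at (snd d x))
            (frechet_derivative (snd d \<circ> chart_inv c) (at (snd c x)) v))) (at (snd c x))"
proof -
  let ?V = "snd c ` (fst d \<inter> fst c)"
  have V: "open ?V" "snd c x \<in> ?V"
    using cd chart_image_open[OF cd(1) chart_open[OF cd(2)]] by auto
  have "(snd d \<circ> chart_inv c) differentiable (at (snd c x))"
    using transition_smooth[OF cd(1,2)] V(2) by (intro smooth_on_differentiable) (auto simp: Int_commute)
  then have tr: "((snd d \<circ> chart_inv c) has_derivative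
      frechet_derivative (snd d \<circ> chart_inv c) (at (snd c x))) (at (snd c x))"
    by (simp add: frechet_derivative_works)
  have "(snd d \<circ> chart_inv c) (snd c x) = snd d x" using cd by simp
  then have "((F \<circ> chart_inv d) has_derivative
      frechet_derivative (F \<circ> chart_inv d) (at (snd d x))) (at ((snd d \<circ> chart_inv c) (snd c x)))"
    using F by (simp add: frechet_derivative_works)
  from has_derivative_compose[OF tr this] have "((\<lambda>y. (F \<circ> chart_inv d) ((snd d \<circ> chart_inv c) y)) has_derivative
     (\<lambda>v. frechet_derivative (F \<circ> chart_inv d) (at (snd d x))
            (frechet_derivative (snd d \<circ> chart_inv c) (at (snd c x)) v))) (at (snd c x))"
    .
  then show ?thesis
    by (rule has_derivative_transform_within_open[OF _ V]) (use cd in auto)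
qed

lemma transition_differentiable:
  "c \<in> A \<Longrightarrow> d \<in> A \<Longrightarrow> x \<in> fst c \<Longrightarrow> x \<in> fst d \<Longrightarrow> (snd d \<circ> chart_inv c) differentiable (at (snd c x))"
  by (rule smooth_on_differentiable[OF transition_smooth]) auto

lemma tangent_space_transform:
  "v \<in> tangent_space A x \<Longrightarrow> c \<in> A \<Longrightarrow> d \<in> A \<Longrightarrow> x \<in> fst c \<Longrightarrow> x \<in> fst d \<Longrightarrow>
    v d = frechet_derivative (snd d \<circ> chart_inv c) (at (snd c x)) (v c)"
  unfolding tangent_space_def by blast

lemma tangent_space_outside: "v \<in> tangent_space A x \<Longrightarrow> \<not> (c \<in> A \<and> x \<in> fst c) \<Longrightarrow> v c = 0"
  unfolding tangent_space_def by blast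

lemma subspace_tangent_space: "subspace (tangent_space A x)"
proof -
  have lin: "linear (frechet_derivative (snd d \<circ> chart_inv c) (at (snd c x)))"
    if "c \<in> A" "d \<in> A" "x \<in> fst c" "x \<in> fst d" for c d
    using linear_frechet_derivative transition_differentiable that by blast
  show ?thesis
    unfolding subspace_def
  proof (intro conjI ballI allI)
    show "0 \<in> tangent_space A x"
      unfolding tangent_space_def using linear_0[OF lin] by simp
  next
    fix v w assume vw: "v \<in> tangent_space A x" "w \<in> tangent_space A x"
    show "v + w \<in> tangent_space A x"
      unfolding tangent_space_def
    proof (intro CollectI conjI ballI allI impI)
      fix c d assume cd: "c \<in> A" "d \<in> A" "x \<in> fst c" "x \<in> fst d"
      show "(v + w) d = frechet_derivative (snd d \<circ> chart_inv c) (at (snd c x)) ((v + w) c)"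
        unfolding plus_fun_apply linear_add[OF lin[OF cd]]
        using tangent_space_transform[OF vw(1) cd] tangent_space_transform[OF vw(2) cd] by presburger
    qed (simp add: tangent_space_outside[OF vw(1)] tangent_space_outside[OF vw(2)])
  next
    fix a v assume v: "v \<in> tangent_space A x"
    show "a *\<^sub>R v \<in> tangent_space A x"
      unfolding tangent_space_def
    proof (intro CollectI conjI ballI allI impI)
      fix c d assume cd: "c \<in> A" "d \<in> A" "x \<in> fst c" "x \<in> fst d"
      show "(a *\<^sub>R v) d = frechet_derivative (snd d \<circ> chart_inv c) (at (snd c x)) ((a *\<^sub>R v) c)"
        unfolding scaleR_fun_apply linear_cmul[OF lin[OF cd]]
        using tangent_space_transform[OF v cd] by presburger
    qed (simp add: tangent_space_outside[OF v])
  qed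
qed

lemmas tangent_zero = subspace_0[OF subspace_tangent_space]
  and tangent_add = subspace_add[OF subspace_tangent_space]
  and tangent_scaleR = subspace_scale[OF subspace_tangent_space]
  and tangent_diff = subspace_diff[OF subspace_tangent_space]
  and tangent_sum = subspace_sum[OF subspace_tangent_space]

lemma tangent_vector_eqI:
  assumes "v \<in> tangent_space A x" "w \<in> tangent_space A x" "c \<in> A" "x \<in> fst c" "v c = w c"
  shows "v = w"
proof
  fix d show "v d = w d"
  proof (cases "d \<in> A \<and> x \<in> fst d")
    case True
    then show ?thesis
      using tangent_space_transform[OF assms(1,3) _ assms(4)] tangent_space_transform[OF assms(2,3) _ assms(4)]
        assms(5) by auto
  next
    case False
    then show ?thesis using tangent_space_outside assms(1,2) by metis
  qed
qed

lemma coord_field_self [simp]: "c \<in> A \<Longrightarrow> x \<in> fst c \<Longrightarrow> coord_field A c e x c = e"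
proof -
  assume c: "c \<in> A" "x \<in> fst c"
  have "((\<lambda>y. y) has_derivative (\<lambda>v. v)) (at (snd c x))" by simp
  then have "((snd c \<circ> chart_inv c) has_derivative (\<lambda>v. v)) (at (snd c x))"
    by (rule has_derivative_transform_within_open[OF _ chart_range_open[OF c(1)]])
       (use c in auto)
  from has_derivative_imp_frechet[OF this] show ?thesis using c by (simp add: coord_field_def)
qed

lemma coord_field_tangent: "c \<in> A \<Longrightarrow> coord_field A c e x \<in> tangent_space A x"
proof (cases "x \<in> fst c")
  case True
  assume c: "c \<in> A"
  show ?thesis
    unfolding tangent_space_def
  proof (intro CollectI conjI ballI allI impI)
    fix d d' assume d: "d \<in> A" "d' \<in> A" "x \<in> fst d" "x \<in> fst d'"
    from has_derivative_imp_frechet[OF chart_change_derivative[OF c d(1) True d(3)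
        transition_differentiable[OF d]]]
    show "coord_field A c e x d' =
        frechet_derivative (snd d' \<circ> chart_inv d) (at (snd d x)) (coord_field A c e x d)"
      using c d True by (simp add: coord_field_def)
  qed (auto simp: coord_field_def)
next
  case False
  then show ?thesis
    using tangent_zero by (simp add: coord_field_def zero_fun_def)
qed

lemma coord_field_component:
  "c \<in> A \<Longrightarrow> x \<in> fst c \<Longrightarrow> v \<in> tangent_space A x \<Longrightarrow> coord_field A c (v c) x = v"
  by (rule tangent_vector_eqI[of _ x _ c]) (auto simp: coord_field_tangent)

lemma coord_field_sum:
  assumes c: "c \<in> A" "x \<in> fst c"
  shows "(\<Sum>b\<in>Basis. (e \<bullet> b) *\<^sub>R coord_field A c b x) = coord_field A c e x"
  by (rule tangent_vector_eqI[of _ x _ c])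
     (use c in \<open>auto intro!: tangent_sum tangent_scaleR coord_field_tangent
        simp: sum_fun_apply euclidean_representation\<close>)

subsection \<open>Directional derivatives\<close>

text \<open>
  The definition of \<open>tangent_deriv\<close> picks an unknown chart. By the chain rule and the transformation
  law, derivatives may be computed in any chart around the point.
\<close>

lemma tangent_deriv_eqI:
  assumes c: "c \<in> A" "x \<in> fst c" and v: "v \<in> tangent_space A x"
    and D: "((F \<circ> chart_inv c) has_derivative D) (at (snd c x))"
  shows "tangent_deriv A x v F = D (v c)"
proof -
  define d where "d = (SOME c. c \<in> A \<and> x \<in> fst c)"
  have d: "d \<in> A" "x \<in> fst d"
    using someI_ex[OF ex_chart[of x, unfolded Bex_def]] unfolding d_def by simp_all
  have "(F \<circ> chart_inv c) differentiable (at (snd c x))"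
    using D differentiable_def by blast
  from has_derivative_imp_frechet[OF chart_change_derivative[OF d(1) c(1) d(2) c(2) this]]
  have "tangent_deriv A x v F = frechet_derivative (F \<circ> chart_inv c) (at (snd c x)) (v c)"
    unfolding tangent_deriv_def Let_def d_def[symmetric]
    using tangent_space_transform[OF v d(1) c(1) d(2) c(2)] by simp
  then show ?thesis using has_derivative_imp_frechet[OF D] by simp
qed

lemma tangent_deriv_chart:
  assumes "smooth_function A U F" "x \<in> U" "c \<in> A" "x \<in> fst c" "v \<in> tangent_space A x"
  shows "tangent_deriv A x v F = frechet_derivative (F \<circ> chart_inv c) (at (snd c x)) (v c)"
  using tangent_deriv_eqI[OF assms(3-5)] smooth_function_differentiable[OF assms(1-4)]
  by (simp add: frechet_derivative_works)

lemma tangent_deriv_cong: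
  assumes "open U" "x \<in> U" "v \<in> tangent_space A x" "smooth_function A U F" "\<And>y. y \<in> U \<Longrightarrow> F y = F' y"
  shows "tangent_deriv A x v F' = tangent_deriv A x v F"
proof -
  obtain c where c: "c \<in> A" "x \<in> fst c" using ex_chart by blast
  have "(F \<circ> chart_inv c has_derivative frechet_derivative (F \<circ> chart_inv c) (at (snd c x))) (at (snd c x))"
    using smooth_function_differentiable[OF assms(4,2) c] by (simp add: frechet_derivative_works)
  then have "(F' \<circ> chart_inv c has_derivative frechet_derivative (F \<circ> chart_inv c) (at (snd c x))) (at (snd c x))"
    by (rule has_derivative_transform_within_open[OF _ chart_image_open[OF c(1) assms(1)]])
       (use c assms in auto)
  from tangent_deriv_eqI[OF c assms(3) this] tangent_deriv_chart[OF assms(4,2) c assms(3)]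
  show ?thesis by simp
qed

lemma tangent_deriv_const [simp]: "tangent_deriv A x v (\<lambda>y. a) = 0"
  by (simp add: tangent_deriv_def comp_def)

lemma tangent_deriv_bilinear:
  assumes P: "bounded_bilinear P" and x: "x \<in> U" "v \<in> tangent_space A x"
    and F: "smooth_function A U F" and H: "smooth_function A U H"
  shows "tangent_deriv A x v (\<lambda>y. P (F y) (H y)) =
    P (F x) (tangent_deriv A x v H) + P (tangent_deriv A x v F) (H x)"
proof -
  obtain c where c: "c \<in> A" "x \<in> fst c" using ex_chart by blast
  note dF = smooth_function_differentiable[OF F x(1) c, unfolded frechet_derivative_works]
  note dH = smooth_function_differentiable[OF H x(1) c, unfolded frechet_derivative_works]
  have "((\<lambda>y. P (F y) (H y)) \<circ> chart_inv c has_derivative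
     (\<lambda>v. P ((F \<circ> chart_inv c) (snd c x)) (frechet_derivative (H \<circ> chart_inv c) (at (snd c x)) v) +
          P (frechet_derivative (F \<circ> chart_inv c) (at (snd c x)) v) ((H \<circ> chart_inv c) (snd c x))))
     (at (snd c x))"
    using bounded_bilinear.FDERIV[OF P dF dH] by (simp add: comp_def)
  from tangent_deriv_eqI[OF c x(2) this] show ?thesis
    using c by (simp add: tangent_deriv_chart[OF F x(1) c x(2)] tangent_deriv_chart[OF H x(1) c x(2)])
qed

lemmas tangent_deriv_scaleR = tangent_deriv_bilinear[OF bounded_bilinear_scaleR]
lemmas tangent_deriv_mult = tangent_deriv_bilinear[OF bounded_bilinear_mult]

lemma tangent_deriv_compose:
  fixes F :: "'m \<Rightarrow> 'c::real_normed_vector"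
  assumes x: "x \<in> U" "v \<in> tangent_space A x"
    and F: "smooth_function A U F" and Q: "Q differentiable (at (F x))"
  shows "tangent_deriv A x v (\<lambda>y. Q (F y)) = frechet_derivative Q (at (F x)) (tangent_deriv A x v F)"
proof -
  obtain c where c: "c \<in> A" "x \<in> fst c" using ex_chart by blast
  note dF = smooth_function_differentiable[OF F x(1) c, unfolded frechet_derivative_works]
  have "(F \<circ> chart_inv c) (snd c x) = F x" using c by simp
  with Q have "(Q has_derivative frechet_derivative Q (at (F x))) (at ((F \<circ> chart_inv c) (snd c x)))"
    by (simp add: frechet_derivative_works)
  from has_derivative_compose[OF dF this]
  have "((\<lambda>y. Q (F y)) \<circ> chart_inv c has_derivative
     (\<lambda>v. frechet_derivative Q (at (F x)) (frechet_derivative (F \<circ> chart_inv c) (at (snd c x)) v))) (at (snd c x))"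
    by (simp add: comp_def)
  from tangent_deriv_eqI[OF c x(2) this] show ?thesis
    by (simp add: tangent_deriv_chart[OF F x(1) c x(2)])
qed

lemma tangent_deriv_linear:
  assumes "bounded_linear L" "x \<in> U" "v \<in> tangent_space A x" "smooth_function A U F"
  shows "tangent_deriv A x v (\<lambda>y. L (F y)) = L (tangent_deriv A x v F)"
  using tangent_deriv_compose[OF assms(2-4), of L]
    bounded_linear_imp_differentiable[OF assms(1)]
    has_derivative_imp_frechet[OF bounded_linear_imp_has_derivative[OF assms(1)]] by metis

lemma tangent_deriv_add:
  assumes x: "x \<in> U" "v \<in> tangent_space A x"
    and F: "smooth_function A U F" and H: "smooth_function A U H"
  shows "tangent_deriv A x v (\<lambda>y. F y + H y) = tangent_deriv A x v F + tangent_deriv A x v H"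
proof -
  obtain c where c: "c \<in> A" "x \<in> fst c" using ex_chart by blast
  note dF = smooth_function_differentiable[OF F x(1) c, unfolded frechet_derivative_works]
  note dH = smooth_function_differentiable[OF H x(1) c, unfolded frechet_derivative_works]
  have "((\<lambda>y. F y + H y) \<circ> chart_inv c has_derivative
     (\<lambda>v. frechet_derivative (F \<circ> chart_inv c) (at (snd c x)) v +
          frechet_derivative (H \<circ> chart_inv c) (at (snd c x)) v)) (at (snd c x))"
    using has_derivative_add[OF dF dH] by (simp add: comp_def)
  from tangent_deriv_eqI[OF c x(2) this] show ?thesis
    by (simp add: tangent_deriv_chart[OF F x(1) c x(2)] tangent_deriv_chart[OF H x(1) c x(2)])
qed

lemma tangent_deriv_sum:
  assumes "open U" "x \<in> U" "v \<in> tangent_space A x" "\<And>i. i \<in> I \<Longrightarrow> smooth_function A U (F i)"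
  shows "tangent_deriv A x v (\<lambda>y. \<Sum>i\<in>I. F i y) = (\<Sum>i\<in>I. tangent_deriv A x v (F i))"
  using assms(4)
proof (induction I rule: infinite_finite_induct)
  case (insert i I)
  then have "tangent_deriv A x v (\<lambda>y. F i y + (\<Sum>i\<in>I. F i y)) =
      tangent_deriv A x v (F i) + tangent_deriv A x v (\<lambda>y. \<Sum>i\<in>I. F i y)"
    by (intro tangent_deriv_add[OF assms(2,3)] smooth_function_sum[OF assms(1)]) auto
  with insert show ?case by simp
qed auto

lemma tangent_deriv_vector_linear:
  assumes F: "smooth_function A U F" "x \<in> U"
  shows "linear (\<lambda>v. tangent_deriv A x v F)"
proof -
  define d where "d = (SOME c. c \<in> A \<and> x \<in> fst c)"
  have d: "d \<in> A" "x \<in> fst d"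
    using someI_ex[OF ex_chart[of x, unfolded Bex_def]] unfolding d_def by simp_all
  note lin = linear_frechet_derivative[OF smooth_function_differentiable[OF F d]]
  show ?thesis
    unfolding tangent_deriv_def Let_def d_def[symmetric]
    by (rule linearI) (simp_all add: linear_add[OF lin] linear_cmul[OF lin])
qed

subsection \<open>Vector fields\<close>

lemma vector_field_tangent: "vector_field A U X \<Longrightarrow> x \<in> U \<Longrightarrow> X x \<in> tangent_space A x"
  and vector_field_component: "vector_field A U X \<Longrightarrow> c \<in> A \<Longrightarrow> smooth_function A (U \<inter> fst c) (\<lambda>x. X x c)"
  by (auto simp: vector_field_def)

text \<open>
  By the transformation law, smooth components in one chart around each point force the components
  in all charts to be smooth.
\<close>

lemma vector_fieldI:
  assumes U: "open U" and T: "\<And>x. x \<in> U \<Longrightarrow> X x \<in> tangent_space A x"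
    and sm: "\<And>x. x \<in> U \<Longrightarrow> \<exists>c\<in>A. x \<in> fst c \<and> smooth_function A (U \<inter> fst c) (\<lambda>x. X x c)"
  shows "vector_field A U X"
  unfolding vector_field_def
proof (intro conjI ballI T smooth_function_local_chart)
  fix d x assume d: "d \<in> A" and x: "x \<in> U \<inter> fst d"
  obtain c where c: "c \<in> A" "x \<in> fst c" "smooth_function A (U \<inter> fst c) (\<lambda>x. X x c)"
    using sm x by blast
  let ?W = "U \<inter> fst d \<inter> fst c"
  have W: "open ?W" by (intro open_chart_domain c d U)
  have oW: "open (snd c ` ?W)" by (rule chart_image_open_subset[OF c(1) W]) auto
  have "smooth_on (snd c ` ?W) (\<lambda>y. frechet_derivative (snd d \<circ> chart_inv c) (at y) (((\<lambda>x. X x c) \<circ> chart_inv c) y))"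
    by (intro smooth_on_frechet_field[OF oW] smooth_on_subset[OF transition_smooth[OF c(1) d]]
        smooth_function_chart[OF c(3,1)]) auto
  then have "smooth_on (snd c ` ?W) ((\<lambda>x. X x d) \<circ> chart_inv c)"
    by (rule smooth_on_cong[OF oW, rotated])
       (use c d T in \<open>auto intro!: tangent_space_transform[symmetric]\<close>)
  then show "\<exists>c\<in>A. \<exists>W. open W \<and> x \<in> W \<and> W \<subseteq> fst c \<and> smooth_on (snd c ` W) ((\<lambda>x. X x d) \<circ> chart_inv c)"
    using W c x by (intro bexI[of _ c] exI[of _ ?W]) auto
qed

lemma vector_field_subset: "vector_field A U X \<Longrightarrow> V \<subseteq> U \<Longrightarrow> vector_field A V X"
  unfolding vector_field_def by (meson Int_mono order_refl smooth_function_subset subsetD)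

lemma vector_field_add:
  assumes "open U" "vector_field A U X" "vector_field A U Y"
  shows "vector_field A U (\<lambda>x. X x + Y x)"
proof -
  have "smooth_function A (U \<inter> fst c) (\<lambda>x. (X x + Y x) c)" if "c \<in> A" for c
    using smooth_function_add[OF open_chart_domain[OF that assms(1)]
        vector_field_component[OF assms(2) that] vector_field_component[OF assms(3) that]]
    by simp
  then show ?thesis
    using assms(2,3) tangent_add unfolding vector_field_def by blast
qed

lemma vector_field_zero: "vector_field A U (\<lambda>x. 0)"
  unfolding vector_field_def by (auto intro!: tangent_zero smooth_function_const)

lemma vector_field_scaleR:
  assumes "open U" "smooth_function A U a" "vector_field A U X"
  shows "vector_field A U (\<lambda>x. a x *\<^sub>R X x)"
  using assms unfolding vector_field_def
  by (auto intro!: tangent_scaleR smooth_function_scaleR smooth_function_subset[OF assms(2)]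
      open_chart_domain simp del: split_paired_All split_paired_Ex)

lemma vector_field_sum:
  assumes "open U" "\<And>i. i \<in> I \<Longrightarrow> vector_field A U (X i)"
  shows "vector_field A U (\<lambda>x. \<Sum>i\<in>I. X i x)"
  using assms(2)
proof (induction I rule: infinite_finite_induct)
  case (insert i I)
  then show ?case
    unfolding sum.insert[OF insert(1,2)] by (intro vector_field_add[OF assms(1)]) auto
qed (auto intro: vector_field_zero)

lemma coord_field_vector_field:
  assumes c: "c \<in> A"
  shows "vector_field A (fst c) (coord_field A c e)"
proof (rule vector_fieldI[OF chart_open[OF c] coord_field_tangent[OF c]])
  fix x assume x: "x \<in> fst c"
  have "smooth_function A (fst c \<inter> fst c) (\<lambda>x. coord_field A c e x c)"
    by (rule smooth_function_cong[of _ "\<lambda>x. e"]) (use c chart_open in \<open>auto intro: smooth_function_const\<close>)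
  then show "\<exists>c'\<in>A. x \<in> fst c' \<and> smooth_function A (fst c \<inter> fst c') (\<lambda>x. coord_field A c e x c')"
    using c x by blast
qed

lemma smooth_function_tangent_deriv:
  assumes U: "open U" and F: "smooth_function A U F" and X: "vector_field A U X"
  shows "smooth_function A U (\<lambda>x. tangent_deriv A x (X x) F)"
proof (rule smooth_function_local_chart)
  fix x assume x: "x \<in> U"
  obtain c where c: "c \<in> A" "x \<in> fst c" using ex_chart by blast
  let ?W = "U \<inter> fst c"
  have W: "open ?W" by (intro open_chart_domain c U)
  have oW: "open (snd c ` ?W)" by (rule chart_image_open[OF c(1) U])
  have "smooth_on (snd c ` ?W) (\<lambda>y. frechet_derivative (F \<circ> chart_inv c) (at y) (((\<lambda>x. X x c) \<circ> chart_inv c) y))"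
    by (intro smooth_on_frechet_field[OF oW] smooth_function_chart[OF F c(1)]
        smooth_function_chart[OF vector_field_component[OF X c(1)] c(1)]) auto
  then have "smooth_on (snd c ` ?W) ((\<lambda>x. tangent_deriv A x (X x) F) \<circ> chart_inv c)"
    by (rule smooth_on_cong[OF oW, rotated])
       (use c in \<open>auto simp: tangent_deriv_chart[OF F] vector_field_tangent[OF X]\<close>)
  then show "\<exists>c\<in>A. \<exists>W. open W \<and> x \<in> W \<and> W \<subseteq> fst c \<and>
      smooth_on (snd c ` W) ((\<lambda>x. tangent_deriv A x (X x) F) \<circ> chart_inv c)"
    using W c x by (intro bexI[of _ c] exI[of _ ?W]) auto
qed

subsection \<open>Fields of endomorphisms\<close>

lemma
  assumes "tensor_field_11 A J" "u \<in> tangent_space A x"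
  shows endomorphism_tangent: "J x u \<in> tangent_space A x"
    and endomorphism_add: "v \<in> tangent_space A x \<Longrightarrow> J x (u + v) = J x u + J x v"
    and endomorphism_scaleR: "J x (a *\<^sub>R u) = a *\<^sub>R J x u"
  using assms unfolding tensor_field_11_def by blast+

lemma endomorphism_vector_field:
  "tensor_field_11 A J \<Longrightarrow> open U \<Longrightarrow> vector_field A U X \<Longrightarrow> vector_field A U (\<lambda>x. J x (X x))"
  unfolding tensor_field_11_def by blast

lemma endomorphism_sum:
  assumes "tensor_field_11 A J" "\<And>i. i \<in> I \<Longrightarrow> u i \<in> tangent_space A x"
  shows "J x (\<Sum>i\<in>I. u i) = (\<Sum>i\<in>I. J x (u i))"
proof -
  have "J x 0 = 0"
    using endomorphism_scaleR[OF assms(1) tangent_zero, of x 0] by simp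
  with assms(2) show ?thesis
    by (induction I rule: infinite_finite_induct)
       (simp_all add: endomorphism_add[OF assms(1)] tangent_sum)
qed

end

section \<open>Smooth maps\<close>

locale smooth_map_manifolds = M: smooth_manifold A + N: smooth_manifold B
  for A :: "('m::{t2_space,second_countable_topology}, 'e::euclidean_space) chart set"
    and B :: "('n::{t2_space,second_countable_topology}, 'f::euclidean_space) chart set" +
  fixes f :: "'m \<Rightarrow> 'n"
  assumes smooth: "smooth_map A B f"
begin

abbreviation df where "df \<equiv> differential A B f"

lemma open_preimage: "open V \<Longrightarrow> open (f -` V)"
  using smooth continuous_on_open_vimage[of UNIV f] by (auto simp: smooth_map_def)

lemma smooth_chart_map: "d \<in> B \<Longrightarrow> smooth_function A (f -` fst d) (\<lambda>x. snd d (f x))"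
  using smooth by (auto simp: smooth_map_def comp_def)

lemma differential_component:
  "d \<in> B \<Longrightarrow> f x \<in> fst d \<Longrightarrow> df x v d = tangent_deriv A x v (\<lambda>y. snd d (f y))"
  by (simp add: differential_def comp_def)

text \<open>
  Near \<open>x\<close>, the function \<open>Q \<circ> f\<close> is its coordinate representation in \<open>d\<close> composed with the smooth
  map \<open>snd d \<circ> f\<close> into the model space, so the chain rule in Euclidean space applies.
\<close>

lemma compose_in_chart:
  assumes "open W" "smooth_function B W Q" "d \<in> B" "f x \<in> W" "f x \<in> fst d" "v \<in> tangent_space A x"
  shows "tangent_deriv A x v (\<lambda>y. Q (f y)) =
     frechet_derivative (Q \<circ> chart_inv d) (at (snd d (f x))) (df x v d)"
    and "smooth_function A (f -` (W \<inter> fst d)) (\<lambda>y. Q (f y))"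
proof -
  let ?V = "f -` (W \<inter> fst d)"
  have V: "open ?V" by (intro open_preimage open_Int assms N.chart_open)
  have sd: "smooth_function A ?V (\<lambda>x. snd d (f x))"
    using smooth_chart_map[OF assms(3)] by (rule M.smooth_function_subset) auto
  have sQ: "smooth_on (snd d ` (W \<inter> fst d)) (Q \<circ> chart_inv d)"
    using assms by (simp add: smooth_function_def)
  have sm: "smooth_function A ?V (\<lambda>y. (Q \<circ> chart_inv d) (snd d (f y)))"
    by (rule M.smooth_function_compose[OF V _ sd sQ]) auto
  then show "smooth_function A ?V (\<lambda>y. Q (f y))"
    by (rule M.smooth_function_cong[OF V, rotated]) (use assms in simp)
  have "tangent_deriv A x v (\<lambda>y. Q (f y)) = tangent_deriv A x v (\<lambda>y. (Q \<circ> chart_inv d) (snd d (f y)))"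
    by (rule M.tangent_deriv_cong[OF V _ assms(6) sm]) (use assms in auto)
  also have "\<dots> = frechet_derivative (Q \<circ> chart_inv d) (at (snd d (f x))) (tangent_deriv A x v (\<lambda>y. snd d (f y)))"
    using N.smooth_function_differentiable[OF assms(2,4,3,5)] assms(4,5)
    by (intro M.tangent_deriv_compose[OF _ assms(6) sd]) (simp_all del: comp_apply)
  finally show "tangent_deriv A x v (\<lambda>y. Q (f y)) =
     frechet_derivative (Q \<circ> chart_inv d) (at (snd d (f x))) (df x v d)"
    using assms by (simp add: differential_component)
qed

lemma smooth_function_pullback:
  assumes "open W" "smooth_function B W Q"
  shows "smooth_function A (f -` W) (\<lambda>y. Q (f y))"
proof (rule M.smooth_function_local)
  fix x assume x: "x \<in> f -` W"
  obtain d where d: "d \<in> B" "f x \<in> fst d" using N.ex_chart by blast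
  show "\<exists>V. open V \<and> x \<in> V \<and> smooth_function A V (\<lambda>y. Q (f y))"
    \<comment> \<open>The premises are shared with the formula for the derivative, hence mention a tangent vector;
       the zero vector serves as one.\<close>
    using compose_in_chart(2)[OF assms d(1) _ d(2) M.tangent_zero] x d
    by (intro exI[of _ "f -` (W \<inter> fst d)"]) (auto intro!: open_preimage open_Int assms N.chart_open)
qed

lemma differential_tangent:
  assumes v: "v \<in> tangent_space A x" shows "df x v \<in> tangent_space B (f x)"
  unfolding tangent_space_def
proof (intro CollectI conjI ballI allI impI)
  fix d d' assume d: "d \<in> B" "d' \<in> B" "f x \<in> fst d" "f x \<in> fst d'"
  show "df x v d' = frechet_derivative (snd d' \<circ> chart_inv d) (at (snd d (f x))) (df x v d)"
    unfolding differential_component[OF d(2,4)]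
    by (rule compose_in_chart(1)[OF N.chart_open[OF d(2)] N.smooth_function_coordinates[OF d(2)] d(1,4,3) v])
qed (auto simp: differential_def)

lemma tangent_deriv_pullback:
  assumes "open W" "smooth_function B W Q" "f x \<in> W" "v \<in> tangent_space A x"
  shows "tangent_deriv A x v (\<lambda>y. Q (f y)) = tangent_deriv B (f x) (df x v) Q"
proof -
  obtain d where d: "d \<in> B" "f x \<in> fst d" using N.ex_chart by blast
  show ?thesis
    unfolding compose_in_chart(1)[OF assms(1,2) d(1) assms(3) d(2) assms(4)]
    by (rule N.tangent_deriv_chart[OF assms(2,3) d differential_tangent[OF assms(4)], symmetric])
qed

lemma differential_linear: "linear (df x)"
proof -
  have lin: "linear (\<lambda>v. tangent_deriv A x v (snd d \<circ> f))" if "d \<in> B" "f x \<in> fst d" for d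
    using M.tangent_deriv_vector_linear[OF smooth_chart_map[OF that(1)]] that by (simp add: comp_def)
  then show ?thesis
    unfolding differential_def
    by (intro linearI ext) (simp_all add: linear_add[OF lin] linear_cmul[OF lin])
qed

lemma smooth_differential_component:
  assumes U: "open U" and X: "vector_field A U X" and d: "d \<in> B"
  shows "smooth_function A (U \<inter> f -` fst d) (\<lambda>x. df x (X x) d)"
proof (rule M.smooth_function_cong)
  show op: "open (U \<inter> f -` fst d)" using U open_preimage N.chart_open[OF d] by auto
  show "smooth_function A (U \<inter> f -` fst d) (\<lambda>x. tangent_deriv A x (X x) (\<lambda>y. snd d (f y)))"
    by (intro M.smooth_function_tangent_deriv[OF op] M.smooth_function_subset[OF smooth_chart_map[OF d]]
        M.vector_field_subset[OF X]) auto
qed (use d in \<open>simp add: differential_component\<close>)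

end

section \<open>Connections in coordinates\<close>

locale affine_manifold = smooth_manifold A
  for A :: "('m::{t2_space,second_countable_topology}, 'e::euclidean_space) chart set" +
  fixes nabla :: "('m \<Rightarrow> ('m, 'e) tvec) \<Rightarrow> ('m \<Rightarrow> ('m, 'e) tvec) \<Rightarrow> 'm \<Rightarrow> ('m, 'e) tvec"
  assumes affine: "affine_connection A nabla"
begin

lemma
  assumes "open U" "vector_field A U X" "vector_field A U Y"
  shows nabla_vector_field: "vector_field A U (nabla X Y)"
    and nabla_add_left: "vector_field A U Z \<Longrightarrow> x \<in> U \<Longrightarrow>
          nabla (\<lambda>y. X y + Z y) Y x = nabla X Y x + nabla Z Y x"
    and nabla_add_right: "vector_field A U Z \<Longrightarrow> x \<in> U \<Longrightarrow>
          nabla X (\<lambda>y. Y y + Z y) x = nabla X Y x + nabla X Z x"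
    and nabla_scaleR_left: "smooth_function A U a \<Longrightarrow> x \<in> U \<Longrightarrow>
          nabla (\<lambda>y. a y *\<^sub>R X y) Y x = a x *\<^sub>R nabla X Y x"
    and nabla_scaleR_right: "smooth_function A U a \<Longrightarrow> x \<in> U \<Longrightarrow>
          nabla X (\<lambda>y. a y *\<^sub>R Y y) x = a x *\<^sub>R nabla X Y x + tangent_deriv A x (X x) a *\<^sub>R Y x"
    and nabla_cong: "x \<in> U \<Longrightarrow> (\<And>y. y \<in> U \<Longrightarrow> X' y = X y) \<Longrightarrow> (\<And>y. y \<in> U \<Longrightarrow> Y' y = Y y) \<Longrightarrow>
          nabla X' Y' x = nabla X Y x"
  using affine[unfolded affine_connection_def, rule_format, of U X Y] assms
  unfolding plus_fun_def[of X] plus_fun_def[of Y] by blast+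

lemma nabla_tangent:
  "open U \<Longrightarrow> vector_field A U X \<Longrightarrow> vector_field A U Y \<Longrightarrow> x \<in> U \<Longrightarrow> nabla X Y x \<in> tangent_space A x"
  using nabla_vector_field vector_field_tangent by blast

lemma nabla_sum_left:
  assumes U: "open U" "x \<in> U" and Y: "vector_field A U Y"
    and X: "\<And>i. i \<in> I \<Longrightarrow> vector_field A U (X i)" and a: "\<And>i. i \<in> I \<Longrightarrow> smooth_function A U (a i)"
  shows "nabla (\<lambda>y. \<Sum>i\<in>I. a i y *\<^sub>R X i y) Y x = (\<Sum>i\<in>I. a i x *\<^sub>R nabla (X i) Y x)"
proof -
  \<comment> \<open>Take the constant coefficient \<open>0\<close> in the rule for function multiples.\<close>
  have zero: "nabla (\<lambda>y. 0) Y x = 0"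
    using nabla_scaleR_left[OF U(1) Y Y smooth_function_const[of _ 0] U(2)] by simp
  show ?thesis
    using X a
  proof (induction I rule: infinite_finite_induct)
    case (insert i I)
    have 1: "vector_field A U (\<lambda>y. a i y *\<^sub>R X i y)"
      and 2: "vector_field A U (\<lambda>y. \<Sum>i\<in>I. a i y *\<^sub>R X i y)"
      using insert.prems by (auto intro!: vector_field_scaleR vector_field_sum U(1))
    have 3: "nabla (\<lambda>y. a i y *\<^sub>R X i y) Y x = a i x *\<^sub>R nabla (X i) Y x"
      using insert.prems U by (intro nabla_scaleR_left[OF U(1) _ Y]) auto
    have 4: "nabla (\<lambda>y. \<Sum>i\<in>I. a i y *\<^sub>R X i y) Y x = (\<Sum>i\<in>I. a i x *\<^sub>R nabla (X i) Y x)"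
      using insert.prems by (intro insert.IH) auto
    show ?case
      unfolding sum.insert[OF insert.hyps] nabla_add_left[OF U(1) 1 Y 2 U(2)] 3 4 ..
  qed (simp_all add: zero)
qed

lemma nabla_sum_right:
  assumes U: "open U" "x \<in> U" and X: "vector_field A U X"
    and Y: "\<And>i. i \<in> I \<Longrightarrow> vector_field A U (Y i)" and a: "\<And>i. i \<in> I \<Longrightarrow> smooth_function A U (a i)"
  shows "nabla X (\<lambda>y. \<Sum>i\<in>I. a i y *\<^sub>R Y i y) x =
    (\<Sum>i\<in>I. a i x *\<^sub>R nabla X (Y i) x + tangent_deriv A x (X x) (a i) *\<^sub>R Y i x)"
proof -
  have zero: "nabla X (\<lambda>y. 0) x = 0"
    using nabla_scaleR_right[OF U(1) X X smooth_function_const[of _ 0] U(2)] by simp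
  show ?thesis
    using Y a
  proof (induction I rule: infinite_finite_induct)
    case (insert i I)
    have 1: "vector_field A U (\<lambda>y. a i y *\<^sub>R Y i y)"
      and 2: "vector_field A U (\<lambda>y. \<Sum>i\<in>I. a i y *\<^sub>R Y i y)"
      using insert.prems by (auto intro!: vector_field_scaleR vector_field_sum U(1))
    have 3: "nabla X (\<lambda>y. a i y *\<^sub>R Y i y) x = a i x *\<^sub>R nabla X (Y i) x + tangent_deriv A x (X x) (a i) *\<^sub>R Y i x"
      using insert.prems U by (intro nabla_scaleR_right[OF U(1) X]) auto
    have 4: "nabla X (\<lambda>y. \<Sum>i\<in>I. a i y *\<^sub>R Y i y) x =
        (\<Sum>i\<in>I. a i x *\<^sub>R nabla X (Y i) x + tangent_deriv A x (X x) (a i) *\<^sub>R Y i x)"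
      using insert.prems by (intro insert.IH) auto
    show ?case
      unfolding sum.insert[OF insert.hyps] nabla_add_right[OF U(1) X 1 2 U(2)] 3 4 ..
  qed (simp_all add: zero)
qed

lemma component_expansion:
  assumes "c \<in> A" "x \<in> fst c" "v \<in> tangent_space A x"
  shows "(\<Sum>b\<in>Basis. (v c \<bullet> b) *\<^sub>R coord_field A c b x) = v"
  using coord_field_sum[OF assms(1,2)] coord_field_component[OF assms] by simp

text \<open>
  A connection is tensorial in the first slot: near \<open>x\<close>, the field \<open>X\<close> is a combination of coordinate
  fields, and only the values of the coefficients at \<open>x\<close> enter.
\<close>

lemma nabla_coord_left:
  assumes U: "open U" "x \<in> U" "U \<subseteq> fst c" and c: "c \<in> A"
    and X: "vector_field A U X" and Y: "vector_field A U Y"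
  shows "nabla X Y x = nabla (coord_field A c (X x c)) Y x"
proof -
  have E: "vector_field A U (coord_field A c e)" for e
    using coord_field_vector_field[OF c] U(3) by (rule vector_field_subset)
  have sX: "smooth_function A U (\<lambda>y. X y c \<bullet> b)" for b
    using smooth_function_inner[OF U(1) smooth_function_subset[OF vector_field_component[OF X c]]] U(3) by blast
  have "nabla X Y x = nabla (\<lambda>y. \<Sum>b\<in>Basis. (X y c \<bullet> b) *\<^sub>R coord_field A c b y) Y x"
    by (rule nabla_cong[OF U(1) X Y U(2), symmetric])
       (use U(3) in \<open>auto intro!: component_expansion c vector_field_tangent[OF X]\<close>)
  also have "\<dots> = (\<Sum>b\<in>Basis. (X x c \<bullet> b) *\<^sub>R nabla (coord_field A c b) Y x)"
    by (rule nabla_sum_left[OF U(1,2) Y E sX])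
  also have "\<dots> = nabla (\<lambda>y. \<Sum>b\<in>Basis. (X x c \<bullet> b) *\<^sub>R coord_field A c b y) Y x"
    by (rule nabla_sum_left[OF U(1,2) Y E smooth_function_const, symmetric])
  also have "\<dots> = nabla (coord_field A c (X x c)) Y x"
    by (rule nabla_cong[OF U(1) E Y U(2)]) (use U(3) c in \<open>auto intro!: coord_field_sum\<close>)
  finally show ?thesis .
qed

lemma christoffel_linear: "c \<in> A \<Longrightarrow> x \<in> fst c \<Longrightarrow> linear (christoffel A nabla c x u)"
proof -
  assume c: "c \<in> A" "x \<in> fst c"
  note E = coord_field_vector_field[OF c(1)] and op = chart_open[OF c(1)]
  have t: "coord_field A c e y \<in> tangent_space A y" for e y
    by (rule coord_field_tangent[OF c(1)])
  have add: "nabla (coord_field A c u) (coord_field A c (v + w)) x =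
      nabla (coord_field A c u) (\<lambda>y. coord_field A c v y + coord_field A c w y) x" for v w
    by (rule nabla_cong[OF op E vector_field_add[OF op E E] c(2) refl])
       (rule tangent_vector_eqI[OF t tangent_add[OF t t] c(1)], use c in auto)
  have scale: "nabla (coord_field A c u) (coord_field A c (a *\<^sub>R v)) x =
      nabla (coord_field A c u) (\<lambda>y. a *\<^sub>R coord_field A c v y) x" for a v
    by (rule nabla_cong[OF op E vector_field_scaleR[OF op smooth_function_const E] c(2) refl])
       (rule tangent_vector_eqI[OF t tangent_scaleR[OF t] c(1)], use c in auto)
  show ?thesis
    unfolding christoffel_def
    by (rule linearI)
       (simp_all add: add scale nabla_add_right[OF op E E E c(2)]
          nabla_scaleR_right[OF op E E smooth_function_const c(2)])
qed

text \<open>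
  The Leibniz rule for the expansion of \<open>Y\<close> in coordinate fields. The right-hand side is
  the shape of the definition of \<open>cov_deriv_along\<close>, which links the latter to the connection.
\<close>

lemma nabla_in_coordinates:
  assumes U: "open U" "x \<in> U" and c: "c \<in> A" "x \<in> fst c"
    and X: "vector_field A U X" and Y: "vector_field A U Y"
  shows "nabla X Y x c =
    tangent_deriv A x (X x) (\<lambda>y. Y y c) + christoffel A nabla c x (X x c) (Y x c)"
proof -
  let ?U = "U \<inter> fst c" and ?E = "coord_field A c"
  have oU: "open ?U" "x \<in> ?U" "?U \<subseteq> fst c" using U c open_chart_domain by auto
  have E: "vector_field A ?U (?E e)" for e
    using coord_field_vector_field[OF c(1)] oU(3) by (rule vector_field_subset)
  have X': "vector_field A ?U X" and Y': "vector_field A ?U Y"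
    using X Y by (auto intro: vector_field_subset)
  have sY: "smooth_function A ?U (\<lambda>y. Y y c)" by (rule vector_field_component[OF Y c(1)])
  have sY': "smooth_function A ?U (\<lambda>y. Y y c \<bullet> b)" for b
    by (rule smooth_function_inner[OF oU(1) sY])
  have tX: "X x \<in> tangent_space A x" by (rule vector_field_tangent[OF X U(2)])
  have "nabla X Y x = nabla X (\<lambda>y. \<Sum>b\<in>Basis. (Y y c \<bullet> b) *\<^sub>R ?E b y) x"
    by (rule nabla_cong[OF oU(1) X' Y' oU(2), symmetric])
       (auto intro!: component_expansion c vector_field_tangent[OF Y])
  also have "\<dots> = (\<Sum>b\<in>Basis. (Y x c \<bullet> b) *\<^sub>R nabla X (?E b) x +
      tangent_deriv A x (X x) (\<lambda>y. Y y c \<bullet> b) *\<^sub>R ?E b x)"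
    by (rule nabla_sum_right[OF oU(1,2) X' E sY'])
  finally have "nabla X Y x c = (\<Sum>b\<in>Basis. (Y x c \<bullet> b) *\<^sub>R nabla X (?E b) x c +
      tangent_deriv A x (X x) (\<lambda>y. Y y c \<bullet> b) *\<^sub>R b)"
    using c by (simp add: sum_fun_apply)
  also have "\<dots> = (\<Sum>b\<in>Basis. (Y x c \<bullet> b) *\<^sub>R christoffel A nabla c x (X x c) b) +
      (\<Sum>b\<in>Basis. (tangent_deriv A x (X x) (\<lambda>y. Y y c) \<bullet> b) *\<^sub>R b)"
    unfolding sum.distrib christoffel_def nabla_coord_left[OF oU c(1) X' E]
      tangent_deriv_linear[OF bounded_linear_inner_left oU(2) tX sY] ..
  also have "\<dots> = tangent_deriv A x (X x) (\<lambda>y. Y y c) + christoffel A nabla c x (X x c) (Y x c)"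
    using derivative_euclidean_expansion[OF christoffel_linear[OF c], of "X x c" "Y x c"]
    by (simp add: euclidean_representation)
  finally show ?thesis .
qed

end

section \<open>Riemannian metrics\<close>

locale riemannian_manifold = smooth_manifold A
  for A :: "('m::{t2_space,second_countable_topology}, 'e::euclidean_space) chart set" +
  fixes g :: "'m \<Rightarrow> ('m, 'e) tvec \<Rightarrow> ('m, 'e) tvec \<Rightarrow> real"
  assumes metric: "riemannian_metric A g"
begin

lemma
  assumes "u \<in> tangent_space A x" "v \<in> tangent_space A x"
  shows metric_sym: "g x u v = g x v u"
    and metric_add_left: "w \<in> tangent_space A x \<Longrightarrow> g x (u + v) w = g x u w + g x v w"
    and metric_scaleR_left: "g x (a *\<^sub>R u) v = a * g x u v"
    and metric_pos: "u \<noteq> 0 \<Longrightarrow> g x u u > 0"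
  using metric[unfolded riemannian_metric_def] assms by blast+

lemma metric_add_right:
  "u \<in> tangent_space A x \<Longrightarrow> v \<in> tangent_space A x \<Longrightarrow> w \<in> tangent_space A x \<Longrightarrow>
    g x w (u + v) = g x w u + g x w v"
  by (metis metric_sym metric_add_left tangent_add)

lemma metric_scaleR_right:
  "u \<in> tangent_space A x \<Longrightarrow> v \<in> tangent_space A x \<Longrightarrow> g x v (a *\<^sub>R u) = a * g x v u"
  by (metis metric_sym metric_scaleR_left tangent_scaleR)

lemma metric_zero_left: "v \<in> tangent_space A x \<Longrightarrow> g x 0 v = 0"
  using metric_scaleR_left[OF tangent_zero, of v x 0] by simp

lemma metric_zero_right: "v \<in> tangent_space A x \<Longrightarrow> g x v 0 = 0"
  using metric_scaleR_right[OF tangent_zero, of v x 0] by simp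

lemma metric_sum_left:
  "(\<And>i. i \<in> I \<Longrightarrow> u i \<in> tangent_space A x) \<Longrightarrow> v \<in> tangent_space A x \<Longrightarrow>
    g x (\<Sum>i\<in>I. u i) v = (\<Sum>i\<in>I. g x (u i) v)"
  by (induction I rule: infinite_finite_induct) (simp_all add: metric_zero_left metric_add_left tangent_sum)

lemma metric_sum_right:
  "(\<And>i. i \<in> I \<Longrightarrow> u i \<in> tangent_space A x) \<Longrightarrow> v \<in> tangent_space A x \<Longrightarrow>
    g x v (\<Sum>i\<in>I. u i) = (\<Sum>i\<in>I. g x v (u i))"
  by (induction I rule: infinite_finite_induct) (simp_all add: metric_zero_right metric_add_right tangent_sum)

lemma metric_double_sum:
  assumes "\<And>i. i \<in> I \<Longrightarrow> u i \<in> tangent_space A x" "\<And>j. j \<in> K \<Longrightarrow> w j \<in> tangent_space A x"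
  shows "g x (\<Sum>i\<in>I. a i *\<^sub>R u i) (\<Sum>j\<in>K. c j *\<^sub>R w j) = (\<Sum>i\<in>I. \<Sum>j\<in>K. a i * (c j * g x (u i) (w j)))"
  by (simp add: metric_sum_left metric_sum_right metric_scaleR_left metric_scaleR_right
      assms tangent_scaleR tangent_sum sum_distrib_left)
     (subst sum.swap, simp add: mult.left_commute)

lemma metric_diff_left:
  assumes "u \<in> tangent_space A x" "v \<in> tangent_space A x" "w \<in> tangent_space A x"
  shows "g x (u - v) w = g x u w - g x v w"
  using metric_add_left[OF assms(2) tangent_diff[OF assms(1,2)] assms(3)] by simp

lemma metric_definite: "u \<in> tangent_space A x \<Longrightarrow> g x u u = 0 \<Longrightarrow> u = 0"
  using metric_pos by (metis less_irrefl)

lemma metric_smooth: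
  "open U \<Longrightarrow> vector_field A U X \<Longrightarrow> vector_field A U Y \<Longrightarrow> smooth_function A U (\<lambda>x. g x (X x) (Y x))"
  using metric unfolding riemannian_metric_def by blast

end

locale levi_civita_manifold = riemannian_manifold A g
  for A :: "('m::{t2_space,second_countable_topology}, 'e::euclidean_space) chart set"
    and g :: "'m \<Rightarrow> ('m, 'e) tvec \<Rightarrow> ('m, 'e) tvec \<Rightarrow> real" +
  fixes nabla :: "('m \<Rightarrow> ('m, 'e) tvec) \<Rightarrow> ('m \<Rightarrow> ('m, 'e) tvec) \<Rightarrow> 'm \<Rightarrow> ('m, 'e) tvec"
  assumes levi_civita: "levi_civita A g nabla"
begin

sublocale affine_manifold A nabla
  by unfold_locales (use levi_civita in \<open>simp add: levi_civita_def\<close>)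

lemma nabla_torsion_free:
  "open U \<Longrightarrow> vector_field A U X \<Longrightarrow> vector_field A U Y \<Longrightarrow> x \<in> U \<Longrightarrow>
    nabla X Y x - nabla Y X x = lie_bracket A X Y x"
  using levi_civita unfolding levi_civita_def by blast

lemma nabla_metric:
  "open U \<Longrightarrow> vector_field A U X \<Longrightarrow> vector_field A U Y \<Longrightarrow> vector_field A U Z \<Longrightarrow> x \<in> U \<Longrightarrow>
    tangent_deriv A x (X x) (\<lambda>y. g y (Y y) (Z y)) = g x (nabla X Y x) (Z x) + g x (Y x) (nabla X Z x)"
  using levi_civita unfolding levi_civita_def by blast

text \<open>
  Coordinate fields commute, since their components in their own chart are constant.
\<close>

lemma christoffel_sym:
  assumes c: "c \<in> A" "x \<in> fst c"
  shows "christoffel A nabla c x u w = christoffel A nabla c x w u"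
proof -
  note E = coord_field_vector_field[OF c(1)] and op = chart_open[OF c(1)]
  have "tangent_deriv A x (coord_field A c v x) (\<lambda>y. coord_field A c e y c) = 0" for v e
    using tangent_deriv_cong[OF op c(2) coord_field_tangent[OF c(1)] smooth_function_const,
        of e "\<lambda>y. coord_field A c e y c" v] c by simp
  then have "lie_bracket A (coord_field A c u) (coord_field A c w) x c = 0"
    by (simp add: lie_bracket_def)
  then show ?thesis
    unfolding christoffel_def
    using fun_cong[OF nabla_torsion_free[OF op E E c(2)], of u w c] by simp
qed

end

section \<open>Sections along a map\<close>

definition section_along ::
  "('m, 'e::euclidean_space) chart set \<Rightarrow> ('n, 'f::euclidean_space) chart set \<Rightarrow> ('m \<Rightarrow> 'n) \<Rightarrow>
   'm set \<Rightarrow> ('m \<Rightarrow> ('n, 'f) tvec) \<Rightarrow> bool" where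
  "section_along A B f U V \<longleftrightarrow> (\<forall>x\<in>U. V x \<in> tangent_space B (f x)) \<and>
     (\<forall>d\<in>B. smooth_function A (U \<inter> f -` fst d) (\<lambda>x. V x d))"

context smooth_map_manifolds
begin

lemma section_tangent: "section_along A B f U V \<Longrightarrow> x \<in> U \<Longrightarrow> V x \<in> tangent_space B (f x)"
  and section_component: "section_along A B f U V \<Longrightarrow> d \<in> B \<Longrightarrow> smooth_function A (U \<inter> f -` fst d) (\<lambda>x. V x d)"
  by (auto simp: section_along_def)

lemma open_chart_preimage: "open U \<Longrightarrow> d \<in> B \<Longrightarrow> open (U \<inter> f -` fst d)"
  using open_preimage N.chart_open by blast

lemma section_local:
  assumes "\<And>x. x \<in> U \<Longrightarrow> \<exists>W. open W \<and> x \<in> W \<and> section_along A B f W V"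
  shows "section_along A B f U V"
  unfolding section_along_def
proof (intro conjI ballI)
  fix x assume "x \<in> U" then show "V x \<in> tangent_space B (f x)"
    using assms section_tangent by blast
next
  fix d assume d: "d \<in> B"
  show "smooth_function A (U \<inter> f -` fst d) (\<lambda>x. V x d)"
  proof (rule M.smooth_function_local)
    fix x assume "x \<in> U \<inter> f -` fst d"
    then obtain W where "open W" "x \<in> W \<inter> f -` fst d" "section_along A B f W V" using assms by blast
    then show "\<exists>W. open W \<and> x \<in> W \<and> smooth_function A W (\<lambda>x. V x d)"
      using section_component[OF _ d] open_chart_preimage[OF _ d] by blast
  qed
qed

text \<open>
  Ambient vector fields along \<open>f\<close> with smooth coefficients: in this form, sections can be compared with
  ambient objects. By \<open>section_frame\<close>, every section is locally of this form.
\<close>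

lemma section_combination:
  assumes U: "open U" and Q: "open Q" "f ` U \<subseteq> Q"
    and a: "\<And>i. i \<in> I \<Longrightarrow> smooth_function A U (a i)"
    and W: "\<And>i. i \<in> I \<Longrightarrow> vector_field B Q (W i)"
    and V: "\<And>x. x \<in> U \<Longrightarrow> V x = (\<Sum>i\<in>I. a i x *\<^sub>R W i (f x))"
  shows "section_along A B f U V"
  unfolding section_along_def
proof (intro conjI ballI)
  fix x assume "x \<in> U" then show "V x \<in> tangent_space B (f x)"
    using V Q N.vector_field_tangent[OF W] by (auto intro!: N.tangent_sum N.tangent_scaleR)
next
  fix d assume d: "d \<in> B"
  note op = open_chart_preimage[OF U d]
  have "smooth_function A (U \<inter> f -` fst d) (\<lambda>x. \<Sum>i\<in>I. a i x *\<^sub>R W i (f x) d)"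
  proof (intro M.smooth_function_sum[OF op] M.smooth_function_scaleR[OF op])
    fix i assume i: "i \<in> I"
    show "smooth_function A (U \<inter> f -` fst d) (a i)"
      using a[OF i] by (rule M.smooth_function_subset) auto
    show "smooth_function A (U \<inter> f -` fst d) (\<lambda>x. W i (f x) d)"
      using smooth_function_pullback[OF N.open_chart_domain[OF d Q(1)] N.vector_field_component[OF W[OF i] d]]
      by (rule M.smooth_function_subset) (use Q in auto)
  qed
  then show "smooth_function A (U \<inter> f -` fst d) (\<lambda>x. V x d)"
    by (rule M.smooth_function_cong[OF op, rotated]) (simp add: V sum_fun_apply)
qed

lemma section_frame:
  assumes U: "open U" and d: "d \<in> B" and V: "section_along A B f U V"
  shows "\<And>b. smooth_function A (U \<inter> f -` fst d) (\<lambda>y. V y d \<bullet> b)"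
    and "\<And>y. y \<in> U \<inter> f -` fst d \<Longrightarrow> V y = (\<Sum>b\<in>Basis. (V y d \<bullet> b) *\<^sub>R coord_field B d b (f y))"
proof -
  show "smooth_function A (U \<inter> f -` fst d) (\<lambda>y. V y d \<bullet> b)" for b
    by (rule M.smooth_function_inner[OF open_chart_preimage[OF U d] section_component[OF V d]])
  fix y assume "y \<in> U \<inter> f -` fst d"
  then show "V y = (\<Sum>b\<in>Basis. (V y d \<bullet> b) *\<^sub>R coord_field B d b (f y))"
    using N.coord_field_sum[OF d] N.coord_field_component[OF d] section_tangent[OF V] by simp
qed

lemma section_differential:
  assumes "open U" "vector_field A U X"
  shows "section_along A B f U (\<lambda>x. df x (X x))"
  unfolding section_along_def
  using differential_tangent M.vector_field_tangent[OF assms(2)] smooth_differential_component[OF assms] by blast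

lemma section_endomorphism:
  assumes J: "tensor_field_11 B J" and U: "open U" and V: "section_along A B f U V"
  shows "section_along A B f U (\<lambda>x. J (f x) (V x))"
proof (rule section_local)
  fix x assume x: "x \<in> U"
  obtain d where d: "d \<in> B" "f x \<in> fst d" using N.ex_chart by blast
  note frame = section_frame[OF U d(1) V] and op = N.chart_open[OF d(1)]
  have "section_along A B f (U \<inter> f -` fst d) (\<lambda>x. J (f x) (V x))"
  proof (rule section_combination[OF open_chart_preimage[OF U d(1)] op])
    show "smooth_function A (U \<inter> f -` fst d) (\<lambda>y. V y d \<bullet> b)" for b by (rule frame(1))
    show "vector_field B (fst d) (\<lambda>z. J z (coord_field B d b z))" for b
      by (rule N.endomorphism_vector_field[OF J op N.coord_field_vector_field[OF d(1)]])
    fix y assume y: "y \<in> U \<inter> f -` fst d"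
    show "J (f y) (V y) = (\<Sum>b\<in>Basis. (V y d \<bullet> b) *\<^sub>R J (f y) (coord_field B d b (f y)))"
      by (subst frame(2)[OF y])
         (simp add: N.endomorphism_sum[OF J] N.endomorphism_scaleR[OF J] N.coord_field_tangent[OF d(1)]
            N.tangent_scaleR)
  qed auto
  then show "\<exists>W. open W \<and> x \<in> W \<and> section_along A B f W (\<lambda>x. J (f x) (V x))"
    using open_chart_preimage[OF U d(1)] x d by blast
qed

end

section \<open>The pull-back of a connection\<close>

locale pullback_connection = smooth_map_manifolds A B f + N: affine_manifold B nablaB
  for A :: "('m::{t2_space,second_countable_topology}, 'e::euclidean_space) chart set"
    and B :: "('n::{t2_space,second_countable_topology}, 'f::euclidean_space) chart set"
    and f :: "'m \<Rightarrow> 'n" and nablaB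
begin

abbreviation D where "D \<equiv> cov_deriv_along A B nablaB f"

text \<open>
  The Leibniz rule. In a chart \<open>d\<close>, the product rule and the chain rule produce the derivatives of
  \<open>a i\<close> and, through \<open>df (X x) = P (f x)\<close>, the derivatives of the components of \<open>W i\<close> in direction
  \<open>P\<close>. Together with the Christoffel term the latter make up \<open>nablaB P (W i)\<close>. The right-hand side
  does not mention \<open>d\<close> and is a tangent vector, so the chart formula transforms correctly.
\<close>

lemma pullback_connection_combination:
  assumes U: "open U" "x \<in> U" and Q: "open Q" "f ` U \<subseteq> Q" and X: "X x \<in> tangent_space A x"
    and P: "vector_field B Q P" "P (f x) = df x (X x)"
    and a: "\<And>i. i \<in> I \<Longrightarrow> smooth_function A U (a i)"
    and W: "\<And>i. i \<in> I \<Longrightarrow> vector_field B Q (W i)"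
    and V: "\<And>y. y \<in> U \<Longrightarrow> V y = (\<Sum>i\<in>I. a i y *\<^sub>R W i (f y))"
  shows "D X V x = (\<Sum>i\<in>I. a i x *\<^sub>R nablaB P (W i) (f x) + tangent_deriv A x (X x) (a i) *\<^sub>R W i (f x))"
    (is "_ = ?R")
proof
  have fx: "f x \<in> Q" using U Q by auto
  have R: "?R \<in> tangent_space B (f x)"
    by (intro N.tangent_sum N.tangent_add N.tangent_scaleR N.nabla_tangent[OF Q(1) P(1) W fx]
        N.vector_field_tangent[OF W fx])
  fix d
  show "D X V x d = ?R d"
  proof (cases "d \<in> B \<and> f x \<in> fst d")
    case False
    then show ?thesis using N.tangent_space_outside[OF R False] by (simp only: cov_deriv_along_def if_False)
  next
    case True
    then have d: "d \<in> B" "f x \<in> fst d" by auto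
    let ?U = "U \<inter> f -` fst d"
    have oU: "open ?U" "x \<in> ?U" using open_chart_preimage[OF U(1) d(1)] U d by auto
    have sa: "smooth_function A ?U (a i)" if "i \<in> I" for i
      using a[OF that] by (rule M.smooth_function_subset) auto
    have sW: "smooth_function A ?U (\<lambda>y. W i (f y) d)" if "i \<in> I" for i
      using smooth_function_pullback[OF N.open_chart_domain[OF d(1) Q(1)]
          N.vector_field_component[OF W[OF that] d(1)]]
      by (rule M.smooth_function_subset) (use Q in auto)
    have sm: "smooth_function A ?U (\<lambda>y. a i y *\<^sub>R W i (f y) d)" if "i \<in> I" for i
      by (rule M.smooth_function_scaleR[OF oU(1) sa[OF that] sW[OF that]])
    have "tangent_deriv A x (X x) (\<lambda>y. V y d) = tangent_deriv A x (X x) (\<lambda>y. \<Sum>i\<in>I. a i y *\<^sub>R W i (f y) d)"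
      by (rule M.tangent_deriv_cong[OF oU X M.smooth_function_sum[OF oU(1) sm]])
         (auto simp: V sum_fun_apply)
    also have "\<dots> = (\<Sum>i\<in>I. tangent_deriv A x (X x) (\<lambda>y. a i y *\<^sub>R W i (f y) d))"
      by (rule M.tangent_deriv_sum[OF oU X sm])
    also have "\<dots> = (\<Sum>i\<in>I. a i x *\<^sub>R tangent_deriv A x (X x) (\<lambda>y. W i (f y) d) +
        tangent_deriv A x (X x) (a i) *\<^sub>R W i (f x) d)"
      by (rule sum.cong[OF refl], rule M.tangent_deriv_scaleR[OF oU(2) X sa sW])
    also have "\<dots> = (\<Sum>i\<in>I. a i x *\<^sub>R tangent_deriv B (f x) (P (f x)) (\<lambda>z. W i z d) +
        tangent_deriv A x (X x) (a i) *\<^sub>R W i (f x) d)"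
    proof (rule sum.cong[OF refl])
      fix i assume i: "i \<in> I"
      show "a i x *\<^sub>R tangent_deriv A x (X x) (\<lambda>y. W i (f y) d) + tangent_deriv A x (X x) (a i) *\<^sub>R W i (f x) d =
        a i x *\<^sub>R tangent_deriv B (f x) (P (f x)) (\<lambda>z. W i z d) + tangent_deriv A x (X x) (a i) *\<^sub>R W i (f x) d"
        using tangent_deriv_pullback[OF N.open_chart_domain[OF d(1) Q(1)]
            N.vector_field_component[OF W[OF i] d(1)] _ X] fx d P(2) by simp
    qed
    finally have td: "tangent_deriv A x (X x) (\<lambda>y. V y d) = \<dots>" .
    note lin = N.christoffel_linear[OF d, of "P (f x) d"]
    have ch: "christoffel B nablaB d (f x) (P (f x) d) (V x d) =
        (\<Sum>i\<in>I. a i x *\<^sub>R christoffel B nablaB d (f x) (P (f x) d) (W i (f x) d))"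
      by (simp add: V[OF U(2)] sum_fun_apply linear_sum[OF lin] linear_cmul[OF lin])
    have "D X V x d = (\<Sum>i\<in>I. a i x *\<^sub>R tangent_deriv B (f x) (P (f x)) (\<lambda>z. W i z d) +
        tangent_deriv A x (X x) (a i) *\<^sub>R W i (f x) d) +
        (\<Sum>i\<in>I. a i x *\<^sub>R christoffel B nablaB d (f x) (P (f x) d) (W i (f x) d))"
      using d by (simp only: cov_deriv_along_def td ch P(2)[symmetric] simp_thms if_True)
    also have "\<dots> = ?R d"
      by (simp add: sum_fun_apply sum.distrib[symmetric] N.nabla_in_coordinates[OF Q(1) fx d P(1) W]
          algebra_simps cong: sum.cong)
    finally show ?thesis .
  qed
qed

lemma pullback_connection_frame:
  assumes U: "open U" "x \<in> U" and d: "d \<in> B" "f x \<in> fst d" and X: "X x \<in> tangent_space A x"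
    and V: "section_along A B f U V"
  shows "D X V x = (\<Sum>b\<in>Basis. (V x d \<bullet> b) *\<^sub>R nablaB (coord_field B d (df x (X x) d)) (coord_field B d b) (f x) +
     tangent_deriv A x (X x) (\<lambda>y. V y d \<bullet> b) *\<^sub>R coord_field B d b (f x))"
proof (rule pullback_connection_combination)
  show "open (U \<inter> f -` fst d)" "x \<in> U \<inter> f -` fst d"
    using open_chart_preimage[OF U(1) d(1)] U d by auto
  show "open (fst d)" "f ` (U \<inter> f -` fst d) \<subseteq> fst d"
    using N.chart_open[OF d(1)] by auto
  show "coord_field B d (df x (X x) d) (f x) = df x (X x)"
    by (rule N.coord_field_component[OF d differential_tangent[OF X]])
qed (rule X N.coord_field_vector_field[OF d(1)] section_frame[OF U(1) d(1) V], assumption?)+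

lemma pullback_connection_tangent:
  assumes "open U" "x \<in> U" "X x \<in> tangent_space A x" "section_along A B f U V"
  shows "D X V x \<in> tangent_space B (f x)"
proof -
  obtain d where d: "d \<in> B" "f x \<in> fst d" using N.ex_chart by blast
  note E = N.coord_field_vector_field[OF d(1)]
  show ?thesis
    unfolding pullback_connection_frame[where X=X and V=V, OF assms(1,2) d assms(3,4)]
    by (intro N.tangent_sum N.tangent_add N.tangent_scaleR N.nabla_tangent[OF N.chart_open[OF d(1)] E E d(2)]
        N.coord_field_tangent[OF d(1)])
qed

text \<open>
  Expand \<open>V\<close> in coordinate fields \<open>E b\<close>. Then \<open>J V\<close> has the same coefficients with respect to the
  vector fields \<open>J (E b)\<close>, and \<open>J\<close> commutes with the ambient derivative of each \<open>E b\<close>.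
\<close>

lemma pullback_connection_endomorphism:
  assumes J: "tensor_field_11 B J" "parallel_endo B nablaB J"
    and U: "open U" "x \<in> U" and X: "X x \<in> tangent_space A x" and V: "section_along A B f U V"
  shows "D X (\<lambda>y. J (f y) (V y)) x = J (f x) (D X V x)"
proof -
  obtain d where d: "d \<in> B" "f x \<in> fst d" using N.ex_chart by blast
  let ?E = "coord_field B d" and ?U = "U \<inter> f -` fst d"
  let ?P = "?E (df x (X x) d)"
  note E = N.coord_field_vector_field[OF d(1)] and op = N.chart_open[OF d(1)]
  note frame = section_frame[OF U(1) d(1) V]
  note tE = N.coord_field_tangent[OF d(1)] and tn = N.nabla_tangent[OF op E E d(2)]
  have par: "nablaB ?P (\<lambda>z. J z (?E b z)) (f x) = J (f x) (nablaB ?P (?E b) (f x))" for b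
    using J(2) op E d(2) unfolding parallel_endo_def cov_deriv_endo_def by fastforce
  have "D X (\<lambda>y. J (f y) (V y)) x =
     (\<Sum>b\<in>Basis. (V x d \<bullet> b) *\<^sub>R nablaB ?P (\<lambda>z. J z (?E b z)) (f x) +
        tangent_deriv A x (X x) (\<lambda>y. V y d \<bullet> b) *\<^sub>R J (f x) (?E b (f x)))"
  proof (rule pullback_connection_combination)
    show "open ?U" "x \<in> ?U"
      using open_chart_preimage[OF U(1) d(1)] U d by auto
    show "open (fst d)" "f ` ?U \<subseteq> fst d"
      using op by auto
    show "?P (f x) = df x (X x)"
      by (rule N.coord_field_component[OF d differential_tangent[OF X]])
    fix y assume y: "y \<in> ?U"
    show "J (f y) (V y) = (\<Sum>b\<in>Basis. (V y d \<bullet> b) *\<^sub>R J (f y) (?E b (f y)))"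
      by (subst frame(2)[OF y])
         (simp add: N.endomorphism_sum[OF J(1)] N.endomorphism_scaleR[OF J(1)] tE N.tangent_scaleR)
  qed (rule X E frame(1) N.endomorphism_vector_field[OF J(1) op E])+
  also have "\<dots> = J (f x) (D X V x)"
    unfolding pullback_connection_frame[where X=X and V=V, OF U d X V]
    by (simp add: par N.endomorphism_sum[OF J(1)] N.endomorphism_add[OF J(1)] N.endomorphism_scaleR[OF J(1)]
        tE tn N.tangent_scaleR N.tangent_add)
  finally show ?thesis .
qed

end

locale levi_civita_pullback = smooth_map_manifolds A B f + N: levi_civita_manifold B G nablaB
  for A :: "('m::{t2_space,second_countable_topology}, 'e::euclidean_space) chart set"
    and B :: "('n::{t2_space,second_countable_topology}, 'f::euclidean_space) chart set"
    and f :: "'m \<Rightarrow> 'n" and G nablaB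
begin

sublocale pullback_connection A B f nablaB ..

lemma section_metric_frame:
  assumes U: "open U" and d: "d \<in> B" and V: "section_along A B f U V" and W: "section_along A B f U W"
    and y: "y \<in> U \<inter> f -` fst d"
  shows "G (f y) (V y) (W y) = (\<Sum>i\<in>Basis. \<Sum>j\<in>Basis. (V y d \<bullet> i) * ((W y d \<bullet> j) *
     G (f y) (coord_field B d i (f y)) (coord_field B d j (f y))))"
  by (subst section_frame(2)[OF U d V y], subst section_frame(2)[OF U d W y])
     (rule N.metric_double_sum[OF N.coord_field_tangent[OF d] N.coord_field_tangent[OF d]])

lemma section_metric_coefficients:
  assumes U: "open U" and d: "d \<in> B"
  shows "smooth_function A (U \<inter> f -` fst d) (\<lambda>y. G (f y) (coord_field B d i (f y)) (coord_field B d j (f y)))"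
proof (rule M.smooth_function_subset)
  note E = N.coord_field_vector_field[OF d] and op = N.chart_open[OF d]
  show "smooth_function A (f -` fst d) (\<lambda>y. G (f y) (coord_field B d i (f y)) (coord_field B d j (f y)))"
    by (rule smooth_function_pullback[OF op N.metric_smooth[OF op E E]])
qed simp

lemma section_metric_smooth:
  assumes U: "open U" and V: "section_along A B f U V" and W: "section_along A B f U W"
  shows "smooth_function A U (\<lambda>y. G (f y) (V y) (W y))"
proof (rule M.smooth_function_local)
  fix x assume x: "x \<in> U"
  obtain d where d: "d \<in> B" "f x \<in> fst d" using N.ex_chart by blast
  note op = open_chart_preimage[OF U d(1)]
  have "smooth_function A (U \<inter> f -` fst d) (\<lambda>y. G (f y) (V y) (W y))"
    by (rule M.smooth_function_cong[OF op section_metric_frame[OF U d(1) V W, symmetric]], assumption)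
       (intro M.smooth_function_sum M.smooth_function_mult op section_frame(1)[OF U d(1)] V W
         section_metric_coefficients[OF U d(1)])
  then show "\<exists>W'. open W' \<and> x \<in> W' \<and> smooth_function A W' (\<lambda>y. G (f y) (V y) (W y))"
    using op x d by blast
qed

text \<open>
  Expand both sections in coordinate fields \<open>E i\<close>, with coefficients \<open>a i\<close> and \<open>c j\<close>. The
  inner product becomes a double sum over products of \<open>a i\<close>, \<open>c j\<close> and \<open>\<gamma> i j = G (E i) (E j)\<close>, and
  the metric property of the ambient connection gives the derivative of \<open>\<gamma> i j\<close> along \<open>f\<close>.
\<close>

lemma pullback_connection_metric:
  assumes U: "open U" "x \<in> U" and X: "X x \<in> tangent_space A x"
    and V: "section_along A B f U V" and W: "section_along A B f U W"
  shows "tangent_deriv A x (X x) (\<lambda>y. G (f y) (V y) (W y)) =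
    G (f x) (D X V x) (W x) + G (f x) (V x) (D X W x)"
proof -
  obtain d where d: "d \<in> B" "f x \<in> fst d" using N.ex_chart by blast
  let ?U = "U \<inter> f -` fst d"
  define E where "E = coord_field B d"
  define P where "P = E (df x (X x) d)"
  define n where "n b = nablaB P (E b) (f x)" for b
  define a a' c c' where "a b y = V y d \<bullet> b" and "a' b = tangent_deriv A x (X x) (\<lambda>y. V y d \<bullet> b)"
    and "c b y = W y d \<bullet> b" and "c' b = tangent_deriv A x (X x) (\<lambda>y. W y d \<bullet> b)" for b y
  define \<gamma> where "\<gamma> i j z = G z (E i z) (E j z)" for i j z
  note op = N.chart_open[OF d(1)]
  have oU: "open ?U" "x \<in> ?U" using open_chart_preimage[OF U(1) d(1)] U d by auto
  have E: "vector_field B (fst d) (E e)" for e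
    unfolding E_def by (rule N.coord_field_vector_field[OF d(1)])
  have tE: "E e z \<in> tangent_space B z" for e z unfolding E_def by (rule N.coord_field_tangent[OF d(1)])
  have tn: "n b \<in> tangent_space B (f x)" for b
    unfolding n_def P_def by (rule N.nabla_tangent[OF op E E d(2)])
  have Px: "P (f x) = df x (X x)"
    unfolding P_def E_def by (rule N.coord_field_component[OF d differential_tangent[OF X]])
  have frames: "V x = (\<Sum>b\<in>Basis. a b x *\<^sub>R E b (f x))" "W x = (\<Sum>b\<in>Basis. c b x *\<^sub>R E b (f x))"
    unfolding a_def c_def E_def
    by (rule section_frame(2)[OF U(1) d(1) V oU(2)] section_frame(2)[OF U(1) d(1) W oU(2)])+
  have DV: "D X V x = (\<Sum>b\<in>Basis. a b x *\<^sub>R n b) + (\<Sum>b\<in>Basis. a' b *\<^sub>R E b (f x))"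
    unfolding pullback_connection_frame[where X=X and V=V, OF U d X V] a_def a'_def n_def P_def E_def
    by (rule sum.distrib)
  have DW: "D X W x = (\<Sum>b\<in>Basis. c b x *\<^sub>R n b) + (\<Sum>b\<in>Basis. c' b *\<^sub>R E b (f x))"
    unfolding pullback_connection_frame[where X=X and V=W, OF U d X W] c_def c'_def n_def P_def E_def
    by (rule sum.distrib)
  have sa: "smooth_function A ?U (a i)" and sc: "smooth_function A ?U (c i)" for i
    unfolding a_def c_def by (rule section_frame(1)[OF U(1) d(1) V] section_frame(1)[OF U(1) d(1) W])+
  have sg: "smooth_function A ?U (\<lambda>y. \<gamma> i j (f y))" for i j
    unfolding \<gamma>_def E_def by (rule section_metric_coefficients[OF U(1) d(1)])
  note scg = M.smooth_function_mult[OF oU(1) sc sg]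
  note sacg = M.smooth_function_mult[OF oU(1) sa scg]
  have dg: "tangent_deriv A x (X x) (\<lambda>y. \<gamma> i j (f y)) = G (f x) (n i) (E j (f x)) + G (f x) (E i (f x)) (n j)" for i j
  proof -
    have "smooth_function B (fst d) (\<gamma> i j)"
      unfolding \<gamma>_def by (rule N.metric_smooth[OF op E E])
    from tangent_deriv_pullback[OF op this d(2) X]
    have "tangent_deriv A x (X x) (\<lambda>y. \<gamma> i j (f y)) = tangent_deriv B (f x) (P (f x)) (\<gamma> i j)"
      by (simp add: Px)
    also have "\<dots> = G (f x) (n i) (E j (f x)) + G (f x) (E i (f x)) (n j)"
      unfolding \<gamma>_def n_def by (rule N.nabla_metric[OF op _ E E d(2)]) (simp add: P_def E)
    finally show ?thesis .
  qed
  have "tangent_deriv A x (X x) (\<lambda>y. G (f y) (V y) (W y)) =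
     tangent_deriv A x (X x) (\<lambda>y. \<Sum>i\<in>Basis. \<Sum>j\<in>Basis. a i y * (c j y * \<gamma> i j (f y)))"
    by (rule M.tangent_deriv_cong[OF oU X])
       (intro M.smooth_function_sum oU sacg, simp add: section_metric_frame[OF U(1) d(1) V W] a_def c_def \<gamma>_def E_def)
  also have "\<dots> = (\<Sum>i\<in>Basis. tangent_deriv A x (X x) (\<lambda>y. \<Sum>j\<in>Basis. a i y * (c j y * \<gamma> i j (f y))))"
    by (rule M.tangent_deriv_sum[OF oU X M.smooth_function_sum[OF oU(1) sacg]])
  also have "\<dots> = (\<Sum>i\<in>Basis. \<Sum>j\<in>Basis. tangent_deriv A x (X x) (\<lambda>y. a i y * (c j y * \<gamma> i j (f y))))"
    by (rule sum.cong[OF refl], rule M.tangent_deriv_sum[OF oU X sacg])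
  also have "\<dots> = (\<Sum>i\<in>Basis. \<Sum>j\<in>Basis.
      a i x * (c j x * (G (f x) (n i) (E j (f x)) + G (f x) (E i (f x)) (n j)) + c' j * \<gamma> i j (f x)) +
      a' i * (c j x * \<gamma> i j (f x)))"
    unfolding M.tangent_deriv_mult[OF oU(2) X sa scg] M.tangent_deriv_mult[OF oU(2) X sc sg] dg
    by (simp add: a_def[abs_def] a'_def c_def[abs_def] c'_def)
  also have "\<dots> = G (f x) (D X V x) (W x) + G (f x) (V x) (D X W x)"
    unfolding DV DW frames
    by (simp add: N.metric_add_left N.metric_add_right N.metric_double_sum tE tn N.tangent_sum N.tangent_scaleR
        \<gamma>_def)
       (simp add: sum.distrib[symmetric] algebra_simps)
  finally show ?thesis .
qed

text \<open>
  With \<open>F\<close> the map \<open>f\<close> in charts, the component of \<open>D X (df Y)\<close> is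
  \<open>D\<^sup>2F(X, Y) + DF(X(Y)) + \<Gamma>(df X, df Y)\<close>. The first and the last term are symmetric in
  \<open>X, Y\<close>, and the middle ones combine to \<open>DF([X, Y])\<close>.
\<close>

lemma pullback_torsion_free:
  assumes U: "open U" "x \<in> U" and X: "vector_field A U X" and Y: "vector_field A U Y"
    and L: "lie_bracket A X Y x \<in> tangent_space A x"
  shows "D X (\<lambda>y. df y (Y y)) x - D Y (\<lambda>y. df y (X y)) x = df x (lie_bracket A X Y x)"
proof -
  have tX: "X x \<in> tangent_space A x" and tY: "Y x \<in> tangent_space A x"
    using X Y U M.vector_field_tangent by blast+
  note sX = section_differential[OF U(1) X] and sY = section_differential[OF U(1) Y]
  obtain d where d: "d \<in> B" "f x \<in> fst d" using N.ex_chart by blast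
  obtain c where c: "c \<in> A" "x \<in> fst c" using M.ex_chart by blast
  let ?W = "U \<inter> f -` fst d \<inter> fst c" and ?F = "(\<lambda>y. snd d (f y)) \<circ> chart_inv c"
  have W: "open ?W" "x \<in> ?W" using M.open_chart_domain[OF c(1) open_chart_preimage[OF U(1) d(1)]] U d c by auto
  have oW: "open (snd c ` ?W)" "snd c x \<in> snd c ` ?W"
    using M.chart_image_open_subset[OF c(1) W(1)] W(2) by auto
  have sF: "smooth_on (snd c ` ?W) ?F"
    by (rule M.smooth_function_chart[OF smooth_chart_map[OF d(1)] c(1)]) auto
  have key: "tangent_deriv A x (X x) (\<lambda>y. df y (Y y) d) =
      frechet_derivative (\<lambda>z. frechet_derivative ?F (at z) (Y x c)) (at (snd c x)) (X x c) +
      frechet_derivative ?F (at (snd c x)) (tangent_deriv A x (X x) (\<lambda>y. Y y c))"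
    if X: "vector_field A U X" and Y: "vector_field A U Y" for X Y
  proof -
    let ?u = "(\<lambda>y. Y y c) \<circ> chart_inv c"
    have tX: "X x \<in> tangent_space A x" by (rule M.vector_field_tangent[OF X U(2)])
    have sY: "smooth_function A (U \<inter> fst c) (\<lambda>y. Y y c)" by (rule M.vector_field_component[OF Y c(1)])
    have xUc: "x \<in> U \<inter> fst c" using U c by auto
    have u: "(?u has_derivative frechet_derivative ?u (at (snd c x))) (at (snd c x))"
      using M.smooth_function_differentiable[OF sY xUc c] by (simp only: frechet_derivative_works)
    from has_derivative_frechet_field[OF oW sF this]
    have "((\<lambda>y. df y (Y y) d) \<circ> chart_inv c has_derivative
        (\<lambda>v. frechet_derivative (\<lambda>z. frechet_derivative ?F (at z) (?u (snd c x))) (at (snd c x)) v +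
          frechet_derivative ?F (at (snd c x)) (frechet_derivative ?u (at (snd c x)) v))) (at (snd c x))"
    proof (rule has_derivative_transform_within_open[OF _ oW])
      fix z assume "z \<in> snd c ` ?W"
      then obtain y where y: "y \<in> U" "f y \<in> fst d" "y \<in> fst c" "z = snd c y" by auto
      show "frechet_derivative ?F (at z) (?u z) = ((\<lambda>y. df y (Y y) d) \<circ> chart_inv c) z"
        using M.tangent_deriv_chart[OF smooth_chart_map[OF d(1)] _ c(1) y(3) M.vector_field_tangent[OF Y y(1)]]
          y c d by (simp add: differential_component)
    qed
    from M.tangent_deriv_eqI[OF c tX this] show ?thesis
      unfolding M.tangent_deriv_chart[OF sY xUc c tX] using c by simp
  qed
  have "(D X (\<lambda>y. df y (Y y)) x - D Y (\<lambda>y. df y (X y)) x) d =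
      tangent_deriv A x (X x) (\<lambda>y. df y (Y y) d) - tangent_deriv A x (Y x) (\<lambda>y. df y (X y) d)"
    using d N.christoffel_sym[OF d, of "df x (X x) d" "df x (Y x) d"] by (simp add: cov_deriv_along_def)
  also have "\<dots> = frechet_derivative ?F (at (snd c x)) (tangent_deriv A x (X x) (\<lambda>y. Y y c)) -
      frechet_derivative ?F (at (snd c x)) (tangent_deriv A x (Y x) (\<lambda>y. X y c))"
    unfolding key[OF X Y] key[OF Y X]
    by (simp add: symmetric_second_derivative[OF oW sF, of "X x c" "Y x c"])
  also have "\<dots> = frechet_derivative ?F (at (snd c x)) (lie_bracket A X Y x c)"
    using c linear_diff[OF linear_frechet_derivative[OF smooth_on_differentiable[OF sF oW(2)]]]
    by (simp add: lie_bracket_def)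
  also have "\<dots> = df x (lie_bracket A X Y x) d"
    using M.tangent_deriv_chart[OF smooth_chart_map[OF d(1)] _ c L] d
    by (simp add: differential_component)
  finally show ?thesis
    using d U sX sY tX tY
    by (intro N.tangent_vector_eqI[of _ "f x" _ d] N.tangent_diff pullback_connection_tangent[of U]
        differential_tangent L)
qed

end

section \<open>Isometrically immersed submanifolds\<close>

locale isometric_submanifold = levi_civita_pullback A B f G nablaB + M: levi_civita_manifold A g nabla
  for A :: "('m::{t2_space,second_countable_topology}, 'e::euclidean_space) chart set"
    and B :: "('n::{t2_space,second_countable_topology}, 'f::euclidean_space) chart set"
    and f :: "'m \<Rightarrow> 'n" and G nablaB g nabla +
  assumes immersion: "isometric_immersion A g B G f"
begin

lemma isometric:
  "u \<in> tangent_space A x \<Longrightarrow> v \<in> tangent_space A x \<Longrightarrow> G (f x) (df x u) (df x v) = g x u v"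
  using immersion by (simp add: isometric_immersion_def)

lemma pullback_connection_torsion_free:
  assumes U: "open U" "x \<in> U" and X: "vector_field A U X" and Y: "vector_field A U Y"
  shows "D X (\<lambda>y. df y (Y y)) x - D Y (\<lambda>y. df y (X y)) x = df x (nabla X Y x - nabla Y X x)"
proof -
  have "lie_bracket A X Y x \<in> tangent_space A x"
    using M.tangent_diff[OF M.nabla_tangent[OF U(1) X Y U(2)] M.nabla_tangent[OF U(1) Y X U(2)]]
      M.nabla_torsion_free[OF U(1) X Y U(2)] by simp
  from pullback_torsion_free[OF U X Y this] show ?thesis
    using M.nabla_torsion_free[OF U(1) X Y U(2)] by simp
qed

text \<open>
  Koszul's argument: \<open>T\<close> is symmetric in its first two arguments and skew in its last two. Applying
  the two rules alternately, three times each, returns to the original order with the sign changed.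
\<close>

lemma tangential_part_fields:
  assumes U: "open U" "x \<in> U" and "vector_field A U X" "vector_field A U Y" "vector_field A U Z"
  shows "G (f x) (D X (\<lambda>y. df y (Y y)) x) (df x (Z x)) = g x (nabla X Y x) (Z x)"
proof -
  define T where "T X Y Z = G (f x) (D X (\<lambda>y. df y (Y y)) x) (df x (Z x)) - g x (nabla X Y x) (Z x)" for X Y Z
  have t: "X x \<in> tangent_space A x" if "vector_field A U X" for X
    using M.vector_field_tangent[OF that U(2)] .
  have tD: "D X (\<lambda>y. df y (Y y)) x \<in> tangent_space B (f x)" if "vector_field A U X" "vector_field A U Y" for X Y
    by (rule pullback_connection_tangent[where X=X and V="\<lambda>y. df y (Y y)", OF U t[OF that(1)] section_differential[OF U(1) that(2)]])
  have sym: "T X Y Z = T Y X Z"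
    if X: "vector_field A U X" and Y: "vector_field A U Y" and Z: "vector_field A U Z" for X Y Z
  proof -
    note tn = M.nabla_tangent[OF U(1) X Y U(2)] M.nabla_tangent[OF U(1) Y X U(2)]
    have "G (f x) (D X (\<lambda>y. df y (Y y)) x) (df x (Z x)) - G (f x) (D Y (\<lambda>y. df y (X y)) x) (df x (Z x)) =
        G (f x) (df x (nabla X Y x - nabla Y X x)) (df x (Z x))"
      unfolding pullback_connection_torsion_free[OF U X Y, symmetric]
      by (rule N.metric_diff_left[OF tD[OF X Y] tD[OF Y X] differential_tangent[OF t[OF Z]], symmetric])
    also have "\<dots> = g x (nabla X Y x) (Z x) - g x (nabla Y X x) (Z x)"
      unfolding isometric[OF M.tangent_diff[OF tn] t[OF Z]] by (rule M.metric_diff_left[OF tn t[OF Z]])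
    finally show ?thesis by (simp add: T_def)
  qed
  have skew: "T X Y Z = - T X Z Y"
    if X: "vector_field A U X" and Y: "vector_field A U Y" and Z: "vector_field A U Z" for X Y Z
  proof -
    have "tangent_deriv A x (X x) (\<lambda>y. G (f y) (df y (Y y)) (df y (Z y))) =
        tangent_deriv A x (X x) (\<lambda>y. g y (Y y) (Z y))"
      by (rule M.tangent_deriv_cong[OF U t[OF X] M.metric_smooth[OF U(1) Y Z]])
         (simp add: isometric M.vector_field_tangent[OF Y] M.vector_field_tangent[OF Z])
    then have "G (f x) (D X (\<lambda>y. df y (Y y)) x) (df x (Z x)) + G (f x) (df x (Y x)) (D X (\<lambda>y. df y (Z y)) x) =
        g x (nabla X Y x) (Z x) + g x (Y x) (nabla X Z x)"
      unfolding M.nabla_metric[OF U(1) X Y Z U(2)]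
        pullback_connection_metric[where X=X and V="\<lambda>y. df y (Y y)" and W="\<lambda>y. df y (Z y)", OF U t[OF X] section_differential[OF U(1) Y] section_differential[OF U(1) Z]] .
    then show ?thesis
      using N.metric_sym[OF tD[OF X Z] differential_tangent[OF t[OF Y]]]
        M.metric_sym[OF M.nabla_tangent[OF U(1) X Z U(2)] t[OF Y]]
      by (simp add: T_def)
  qed
  note vf = assms(3-5)
  have "T X Y Z = - T X Y Z"
    using sym[of X Y Z] skew[of Y X Z] sym[of Y Z X] skew[of Z Y X] sym[of Z X Y] skew[of X Z Y] vf by simp
  then show ?thesis by (simp add: T_def)
qed

lemma normal_spaceI:
  "w \<in> tangent_space B (f x) \<Longrightarrow> (\<And>v. v \<in> tangent_space A x \<Longrightarrow> G (f x) w (df x v) = 0) \<Longrightarrow>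
    w \<in> normal_space A B G f x"
  unfolding normal_space_def using N.metric_sym differential_tangent by fastforce

lemma normal_spaceD:
  assumes "w \<in> normal_space A B G f x"
  shows "w \<in> tangent_space B (f x)" "\<And>v. v \<in> tangent_space A x \<Longrightarrow> G (f x) w (df x v) = 0"
  using assms N.metric_sym differential_tangent unfolding normal_space_def by fastforce+

text \<open>
  The tangential parts agree when tested against vector fields, and every tangent vector is the
  value of a coordinate field.
\<close>

lemma gauss_formula:
  assumes U: "open U" "x \<in> U" and X: "vector_field A U X" and Y: "vector_field A U Y"
  shows "D X (\<lambda>y. df y (Y y)) x - df x (nabla X Y x) \<in> normal_space A B G f x"
proof (rule normal_spaceI)
  have tD: "D X (\<lambda>y. df y (Y y)) x \<in> tangent_space B (f x)"
    by (rule pullback_connection_tangent[where X=X and V="\<lambda>y. df y (Y y)", OF U M.vector_field_tangent[OF X U(2)] section_differential[OF U(1) Y]])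
  have tn: "nabla X Y x \<in> tangent_space A x" by (rule M.nabla_tangent[OF U(1) X Y U(2)])
  show "D X (\<lambda>y. df y (Y y)) x - df x (nabla X Y x) \<in> tangent_space B (f x)"
    by (intro N.tangent_diff tD differential_tangent tn)
  fix v assume v: "v \<in> tangent_space A x"
  obtain c where c: "c \<in> A" "x \<in> fst c" using M.ex_chart by blast
  have vx: "coord_field A c (v c) x = v" by (rule M.coord_field_component[OF c v])
  have "G (f x) (D X (\<lambda>y. df y (Y y)) x) (df x v) = g x (nabla X Y x) v"
    using tangential_part_fields[OF M.open_chart_domain[OF c(1) U(1)] _ M.vector_field_subset[OF X]
        M.vector_field_subset[OF Y] M.vector_field_subset[OF M.coord_field_vector_field[OF c(1)]], of x "v c"]
      U c vx by simp
  then show "G (f x) (D X (\<lambda>y. df y (Y y)) x - df x (nabla X Y x)) (df x v) = 0"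
    using N.metric_diff_left[OF tD differential_tangent[OF tn] differential_tangent[OF v]] isometric[OF tn v]
    by simp
qed

lemma tangent_normal_zero:
  assumes "v \<in> tangent_space A x" "df x v \<in> normal_space A B G f x"
  shows "v = 0"
proof (rule M.metric_definite[OF assms(1)])
  show "g x v v = 0" using isometric[OF assms(1,1)] normal_spaceD(2)[OF assms(2,1)] by simp
qed

lemma normal_diff:
  "u \<in> normal_space A B G f x \<Longrightarrow> w \<in> normal_space A B G f x \<Longrightarrow> u - w \<in> normal_space A B G f x"
  by (intro normal_spaceI N.tangent_diff)
     (auto dest: normal_spaceD simp: N.metric_diff_left normal_spaceD differential_tangent)

end

section \<open>Invariant submanifolds with a parallel self-adjoint endomorphism field\<close>

locale invariant_isometric_submanifold = isometric_submanifold A B f G nablaB g nabla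
  for A :: "('m::{t2_space,second_countable_topology}, 'e::euclidean_space) chart set"
    and B :: "('n::{t2_space,second_countable_topology}, 'f::euclidean_space) chart set"
    and f :: "'m \<Rightarrow> 'n" and G nablaB g nabla +
  fixes J :: "'n \<Rightarrow> ('n, 'f) tvec \<Rightarrow> ('n, 'f) tvec"
  assumes endo: "tensor_field_11 B J"
    and selfadjoint: "\<And>z u v. u \<in> tangent_space B z \<Longrightarrow> v \<in> tangent_space B z \<Longrightarrow> G z (J z u) v = G z u (J z v)"
    and parallel: "parallel_endo B nablaB J"
    and invariant: "invariant_submanifold A B J f"
begin

abbreviation JM where "JM \<equiv> restrict_endo A B f J"

lemma restrict_endo:
  assumes "v \<in> tangent_space A x"
  shows restrict_endo_tangent: "JM x v \<in> tangent_space A x"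
    and differential_restrict_endo: "df x (JM x v) = J (f x) (df x v)"
proof -
  have "J (f x) (df x v) \<in> df x ` tangent_space A x"
    using invariant assms unfolding invariant_submanifold_def by blast
  then show "JM x v \<in> tangent_space A x" "df x (JM x v) = J (f x) (df x v)"
    unfolding restrict_endo_def by (rule inv_into_into, rule f_inv_into_f)
qed

text \<open>
  The orthogonal complement of an invariant subspace of a self-adjoint map is invariant.
\<close>

lemma endo_normal:
  assumes "w \<in> normal_space A B G f x"
  shows "J (f x) w \<in> normal_space A B G f x"
proof (rule normal_spaceI)
  note w = normal_spaceD[OF assms]
  show "J (f x) w \<in> tangent_space B (f x)" by (rule N.endomorphism_tangent[OF endo w(1)])
  fix v assume v: "v \<in> tangent_space A x"
  show "G (f x) (J (f x) w) (df x v) = 0"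
    unfolding selfadjoint[OF w(1) differential_tangent[OF v]] differential_restrict_endo[OF v, symmetric]
    by (rule w(2)[OF restrict_endo_tangent[OF v]])
qed

text \<open>
  In a chart \<open>c\<close>, the components of \<open>JM Y\<close> are determined by the inner products with the coordinate
  fields \<open>E b\<close>, and these are \<open>g (JM Y) (E b) = G (J (df Y)) (df (E b))\<close>, which is smooth because
  all its ingredients are sections along \<open>f\<close>. The matrix of this linear system is the Gram
  matrix of the coordinate fields, which is nonsingular because \<open>g\<close> is definite.
\<close>

lemma restrict_endo_vector_field:
  assumes U: "open U" and Y: "vector_field A U Y"
  shows "vector_field A U (\<lambda>y. JM y (Y y))"
proof (rule M.vector_fieldI[OF U])
  note tY = M.vector_field_tangent[OF Y]
  show "JM x (Y x) \<in> tangent_space A x" if "x \<in> U" for x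
    by (rule restrict_endo_tangent[OF tY[OF that]])
  fix x assume x: "x \<in> U"
  obtain c where c: "c \<in> A" "x \<in> fst c" using M.ex_chart by blast
  let ?W = "U \<inter> fst c" and ?E = "coord_field A c"
  let ?S = "snd c ` ?W"
  have W: "open ?W" and S: "open ?S"
    using M.open_chart_domain[OF c(1) U] M.chart_image_open[OF c(1) U] by auto
  have E: "vector_field A ?W (?E e)" for e
    by (rule M.vector_field_subset[OF M.coord_field_vector_field[OF c(1)]]) simp
  have tE: "?E e y \<in> tangent_space A y" for e y by (rule M.coord_field_tangent[OF c(1)])
  have Y': "vector_field A ?W Y" by (rule M.vector_field_subset[OF Y]) simp
  define gram where "gram e y = (\<Sum>b\<in>Basis. g y (?E e y) (?E b y) *\<^sub>R b)" for e y
  define w where "w y = (\<Sum>b\<in>Basis. G (f y) (J (f y) (df y (Y y))) (df y (?E b y)) *\<^sub>R b)" for y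
  have sgram: "smooth_function A ?W (gram e)" for e
    unfolding gram_def
    by (intro M.smooth_function_sum M.smooth_function_scaleR W M.metric_smooth E M.smooth_function_const)
  have sw: "smooth_function A ?W w"
    unfolding w_def
    by (intro M.smooth_function_sum M.smooth_function_scaleR W M.smooth_function_const
        section_metric_smooth section_endomorphism[OF endo] section_differential E Y')
  have lin: "linear (\<lambda>e. gram e y)" if y: "y \<in> fst c" for y
  proof (rule linearI)
    have add: "?E (e + e') y = ?E e y + ?E e' y" for e e'
      by (rule M.tangent_vector_eqI[OF tE M.tangent_add[OF tE tE] c(1) y]) (use c y in simp)
    have scale: "?E (r *\<^sub>R e) y = r *\<^sub>R ?E e y" for r e
      by (rule M.tangent_vector_eqI[OF tE M.tangent_scaleR[OF tE] c(1) y]) (use c y in simp)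
    show "gram (e + e') y = gram e y + gram e' y" for e e'
      by (simp add: gram_def add M.metric_add_left tE scaleR_add_left sum.distrib del: plus_fun_apply)
    show "gram (r *\<^sub>R e) y = r *\<^sub>R gram e y" for r e
      by (simp add: gram_def scale M.metric_scaleR_left tE scaleR_sum_right)
  qed
  have gram_inner: "gram e y \<bullet> b = g y (?E e y) (?E b y)" if "b \<in> Basis" for e y b
    using that by (simp add: gram_def)
  have inj: "e = 0" if y: "y \<in> fst c" and "gram e y = 0" for y e
  proof -
    have zero: "g y (?E e y) (?E b y) = 0" if "b \<in> Basis" for b
      using gram_inner[OF that, of e y] \<open>gram e y = 0\<close> by simp
    have "g y (?E e y) (\<Sum>b\<in>Basis. (e \<bullet> b) *\<^sub>R ?E b y) = 0"
      by (simp add: M.metric_sum_right M.metric_scaleR_right M.tangent_scaleR tE zero)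
    then have "?E e y = 0"
      unfolding M.coord_field_sum[OF c(1) y] by (rule M.metric_definite[OF tE])
    then show "e = 0" using M.coord_field_self[OF c(1) y, of e] by simp
  qed
  have solve: "gram (JM y (Y y) c) y = w y" if y: "y \<in> ?W" for y
  proof -
    have "?E (JM y (Y y) c) y = JM y (Y y)"
      by (rule M.coord_field_component) (use y c tY in \<open>auto intro: restrict_endo_tangent\<close>)
    moreover have "g y (JM y (Y y)) (?E b y) = G (f y) (J (f y) (df y (Y y))) (df y (?E b y))" for b
      using isometric[OF restrict_endo_tangent tE, of "Y y" y b] differential_restrict_endo[of "Y y" y] tY y
      by simp
    ultimately show ?thesis by (simp add: gram_def w_def)
  qed
  have "smooth_on ?S (\<lambda>z. JM (chart_inv c z) (Y (chart_inv c z)) c)"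
  proof (rule smooth_on_linear_system[OF S, where M = "\<lambda>z e. gram e (chart_inv c z)" and w = "w \<circ> chart_inv c"])
    show "smooth_on ?S (\<lambda>z. gram e (chart_inv c z))" for e
      using M.smooth_function_chart[OF sgram c(1), of ?W] by (simp add: comp_def)
    show "smooth_on ?S (w \<circ> chart_inv c)"
      by (rule M.smooth_function_chart[OF sw c(1)]) auto
  next
    fix z assume "z \<in> ?S"
    then obtain y where y: "y \<in> ?W" "z = snd c y" by auto
    have z: "chart_inv c z = y" using y c by simp
    show "linear (\<lambda>e. gram e (chart_inv c z))" unfolding z using lin y by simp
    show "e = 0" if "gram e (chart_inv c z) = 0" for e using that inj[of y e] y unfolding z by simp
    show "gram (JM (chart_inv c z) (Y (chart_inv c z)) c) (chart_inv c z) = (w \<circ> chart_inv c) z"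
      using solve[OF y(1)] by (simp add: z)
  qed
  then have "smooth_function A ?W (\<lambda>y. JM y (Y y) c)"
    using W c(1) by (intro M.smooth_function_local_chart bexI[of _ c] exI[of _ ?W]) (auto simp: comp_def)
  then show "\<exists>c\<in>A. x \<in> fst c \<and> smooth_function A (U \<inter> fst c) (\<lambda>y. JM y (Y y) c)"
    using c by blast
qed

text \<open>
  The sections \<open>df (JM Y)\<close> and \<open>J (df Y)\<close> agree on \<open>U\<close> only, so the equality of their derivatives is
  checked on components, where \<open>D\<close> is local.
\<close>

lemma pullback_connection_restrict_endo:
  assumes U: "open U" "x \<in> U" and X: "vector_field A U X" and Y: "vector_field A U Y"
  shows "D X (\<lambda>y. df y (JM y (Y y))) x = J (f x) (D X (\<lambda>y. df y (Y y)) x)"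
proof -
  note tX = M.vector_field_tangent[OF X U(2)] and sY = section_differential[OF U(1) Y]
  have eq: "df y (JM y (Y y)) = J (f y) (df y (Y y))" if "y \<in> U" for y
    by (rule differential_restrict_endo[OF M.vector_field_tangent[OF Y that]])
  have "D X (\<lambda>y. df y (JM y (Y y))) x = D X (\<lambda>y. J (f y) (df y (Y y))) x"
  proof
    fix d
    show "D X (\<lambda>y. df y (JM y (Y y))) x d = D X (\<lambda>y. J (f y) (df y (Y y))) x d"
    proof (cases "d \<in> B \<and> f x \<in> fst d")
      case True
      have "tangent_deriv A x (X x) (\<lambda>y. df y (JM y (Y y)) d) =
          tangent_deriv A x (X x) (\<lambda>y. J (f y) (df y (Y y)) d)"
        by (rule M.tangent_deriv_cong[OF open_chart_preimage[OF U(1)] _ tX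
              section_component[OF section_endomorphism[OF endo U(1) sY]]])
           (use True U eq in auto)
      then show ?thesis using True eq[OF U(2)] by (simp add: cov_deriv_along_def)
    qed (simp only: cov_deriv_along_def if_False)
  qed
  also have "\<dots> = J (f x) (D X (\<lambda>y. df y (Y y)) x)"
    by (rule pullback_connection_endomorphism[where X=X and J=J and V="\<lambda>y. df y (Y y)", OF endo parallel U tX sY])
  finally show ?thesis .
qed

text \<open>
  Both sides of \<open>D X (df (JM Y)) = J (D X (df Y))\<close> split into a tangential and a normal part, and
  \<open>J\<close> respects the splitting. The difference of the tangential parts is thus both tangential and
  normal, hence zero.
\<close>

lemma restrict_endo_parallel:
  assumes U: "open U" "x \<in> U" and X: "vector_field A U X" and Y: "vector_field A U Y"
  shows "nabla X (\<lambda>y. JM y (Y y)) x = JM x (nabla X Y x)"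
proof -
  note JY = restrict_endo_vector_field[OF U(1) Y]
  note tn = M.nabla_tangent[OF U(1) X Y U(2)] and tnJ = M.nabla_tangent[OF U(1) X JY U(2)]
  define \<nu> where "\<nu> = D X (\<lambda>y. df y (Y y)) x - df x (nabla X Y x)"
  have \<nu>: "\<nu> \<in> normal_space A B G f x" unfolding \<nu>_def by (rule gauss_formula[OF U X Y])
  have "D X (\<lambda>y. df y (JM y (Y y))) x = J (f x) (df x (nabla X Y x) + \<nu>)"
    unfolding pullback_connection_restrict_endo[OF U X Y] \<nu>_def by simp
  also have "\<dots> = df x (JM x (nabla X Y x)) + J (f x) \<nu>"
    by (simp only: N.endomorphism_add[OF endo differential_tangent[OF tn] normal_spaceD(1)[OF \<nu>]]
        differential_restrict_endo[OF tn])
  finally have "df x (nabla X (\<lambda>y. JM y (Y y)) x - JM x (nabla X Y x)) =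
      J (f x) \<nu> - (D X (\<lambda>y. df y (JM y (Y y))) x - df x (nabla X (\<lambda>y. JM y (Y y)) x))"
    by (simp add: linear_diff[OF differential_linear])
  also have "\<dots> \<in> normal_space A B G f x"
    by (intro normal_diff endo_normal \<nu> gauss_formula[OF U X JY])
  finally have "nabla X (\<lambda>y. JM y (Y y)) x - JM x (nabla X Y x) = 0"
    by (intro tangent_normal_zero[of _ x] M.tangent_diff tnJ restrict_endo_tangent tn)
  then show ?thesis by simp
qed

definition second_fundamental_form where
  "second_fundamental_form X Y x = D X (\<lambda>y. df y (Y y)) x - df x (nabla X Y x)"

lemma second_fundamental_form_sym:
  assumes "open U" "x \<in> U" "vector_field A U X" "vector_field A U Y"
  shows "second_fundamental_form X Y x = second_fundamental_form Y X x"
  using pullback_connection_torsion_free[OF assms]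
  by (simp add: second_fundamental_form_def linear_diff[OF differential_linear] algebra_simps)

text \<open>
  The normal part of \<open>D X (df (JM Y)) = J (D X (df Y))\<close>, once the tangential part is known to be
  \<open>restrict_endo_parallel\<close>.
\<close>

lemma second_fundamental_form_endo_right:
  assumes U: "open U" "x \<in> U" and X: "vector_field A U X" and Y: "vector_field A U Y"
  shows "second_fundamental_form X (\<lambda>y. JM y (Y y)) x = J (f x) (second_fundamental_form X Y x)"
proof -
  note tn = M.nabla_tangent[OF U(1) X Y U(2)]
  have "second_fundamental_form X Y x \<in> tangent_space B (f x)"
    unfolding second_fundamental_form_def by (rule normal_spaceD(1)[OF gauss_formula[OF U X Y]])
  then have "J (f x) (df x (nabla X Y x) + second_fundamental_form X Y x) = df x (JM x (nabla X Y x)) + J (f x) (second_fundamental_form X Y x)"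
    using N.endomorphism_add[OF endo differential_tangent[OF tn]] differential_restrict_endo[OF tn] by simp
  moreover have "D X (\<lambda>y. df y (Y y)) x = df x (nabla X Y x) + second_fundamental_form X Y x"
    by (simp add: second_fundamental_form_def)
  ultimately show ?thesis
    by (simp add: second_fundamental_form_def[of X "\<lambda>y. JM y (Y y)"] pullback_connection_restrict_endo[OF U X Y]
        restrict_endo_parallel[OF U X Y])
qed

lemma second_fundamental_form_endo_left:
  assumes U: "open U" "x \<in> U" and X: "vector_field A U X" and Y: "vector_field A U Y"
  shows "second_fundamental_form (\<lambda>y. JM y (X y)) Y x = J (f x) (second_fundamental_form X Y x)"
  using second_fundamental_form_sym[OF U X Y] second_fundamental_form_endo_right[OF U Y X]
    second_fundamental_form_sym[OF U restrict_endo_vector_field[OF U(1) X] Y] by simp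

end

section \<open>Invariant submanifolds of locally metallic manifolds\<close>

theorem proposition3p10:
  fixes A :: "('m::{t2_space,second_countable_topology}, 'e::euclidean_space) chart set"
    and g :: "'m \<Rightarrow> ('m, 'e) tvec \<Rightarrow> ('m, 'e) tvec \<Rightarrow> real"
    and nabla :: "('m \<Rightarrow> ('m, 'e) tvec) \<Rightarrow> ('m \<Rightarrow> ('m, 'e) tvec) \<Rightarrow> 'm \<Rightarrow> ('m, 'e) tvec"
    and B :: "('n::{t2_space,second_countable_topology}, 'f::euclidean_space) chart set"
    and G :: "'n \<Rightarrow> ('n, 'f) tvec \<Rightarrow> ('n, 'f) tvec \<Rightarrow> real"
    and nablaB :: "('n \<Rightarrow> ('n, 'f) tvec) \<Rightarrow> ('n \<Rightarrow> ('n, 'f) tvec) \<Rightarrow> 'n \<Rightarrow> ('n, 'f) tvec"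
    and J :: "'n \<Rightarrow> ('n, 'f) tvec \<Rightarrow> ('n, 'f) tvec"
    and f :: "'m \<Rightarrow> 'n"
    and JM :: "'m \<Rightarrow> ('m, 'e) tvec \<Rightarrow> ('m, 'e) tvec"
    and p q r :: nat
  assumes JM: "JM = restrict_endo A B f J"
    and ambient: "locally_metallic B G nablaB J p q"
    and submanifold: "smooth_atlas A" "riemannian_metric A g"
    and immersed: "isometric_immersion A g B G f"
    and codim: "DIM('f) = DIM('e) + r"
    and invariant: "invariant_submanifold A B J f"
    and connection: "levi_civita A g nabla"
  shows "(\<forall>U X Y. open U \<and> vector_field A U X \<and> vector_field A U Y \<longrightarrow>
           (\<forall>x\<in>U. cov_deriv_endo nabla JM X Y x = 0)) \<and>
         (\<forall>U N h. open U \<and> orthonormal_normal_frame A B G f U r N \<and>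
             second_fundamental_tensors A B nablaB nabla f U r N h \<longrightarrow>
           (\<forall>V X Y. open V \<and> V \<subseteq> U \<and> vector_field A V X \<and> vector_field A V Y \<longrightarrow>
             (\<forall>x\<in>V.
               (\<Sum>\<alpha>=1..r. h \<alpha> x (X x) (JM x (Y x)) *\<^sub>R N \<alpha> x) =
                 (\<Sum>\<alpha>=1..r. h \<alpha> x (X x) (Y x) *\<^sub>R J (f x) (N \<alpha> x)) \<and>
               (\<Sum>\<alpha>=1..r. h \<alpha> x (X x) (Y x) *\<^sub>R J (f x) (N \<alpha> x)) =
                 (\<Sum>\<alpha>=1..r. h \<alpha> x (JM x (X x)) (Y x) *\<^sub>R N \<alpha> x) \<and>
               (\<forall>\<alpha>\<in>{1..r}. h \<alpha> x (JM x (X x)) (JM x (Y x)) =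
                  real p * h \<alpha> x (X x) (JM x (Y x)) + real q * h \<alpha> x (X x) (Y x)))))"
proof -
  have metallic: "metallic_riemannian B G J p q" and lcB: "levi_civita B G nablaB"
    and par: "parallel_endo B nablaB J"
    using ambient by (auto simp: locally_metallic_def)
  have J2: "J z (J z u) = real p *\<^sub>R J z u + real q *\<^sub>R u" if "u \<in> tangent_space B z" for z u
    using metallic that by (simp add: metallic_riemannian_def)
  interpret S: invariant_isometric_submanifold A B f G nablaB g nabla J
    using metallic lcB par submanifold immersed invariant connection
    by unfold_locales (auto simp: metallic_riemannian_def isometric_immersion_def)
  show ?thesis
    unfolding JM
  proof (intro conjI allI impI ballI)
    fix U X Y x
    assume "open U \<and> vector_field A U X \<and> vector_field A U Y" "x \<in> U"
    then show "cov_deriv_endo nabla S.JM X Y x = 0"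
      using S.restrict_endo_parallel[of U x X Y] by (simp add: cov_deriv_endo_def)
  next
    fix U N h V X Y x
    assume U: "open U \<and> orthonormal_normal_frame A B G f U r N \<and>
        second_fundamental_tensors A B nablaB nabla f U r N h"
      and V: "open V \<and> V \<subseteq> U \<and> vector_field A V X \<and> vector_field A V Y" and x: "x \<in> V"
    have xU: "x \<in> U" using V x by blast
    have span: "span ((\<lambda>\<alpha>. N \<alpha> x) ` {1..r}) = normal_space A B G f x"
      and orth: "\<And>\<alpha> \<beta>. \<alpha> \<in> {1..r} \<Longrightarrow> \<beta> \<in> {1..r} \<Longrightarrow> G (f x) (N \<alpha> x) (N \<beta> x) = (if \<alpha> = \<beta> then 1 else 0)"
      using U xU unfolding orthonormal_normal_frame_def by blast+
    have tN: "N \<alpha> x \<in> tangent_space B (f x)" if "\<alpha> \<in> {1..r}" for \<alpha>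
      using span_base[of "N \<alpha> x" "(\<lambda>\<alpha>. N \<alpha> x) ` {1..r}"] that S.normal_spaceD(1) unfolding span by blast
    have sff: "S.second_fundamental_form X Y x = (\<Sum>\<alpha>=1..r. h \<alpha> x (X x) (Y x) *\<^sub>R N \<alpha> x)"
      if "vector_field A V X" "vector_field A V Y" for X Y
      using U V x that unfolding second_fundamental_tensors_def S.second_fundamental_form_def by fastforce
    have X: "vector_field A V X" and Y: "vector_field A V Y" and oV: "open V" using V by auto
    note JX = S.restrict_endo_vector_field[OF oV X] and JY = S.restrict_endo_vector_field[OF oV Y]
    have Jsff: "J (f x) (S.second_fundamental_form X Y x) = (\<Sum>\<alpha>=1..r. h \<alpha> x (X x) (Y x) *\<^sub>R J (f x) (N \<alpha> x))"
      unfolding sff[OF X Y]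
      by (subst S.N.endomorphism_sum[OF S.endo])
         (simp_all only: S.N.endomorphism_scaleR[OF S.endo] tN S.N.tangent_scaleR cong: sum.cong)
    show "(\<Sum>\<alpha>=1..r. h \<alpha> x (X x) (S.JM x (Y x)) *\<^sub>R N \<alpha> x) =
        (\<Sum>\<alpha>=1..r. h \<alpha> x (X x) (Y x) *\<^sub>R J (f x) (N \<alpha> x))"
      using S.second_fundamental_form_endo_right[OF oV x X Y] unfolding Jsff sff[OF X JY] .
    show "(\<Sum>\<alpha>=1..r. h \<alpha> x (X x) (Y x) *\<^sub>R J (f x) (N \<alpha> x)) =
        (\<Sum>\<alpha>=1..r. h \<alpha> x (S.JM x (X x)) (Y x) *\<^sub>R N \<alpha> x)"
      using S.second_fundamental_form_endo_left[OF oV x X Y] unfolding Jsff sff[OF JX Y] by (rule sym)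
    fix \<alpha> assume \<alpha>: "\<alpha> \<in> {1..r}"
    \<comment> \<open>Pairing with \<open>N \<alpha>\<close> extracts the coefficient of \<open>N \<alpha>\<close>.\<close>
    have coeff: "G (f x) (\<Sum>\<beta>=1..r. a \<beta> *\<^sub>R N \<beta> x) (N \<alpha> x) = a \<alpha>" for a
    proof -
      have "G (f x) (\<Sum>\<beta>=1..r. a \<beta> *\<^sub>R N \<beta> x) (N \<alpha> x) = (\<Sum>\<beta>=1..r. a \<beta> * G (f x) (N \<beta> x) (N \<alpha> x))"
        by (subst S.N.metric_sum_left)
           (simp_all only: S.N.metric_scaleR_left tN \<alpha> S.N.tangent_scaleR cong: sum.cong)
      also have "\<dots> = (\<Sum>\<beta>=1..r. if \<beta> = \<alpha> then a \<beta> else 0)"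
        by (intro sum.cong refl) (use \<alpha> orth in simp)
      finally show ?thesis using \<alpha> by simp
    qed
    have tsff: "S.second_fundamental_form X Y x \<in> tangent_space B (f x)"
      unfolding S.second_fundamental_form_def by (rule S.normal_spaceD(1)[OF S.gauss_formula[OF oV x X Y]])
    have "S.second_fundamental_form (\<lambda>y. S.JM y (X y)) (\<lambda>y. S.JM y (Y y)) x = J (f x) (J (f x) (S.second_fundamental_form X Y x))"
      unfolding S.second_fundamental_form_endo_right[OF oV x JX Y] S.second_fundamental_form_endo_left[OF oV x X Y] ..
    also have "\<dots> = real p *\<^sub>R S.second_fundamental_form X (\<lambda>y. S.JM y (Y y)) x + real q *\<^sub>R S.second_fundamental_form X Y x"
      unfolding S.second_fundamental_form_endo_right[OF oV x X Y] by (rule J2[OF tsff])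
    finally have "(\<Sum>\<beta>=1..r. h \<beta> x (S.JM x (X x)) (S.JM x (Y x)) *\<^sub>R N \<beta> x) =
        (\<Sum>\<beta>=1..r. (real p * h \<beta> x (X x) (S.JM x (Y x)) + real q * h \<beta> x (X x) (Y x)) *\<^sub>R N \<beta> x)"
      unfolding sff[OF JX JY] sff[OF X JY] sff[OF X Y]
      by (simp add: scaleR_sum_right scaleR_add_left sum.distrib)
    from arg_cong[OF this, of "\<lambda>w. G (f x) w (N \<alpha> x)"]
    show "h \<alpha> x (S.JM x (X x)) (S.JM x (Y x)) =
        real p * h \<alpha> x (X x) (S.JM x (Y x)) + real q * h \<alpha> x (X x) (Y x)"
      unfolding coeff .
  qed
qed

end
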